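(* Let $E$ be a Banach lattice and let $\mu$ be a locally finite Borel measure on $\mathbb{R}^d$. Assume that $E$ has the Hardy--Littlewood property and is $q$-convex for some $q\in(1,\infty)$. Then there is a constant $C_{E,q}$, depending only on $E$ and $q$ (the dimension $d$ being fixed), such that for each finite collection $\mathcal{D}$ of dyadic cubes in $\mathbb{R}^d$ and for each locally integrable function $f:\mathbb{R}^d\to E$ there exists a sparse collection $\mathcal{S}\subseteq\mathcal{D}$ such that $$ \bigl\|\widetilde{M}^\mu_{\mathcal{D}}f(x)\bigr\|_E \leq C_{E,q}\,\mathcal{A}^\mu_{q,\mathcal{S}}(\|f\|_E)(x)\qquad\text{for }\mu\text{-a.e. }x\in\mathbb{R}^d. $$
   Context: Dyadic cubes are the cubes of the standard dyadic system on $\mathbb{R}^d$, i.e. $2^{-k}([0,1)^d+m)$ with $k\in\mathbb{Z}$, $m\in\mathbb{Z}^d$. Local integrability of $f:\mathbb{R}^d\to E$ is with respect to $\mu$, in the Bochner sense; $\|f\|_E$ denotes the scalar function $x\mapsto\|f(x)\|_E$. For a cube $Q$, $\langle f\rangle^\mu_Q:=\frac{1}{\mu(Q)}\int_Q f\,\mathrm{d}\mu$ (cubes of $\mu$-measure zero are irrelevant for the $\mu$-a.e. statement; take the average to be $0$ there). Dyadic lattice Hardy--Littlewood maximal operator: for a finite collection $\mathcal{D}$ of dyadic cubes and locally integrable $f:\mathbb{R}^d\to E$, $$\widetilde{M}^\mu_{\mathcal{D}}f(x):=\sup_{Q\in\mathcal{D}}\langle|f|\rangle^\mu_Q\mathbf{1}_Q(x),\qquad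 x\in\mathbb{R}^d,$$ where the supremum and the absolute value are taken in the lattice sense in $E$. Sparse collection: a subcollection $\mathcal{S}\subseteq\mathcal{D}$ is sparse (with respect to $\mu$) if for every $S\in\mathcal{S}$ there is a measurable subset $E_S\subseteq S$ with $\mu(E_S)\geq\frac12\mu(S)$ such that the sets $\{E_S\}_{S\in\mathcal{S}}$ are pairwise disjoint. Sparse operator: for $q\in[1,\infty)$, a sparse collection $\mathcal{S}$ of dyadic cubes and locally integrable $g:\mathbb{R}^d\to\mathbb{R}$, $$\mathcal{A}^\mu_{q,\mathcal{S}}g(x):=\Bigl(\sum_{S\in\mathcal{S}}\bigl(\langle|g|\rangle^\mu_S\bigr)^q\mathbf{1}_S(x)\Bigr)^{1/q}.$$ Hardy--Littlewood property: $E$ has the Hardy--Littlewood property if for some $p\in(1,\infty)$, $$\sup_{\mathcal{D}}\bigl\|\widetilde{M}^{\mathrm{d}x}_{\mathcal{D}}\bigr\|_{L^p(\mathrm{d}x;E)\to L^p(\mathrm{d}x;E)}<\infty,$$ where the supremum is over all finite collections $\mathcal{D}$ of dyadic cubes in $\mathbb{R}^d$, $\mathrm{d}x$ is the Lebesgue measure on $\mathbb{R}^d$, and $L^p(\mathrm{d}x;E)$ is the Lebesgue--Bochner space. $q$-convexity: a Banach lattice $E$ is $q$-convex, $q\in[1,\infty)$, if there is a constant $C$ (depending on $E$ and $q$) such that $$\Bigl\|\Bigl(\sum_{k=1}^n|e_k|^q\Bigr)^{1/q}\Bigr\|_E\leq C\Bigl(\sum_{k=1}^n\|e_k\|_E^q\Bigr)^{1/q}$$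 for all $n\in\mathbb{N}$ and $e_1,\dots,e_n\in E$, where $\bigl(\sum_k|e_k|^q\bigr)^{1/q}$ is defined by the Krivine functional calculus (pointwise in a Banach function space). *)

theory Defs
  imports "HOL-Analysis.Analysis" "HOL-Library.Lattice_Algebras"
begin

section \<open>Banach lattices\<close>

class banach_lattice = banach + ordered_real_vector + lattice_ab_group_add_abs +
  assumes norm_mono_abs: "\<bar>x\<bar> \<le> \<bar>y\<bar> \<Longrightarrow> norm x \<le> norm y"

instance real :: banach_lattice
  by standard (auto simp: abs_if sup_real_def)

section \<open>Bochner integration without separability\<close>

text \<open>The Bochner integral of HOL-Analysis requires a second countable codomain. The definitions
  below are the usual ones for an arbitrary normed space, where strong measurability is meant up to
  null sets. Since \<^const>\<open>nn_integral\<close> does not change when the measure is completed, integrands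
  that are measurable only for the completion cause no problem.\<close>

definition strongly_measurable :: "'a measure \<Rightarrow> ('a \<Rightarrow> 'b::real_normed_vector) \<Rightarrow> bool" where
  "strongly_measurable M f \<longleftrightarrow>
    (\<exists>s. (\<forall>i. Bochner_Integration.simple_bochner_integrable M (s i)) \<and>
      (AE x in M. (\<lambda>i. s i x) \<longlonglongrightarrow> f x))"

definition has_bochner_int :: "'a measure \<Rightarrow> ('a \<Rightarrow> 'b::real_normed_vector) \<Rightarrow> 'b \<Rightarrow> bool" where
  "has_bochner_int M f v \<longleftrightarrow> strongly_measurable M f \<and>
    (\<exists>s. (\<forall>i. Bochner_Integration.simple_bochner_integrable M (s i)) \<and>
      (\<lambda>i. \<integral>\<^sup>+x. norm (f x - s i x) \<partial>M) \<longlonglongrightarrow> 0 \<and>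
      (\<lambda>i. Bochner_Integration.simple_bochner_integral M (s i)) \<longlonglongrightarrow> v)"

definition bochner_integrable :: "'a measure \<Rightarrow> ('a \<Rightarrow> 'b::real_normed_vector) \<Rightarrow> bool" where
  "bochner_integrable M f \<longleftrightarrow> (\<exists>v. has_bochner_int M f v)"

definition bochner_int :: "'a measure \<Rightarrow> ('a \<Rightarrow> 'b::real_normed_vector) \<Rightarrow> 'b" where
  "bochner_int M f = (THE v. has_bochner_int M f v)"

definition locally_integrable ::
    "('a::topological_space) measure \<Rightarrow> ('a \<Rightarrow> 'b::real_normed_vector) \<Rightarrow> bool" where
  "locally_integrable M f \<longleftrightarrow>
    (\<forall>K. compact K \<longrightarrow> bochner_integrable M (\<lambda>x. indicator K x *\<^sub>R f x))"

definition locally_finite_borel :: "('a::topological_space) measure \<Rightarrow> bool" where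
  "locally_finite_borel M \<longleftrightarrow> sets M = sets borel \<and>
    (\<forall>x. \<exists>U. open U \<and> x \<in> U \<and> emeasure M U < \<infinity>)"

definition in_Lp :: "'a measure \<Rightarrow> real \<Rightarrow> ('a \<Rightarrow> 'b::real_normed_vector) \<Rightarrow> bool" where
  "in_Lp M p f \<longleftrightarrow> strongly_measurable M f \<and> (\<integral>\<^sup>+x. norm (f x) powr p \<partial>M) < \<infinity>"

definition Lp_norm :: "'a measure \<Rightarrow> real \<Rightarrow> ('a \<Rightarrow> 'b::real_normed_vector) \<Rightarrow> real" where
  "Lp_norm M p f = enn2real (\<integral>\<^sup>+x. norm (f x) powr p \<partial>M) powr (1 / p)"

section \<open>Dyadic cubes, maximal and sparse operators\<close>

definition dyadic_cube :: "int \<Rightarrow> int ^ 'n \<Rightarrow> (real ^ 'n) set" where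
  "dyadic_cube k m =
    (\<lambda>y. (2 powi (-k)) *\<^sub>R (y + (\<chi> i. of_int (m $ i)))) ` {y. \<forall>i. 0 \<le> y $ i \<and> y $ i < 1}"

definition dyadic_cubes :: "(real ^ 'n) set set" where
  "dyadic_cubes = {dyadic_cube k m |k m. True}"

text \<open>Division by zero yields the average 0 on null sets.\<close>

definition average :: "'a measure \<Rightarrow> 'a set \<Rightarrow> ('a \<Rightarrow> 'b::real_normed_vector) \<Rightarrow> 'b" where
  "average M Q f = (1 / measure M Q) *\<^sub>R bochner_int M (\<lambda>x. indicator Q x *\<^sub>R f x)"

text \<open>All members of the family are nonnegative, so inserting 0 into it changes the supremum
  only for the empty collection, where it gives the value 0.\<close>

definition lattice_maximal ::
    "'a measure \<Rightarrow> 'a set set \<Rightarrow> ('a \<Rightarrow> 'e::banach_lattice) \<Rightarrow> 'a \<Rightarrow> 'e" where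
  "lattice_maximal M \<D> f x =
    Sup_fin (insert 0 ((\<lambda>Q. indicator Q x *\<^sub>R average M Q (\<lambda>y. \<bar>f y\<bar>)) ` \<D>))"

definition sparse_collection :: "'a measure \<Rightarrow> 'a set set \<Rightarrow> bool" where
  "sparse_collection M \<S> \<longleftrightarrow> (\<exists>E. disjoint_family_on E \<S> \<and>
    (\<forall>S\<in>\<S>. E S \<in> sets M \<and> E S \<subseteq> S \<and> emeasure M (E S) \<ge> emeasure M S / 2))"

text \<open>Meant for finite \<open>\<S>\<close>.\<close>

definition sparse_operator ::
    "'a measure \<Rightarrow> real \<Rightarrow> 'a set set \<Rightarrow> ('a \<Rightarrow> real) \<Rightarrow> 'a \<Rightarrow> real" where
  "sparse_operator M q \<S> g x =
    (\<Sum>S\<in>\<S>. (average M S (\<lambda>y. \<bar>g y\<bar>)) powr q * indicator S x) powr (1 / q)"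

section \<open>Hardy--Littlewood property\<close>

text \<open>The type arguments are the index type of the coordinates of the domain and the lattice.\<close>

definition hardy_littlewood_property :: "'n::finite itself \<Rightarrow> 'e::banach_lattice itself \<Rightarrow> bool" where
  "hardy_littlewood_property _ _ \<longleftrightarrow>
    (\<exists>p>1. \<exists>C. \<forall>\<D> \<subseteq> (dyadic_cubes :: (real ^ 'n) set set). finite \<D> \<longrightarrow>
      (\<forall>f :: real ^ 'n \<Rightarrow> 'e. in_Lp lborel p f \<longrightarrow>
        in_Lp lborel p (lattice_maximal lborel \<D> f) \<and>
        Lp_norm lborel p (lattice_maximal lborel \<D> f) \<le> C * Lp_norm lborel p f))"

section \<open>Krivine functional calculus and q-convexity\<close>

text \<open>The continuous positively homogeneous functions on n-dimensional space. A point is a sequence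
  of which only the first \<open>n\<close> entries matter; for functions depending only on these, continuity in
  the product topology is ordinary continuity in \<open>n\<close> variables.\<close>

definition krivine_functions :: "nat \<Rightarrow> ((nat \<Rightarrow> real) \<Rightarrow> real) set" where
  "krivine_functions n = {h. continuous_on UNIV h \<and>
    (\<forall>x y. (\<forall>k<n. x k = y k) \<longrightarrow> h x = h y) \<and>
    (\<forall>t\<ge>0. \<forall>x. h (\<lambda>k. t * x k) = t * h x)}"

definition is_krivine_calculus ::
    "nat \<Rightarrow> (nat \<Rightarrow> 'e::banach_lattice) \<Rightarrow> (((nat \<Rightarrow> real) \<Rightarrow> real) \<Rightarrow> 'e) \<Rightarrow> bool" where
  "is_krivine_calculus n e \<Phi> \<longleftrightarrow>
    (\<forall>k<n. \<Phi> (\<lambda>x. x k) = e k) \<and>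
    (\<forall>g\<in>krivine_functions n. \<forall>h\<in>krivine_functions n.
      \<Phi> (\<lambda>x. g x + h x) = \<Phi> g + \<Phi> h \<and>
      \<Phi> (\<lambda>x. sup (g x) (h x)) = sup (\<Phi> g) (\<Phi> h) \<and>
      \<Phi> (\<lambda>x. inf (g x) (h x)) = inf (\<Phi> g) (\<Phi> h)) \<and>
    (\<forall>a. \<forall>h\<in>krivine_functions n. \<Phi> (\<lambda>x. a * h x) = a *\<^sub>R \<Phi> h)"

text \<open>By Krivine's theorem the calculus exists and is unique on \<^const>\<open>krivine_functions\<close>; the
  choice below only concerns irrelevant values outside this set.\<close>

definition krivine :: "nat \<Rightarrow> (nat \<Rightarrow> 'e::banach_lattice) \<Rightarrow> ((nat \<Rightarrow> real) \<Rightarrow> real) \<Rightarrow> 'e" where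
  "krivine n e = (SOME \<Phi>. is_krivine_calculus n e \<Phi>)"

definition q_convex :: "'e::banach_lattice itself \<Rightarrow> real \<Rightarrow> bool" where
  "q_convex _ q \<longleftrightarrow> (\<exists>C. \<forall>n. \<forall>e :: nat \<Rightarrow> 'e.
    norm (krivine n e (\<lambda>x. (\<Sum>k<n. \<bar>x k\<bar> powr q) powr (1 / q)))
      \<le> C * (\<Sum>k<n. norm (e k) powr q) powr (1 / q))"

end

(* Idea. The Hardy--Littlewood property gives an L^p bound for step functions on dyadic cubes, that is,
   for martingales with 2^d equal splittings, and the Calderon--Zygmund decomposition turns it into
   a weak (1,1) bound. The corresponding Bellman function is bounded and midpoint concave in the mean
   value, hence concave; therefore the same weak (1,1) bound holds, with the same constant, for
   splittings in arbitrary proportions, i.e. for every locally finite measure. Stopping at the maximal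
   cubes P in Q for which the supremum of the averages over the cubes between P and Q has norm
   exceeding a multiple of the average of the norm over Q then gives a sparse family, and the
   maximal function is at most the supremum over this family of the stopped suprema, to which
   q-convexity applies. To use q-convexity one needs that the Krivine calculus exists; it is built
   directly from sup-inf combinations of linear forms, whose positivity is inherited from R^n to the
   lattice by Fourier--Motzkin elimination. *)
theory Submission
  imports Defs
begin

section \<open>Banach lattices\<close>

text \<open>The obstacle is that a general measure need not be doubling: the mean over a stopped
  cube is then not controlled by the mean over its parent. The Calderon--Zygmund step is therefore
  carried out only for equal splittings, where passing to a child costs at most the factor 2^d.
  Trees isolate this inequality from any measure: the Bellman function is the supremum of
  \<open>tree_bad T t s - c * tree_mean (map_dtree norm t)\<close> over all nonnegative trees with
  given mean, where \<open>s\<close> is the supremum collected so far. With \<open>c = C / T\<close>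
  the weak (1,1) bound says that it is at most 0 for \<open>s = 0\<close>. Midpoint concavity yields
  concavity without any continuity, since one-leaf trees bound the function from below on segments.
  Constants: the p-th power of the Hardy--Littlewood constant is the strong bound \<open>K\<close>;
  the weak bound is \<open>C = K * 2^(d(p-1)) + 1\<close>; the stopping factor
  \<open>L = max 1 (2 * C)\<close> lets the stopped cubes cover at most half of a cube; q-convexity
  adds a factor \<open>B\<close>. The result is \<open>B * L\<close>, and none of these depends on
  the measure.\<close>

lemma inf_sup_distrib_lattice_group:
  fixes a b c :: "'a::lattice_ab_group_add"
  shows "inf (sup a b) c = sup (inf a c) (inf b c)"
proof (rule antisym)
  let ?u = "sup (inf a c) (inf b c)" and ?s = "sup (sup a b) c"
  \<comment> \<open>Distributivity comes from the group identity
    \<open>x + c = sup x c + inf x c\<close>: it gives a bound on \<open>x\<close> that is common to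
    \<open>a\<close> and \<open>b\<close>, hence valid for \<open>sup a b\<close>.\<close>
  have *: "x \<le> ?u + ?s - c" if "x = a \<or> x = b" for x
  proof -
    have "x + c = sup x c + inf x c" by (rule add_eq_inf_sup)
    then have "x = inf x c + sup x c - c" by (simp add: eq_diff_eq add.commute)
    also have "\<dots> \<le> ?u + ?s - c"
    proof (intro diff_right_mono add_mono)
      show "inf x c \<le> ?u" using that by auto
      have "x \<le> sup a b" using that by auto
      then show "sup x c \<le> ?s" by (rule sup_mono) simp
    qed
    finally show ?thesis .
  qed
  have "sup a b \<le> ?u + ?s - c"
    by (intro le_supI *) simp_all
  then have "sup a b + c \<le> ?u + ?s"
    by (simp only: le_diff_eq)
  moreover have "sup a b + c = inf (sup a b) c + ?s"
    using add_eq_inf_sup[of "sup a b" c] by (simp only: add.commute)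
  ultimately show "inf (sup a b) c \<le> ?u" by (simp only: add_le_cancel_right)
  show "?u \<le> inf (sup a b) c"
    by (intro le_supI inf_mono) simp_all
qed

text \<open>Multiplication by a positive \<open>c\<close> is an order isomorphism with inverse
  multiplication by \<open>1 / c\<close>, so monotonicity alone makes it commute with
  suprema.\<close>

lemma scaleR_sup:
  fixes x y :: "'e::banach_lattice"
  assumes "0 \<le> c"
  shows "c *\<^sub>R sup x y = sup (c *\<^sub>R x) (c *\<^sub>R y)"
proof (cases "c = 0")
  case False
  with assms have "c > 0" by simp
  have "sup x y \<le> (1 / c) *\<^sub>R sup (c *\<^sub>R x) (c *\<^sub>R y)"
  proof (rule le_supI)
    have "(1 / c) *\<^sub>R (c *\<^sub>R x) \<le> (1 / c) *\<^sub>R sup (c *\<^sub>R x) (c *\<^sub>R y)"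
      by (rule scaleR_left_mono) (use \<open>c > 0\<close> in auto)
    then show "x \<le> (1 / c) *\<^sub>R sup (c *\<^sub>R x) (c *\<^sub>R y)" using \<open>c > 0\<close> by simp
    have "(1 / c) *\<^sub>R (c *\<^sub>R y) \<le> (1 / c) *\<^sub>R sup (c *\<^sub>R x) (c *\<^sub>R y)"
      by (rule scaleR_left_mono) (use \<open>c > 0\<close> in auto)
    then show "y \<le> (1 / c) *\<^sub>R sup (c *\<^sub>R x) (c *\<^sub>R y)" using \<open>c > 0\<close> by simp
  qed
  then have "c *\<^sub>R sup x y \<le> c *\<^sub>R ((1 / c) *\<^sub>R sup (c *\<^sub>R x) (c *\<^sub>R y))"
    by (rule scaleR_left_mono) (use \<open>c > 0\<close> in auto)
  also have "\<dots> = sup (c *\<^sub>R x) (c *\<^sub>R y)" using \<open>c > 0\<close> by simp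
  finally show ?thesis
    by (intro antisym le_supI scaleR_left_mono) (use \<open>c > 0\<close> in auto)
qed simp

lemma scaleR_inf:
  fixes x y :: "'e::banach_lattice"
  assumes "0 \<le> c"
  shows "c *\<^sub>R inf x y = inf (c *\<^sub>R x) (c *\<^sub>R y)"
  using scaleR_sup[OF assms, of "-x" "-y"]
  by (simp only: inf_eq_neg_sup[of x y] inf_eq_neg_sup[of "c *\<^sub>R x"] scaleR_minus_right)

lemma norm_abs_lattice [simp]: "norm \<bar>x\<bar> = norm (x :: 'e::banach_lattice)"
  by (intro antisym norm_mono_abs) simp_all

lemma norm_mono_nonneg:
  fixes x y :: "'e::banach_lattice"
  shows "0 \<le> x \<Longrightarrow> x \<le> y \<Longrightarrow> norm x \<le> norm y"
  by (intro norm_mono_abs) (simp add: abs_of_nonneg)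

lemma norm_abs_diff_le: "norm (\<bar>x\<bar> - \<bar>y\<bar>) \<le> norm (x - y :: 'e::banach_lattice)"
  by (intro norm_mono_abs abs_triangle_ineq3)

lemma tendsto_abs_lattice:
  fixes f :: "'a \<Rightarrow> 'e::banach_lattice"
  assumes "(f \<longlongrightarrow> l) F"
  shows "((\<lambda>x. \<bar>f x\<bar>) \<longlongrightarrow> \<bar>l\<bar>) F"
proof -
  have "((\<lambda>x. norm (f x - l)) \<longlongrightarrow> 0) F"
    using assms by (metis Lim_null tendsto_norm_zero)
  then have "((\<lambda>x. \<bar>f x\<bar> - \<bar>l\<bar>) \<longlongrightarrow> 0) F"
    by (rule Lim_null_comparison[rotated]) (simp add: norm_abs_diff_le)
  then show ?thesis by (simp add: Lim_null[symmetric])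
qed

text \<open>The positive cone is the fixed-point set of the continuous map \<open>abs\<close>, hence
  closed.\<close>

lemma tendsto_nonneg_lattice:
  fixes f :: "'a \<Rightarrow> 'e::banach_lattice"
  assumes "(f \<longlongrightarrow> l) F" "F \<noteq> bot" "\<And>x. 0 \<le> f x"
  shows "0 \<le> l"
proof -
  have "(f \<longlongrightarrow> \<bar>l\<bar>) F"
    using tendsto_abs_lattice[OF assms(1)] assms(3) by (simp add: abs_of_nonneg)
  then have "l = \<bar>l\<bar>" using assms(1,2) tendsto_unique by blast
  then show ?thesis by (metis abs_ge_zero)
qed

text \<open>A Lipschitz estimate in the order rather than in the norm: it lets approximations in the
  Krivine calculus pass through \<open>sup\<close> by the same argument for real functions and for
  lattice elements.\<close>

lemma abs_sup_diff_le:
  fixes a b c d :: "'a::lattice_ab_group_add_abs"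
  shows "\<bar>sup a b - sup c d\<bar> \<le> \<bar>a - c\<bar> + \<bar>b - d\<bar>"
proof -
  have *: "sup a b \<le> sup c d + (\<bar>a - c\<bar> + \<bar>b - d\<bar>)" for a b c d :: 'a
  proof (rule le_supI)
    have "a = c + (a - c)" by simp
    also have "\<dots> \<le> sup c d + (\<bar>a - c\<bar> + \<bar>b - d\<bar>)"
      by (intro add_mono) (auto intro: order_trans[OF abs_ge_self] simp: add_increasing2)
    finally show "a \<le> sup c d + (\<bar>a - c\<bar> + \<bar>b - d\<bar>)" .
    have "b = d + (b - d)" by simp
    also have "\<dots> \<le> sup c d + (\<bar>a - c\<bar> + \<bar>b - d\<bar>)"
      by (intro add_mono) (auto intro: order_trans[OF abs_ge_self] simp: add_increasing)
    finally show "b \<le> sup c d + (\<bar>a - c\<bar> + \<bar>b - d\<bar>)" .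
  qed
  show ?thesis
  proof (rule abs_leI)
    show "sup a b - sup c d \<le> \<bar>a - c\<bar> + \<bar>b - d\<bar>"
      using *[of a b c d] by (simp only: diff_le_eq add.commute)
    show "- (sup a b - sup c d) \<le> \<bar>a - c\<bar> + \<bar>b - d\<bar>"
      using *[of c d a b] by (simp only: minus_diff_eq diff_le_eq add.commute abs_minus_commute)
  qed
qed

lemma abs_inf_diff_le:
  fixes a b c d :: "'a::lattice_ab_group_add_abs"
  shows "\<bar>inf a b - inf c d\<bar> \<le> \<bar>a - c\<bar> + \<bar>b - d\<bar>"
proof -
  have "inf a b - inf c d = - (sup (-a) (-b) - sup (-c) (-d))"
    by (simp only: inf_eq_neg_sup[of a b] inf_eq_neg_sup[of c d]) simp
  then have "\<bar>inf a b - inf c d\<bar> = \<bar>sup (-a) (-b) - sup (-c) (-d)\<bar>"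
    by (simp only: abs_minus_cancel)
  also have "\<dots> \<le> \<bar>- a - - c\<bar> + \<bar>- b - - d\<bar>"
    by (rule abs_sup_diff_le)
  finally show ?thesis by (simp add: abs_minus_commute)
qed

section \<open>Sup-inf combinations of linear forms\<close>

lemma finite_sets_separation:
  fixes A B :: "real set"
  assumes "finite A" "finite B" "\<And>a b. a \<in> A \<Longrightarrow> b \<in> B \<Longrightarrow> a < b"
  shows "\<exists>t. (\<forall>a\<in>A. a < t) \<and> (\<forall>b\<in>B. t < b)"
proof (cases "A = {} \<or> B = {}")
  case True
  have "\<forall>b\<in>B. Min (insert 0 B) - 1 < b"
  proof
    fix b assume "b \<in> B"
    then have "Min (insert 0 B) \<le> b" using assms(2) by (intro Min_le) auto
    then show "Min (insert 0 B) - 1 < b" by simp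
  qed
  moreover have "\<forall>a\<in>A. a < Max (insert 0 A) + 1"
  proof
    fix a assume "a \<in> A"
    then have "a \<le> Max (insert 0 A)" using assms(1) by (intro Max_ge) auto
    then show "a < Max (insert 0 A) + 1" by simp
  qed
  ultimately show ?thesis using True by blast
next
  case False
  then have "Max A < Min B" using assms by simp
  then obtain t where "Max A < t" "t < Min B" using dense by blast
  then show ?thesis using assms(1,2) False by (auto intro!: exI[of _ t])
qed

text \<open>Fourier--Motzkin elimination of the last variable.\<close>

lemma linear_forms_bound_nonneg:
  fixes e :: "nat \<Rightarrow> 'e::ordered_real_vector" and L :: "(nat \<Rightarrow> real) set"
  assumes "finite L" "\<And>x. \<exists>l\<in>L. 0 \<le> (\<Sum>k<n. l k * x k)"
    and "\<And>l. l \<in> L \<Longrightarrow> (\<Sum>k<n. l k *\<^sub>R e k) \<le> u"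
  shows "0 \<le> u"
  using assms
proof (induction n arbitrary: L)
  case 0
  then show ?case by fastforce
next
  case (Suc n)
  \<comment> \<open>The convex combination of a form with positive and a form with negative last
    coefficient in which the last coefficients cancel.\<close>
  define comb where "comb = (\<lambda>l l' k. (- l' n / (l n - l' n)) * l k + (l n / (l n - l' n)) * l' k :: real)"
  define P where "P = {l\<in>L. l n > 0}"
  define N where "N = {l\<in>L. l n < 0}"
  define L' where "L' = {l\<in>L. l n = 0} \<union> (\<lambda>(l, l'). comb l l') ` (P \<times> N)"
  have fin: "finite P" "finite N" using Suc.prems(1) by (auto simp: P_def N_def)
  have comb_sum: "(\<Sum>k<n. comb l l' k * x k) =
      (- l' n / (l n - l' n)) * (\<Sum>k<n. l k * x k) + (l n / (l n - l' n)) * (\<Sum>k<n. l' k * x k)"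
    for l l' x
    by (simp only: comb_def distrib_right sum.distrib sum_distrib_left mult.assoc)
  show ?case
  proof (rule Suc.IH[of L'])
    show "finite L'" using fin Suc.prems(1) by (auto simp: L'_def)
  next
    fix x :: "nat \<Rightarrow> real"
    show "\<exists>l\<in>L'. 0 \<le> (\<Sum>k<n. l k * x k)"
    proof (rule ccontr)
      assume "\<not> ?thesis"
      then have neg: "(\<Sum>k<n. l k * x k) < 0" if "l \<in> L'" for l using that by force
      define S where "S = (\<lambda>l. \<Sum>k<n. l k * x k)"
      \<comment> \<open>If every form of \<open>L'\<close> is negative at \<open>x\<close>, some
        value \<open>t\<close> of the last variable makes every form of \<open>L\<close> negative:
        \<open>N\<close> bounds \<open>t\<close> from below, \<open>P\<close> from above, and each
        pair of bounds is compatible because the corresponding \<open>comb\<close> is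
        negative.\<close>
      have "\<exists>t. (\<forall>a\<in>(\<lambda>l. S l / (- l n)) ` N. a < t) \<and> (\<forall>b\<in>(\<lambda>l. - S l / l n) ` P. t < b)"
      proof (rule finite_sets_separation)
        fix a b assume "a \<in> (\<lambda>l. S l / (- l n)) ` N" "b \<in> (\<lambda>l. - S l / l n) ` P"
        then obtain l l' where l: "l \<in> P" "l' \<in> N" and ab: "a = S l' / (- l' n)" "b = - S l / l n"
          by blast
        have "comb l l' \<in> L'" using l by (auto simp: L'_def)
        from neg[OF this] have "(- l' n / (l n - l' n)) * S l + (l n / (l n - l' n)) * S l' < 0"
          by (simp add: comb_sum S_def)
        moreover have pos: "l n > 0" "l' n < 0" using l by (auto simp: P_def N_def)
        ultimately have "(- l' n * S l + l n * S l') / (l n - l' n) < 0"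
          by (simp add: diff_divide_distrib)
        then have "- l' n * S l + l n * S l' < 0"
          using pos by (simp add: divide_less_0_iff)
        then show "a < b" unfolding ab using pos
          by (simp add: field_simps)
      qed (use fin in auto)
      then obtain t where t: "\<And>l. l \<in> N \<Longrightarrow> S l / (- l n) < t" "\<And>l. l \<in> P \<Longrightarrow> t < - S l / l n"
        by blast
      obtain l where l: "l \<in> L" "0 \<le> (\<Sum>k<Suc n. l k * (x(n := t)) k)"
        using Suc.prems(2) by blast
      have "(\<Sum>k<n. l k * (x(n := t)) k) = S l" unfolding S_def by (intro sum.cong) auto
      with l(2) have ge: "0 \<le> S l + l n * t" by simp
      consider "l n > 0" | "l n = 0" | "l n < 0" by linarith
      then show False
      proof cases
        case 1
        with t(2)[of l] l ge show False by (simp add: P_def field_simps)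
      next
        case 2
        with neg[of l] l ge show False by (simp add: L'_def S_def)
      next
        case 3
        with t(1)[of l] l ge show False by (simp add: N_def field_simps)
      qed
    qed
  next
    fix l assume "l \<in> L'"
    then consider "l \<in> L" "l n = 0" | p m where "p \<in> P" "m \<in> N" "l = comb p m"
      by (auto simp: L'_def)
    then show "(\<Sum>k<n. l k *\<^sub>R e k) \<le> u"
    proof cases
      case 1
      then show ?thesis using Suc.prems(3)[of l] by simp
    next
      case 2
      then have pos: "p n > 0" "m n < 0" and pm: "p \<in> L" "m \<in> L" by (auto simp: P_def N_def)
      let ?a = "- m n / (p n - m n)" and ?b = "p n / (p n - m n)"
      \<comment> \<open>Convexity of the combination is what lets the upper bound \<open>u\<close>
        survive the elimination.\<close>
      have ab: "?a + ?b = 1"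
        using pos by (subst add_divide_distrib[symmetric]) simp
      have nn: "0 \<le> ?a" "0 \<le> ?b"
        using pos by (intro divide_nonneg_nonneg; simp)+
      have "l n = 0" using 2(3) by (simp add: comb_def field_simps)
      then have "(\<Sum>k<n. l k *\<^sub>R e k) = (\<Sum>k<Suc n. l k *\<^sub>R e k)" by simp
      also have "\<dots> = ?a *\<^sub>R (\<Sum>k<Suc n. p k *\<^sub>R e k) + ?b *\<^sub>R (\<Sum>k<Suc n. m k *\<^sub>R e k)"
        unfolding 2(3) comb_def scaleR_add_left sum.distrib scaleR_sum_right scaleR_scaleR ..
      also have "\<dots> \<le> ?a *\<^sub>R u + ?b *\<^sub>R u"
        by (intro add_mono scaleR_left_mono Suc.prems(3) pm nn)
      also have "\<dots> = u" using ab by (metis scaleR_add_left scaleR_one)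
      finally show ?thesis .
    qed
  qed
qed

text \<open>A pair of a lattice-linear function on n-space and its value at \<open>e\<close> in the lattice.\<close>

inductive inf_form :: "nat \<Rightarrow> (nat \<Rightarrow> 'e::banach_lattice) \<Rightarrow> ((nat \<Rightarrow> real) \<Rightarrow> real) \<Rightarrow> 'e \<Rightarrow> bool"
  for n e where
  linear: "inf_form n e (\<lambda>x. \<Sum>k<n. c k * x k) (\<Sum>k<n. c k *\<^sub>R e k)"
| inf: "inf_form n e g u \<Longrightarrow> inf_form n e h v \<Longrightarrow> inf_form n e (\<lambda>x. inf (g x) (h x)) (inf u v)"

text \<open>Suprema of infima of linear forms are a normal form, which reduces positivity to infima.
  A relation is used because a function has many such representations; that they all have the same
  value follows only from \<open>lattice_form_close\<close> with error 0.\<close>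

inductive lattice_form :: "nat \<Rightarrow> (nat \<Rightarrow> 'e::banach_lattice) \<Rightarrow> ((nat \<Rightarrow> real) \<Rightarrow> real) \<Rightarrow> 'e \<Rightarrow> bool"
  for n e where
  inf_form: "inf_form n e g u \<Longrightarrow> lattice_form n e g u"
| sup: "lattice_form n e g u \<Longrightarrow> lattice_form n e h v \<Longrightarrow>
    lattice_form n e (\<lambda>x. sup (g x) (h x)) (sup u v)"

lemma inf_form_add:
  assumes "inf_form n e g u" "inf_form n e h v"
  shows "inf_form n e (\<lambda>x. g x + h x) (u + v)"
  using assms
proof (induction arbitrary: h v)
  case (linear c)
  from linear.prems show ?case
  proof induction
    case (linear d)
    show ?case
      using inf_form.linear[of n e "\<lambda>k. c k + d k"]
      by (simp add: algebra_simps sum.distrib)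
  next
    case (inf g u h v)
    show ?case
      using inf_form.inf[OF inf.IH] by (simp add: add_inf_distrib_left)
  qed
next
  case (inf g u h' v')
  show ?case
    using inf_form.inf[OF inf.IH(1)[OF inf.prems] inf.IH(2)[OF inf.prems]]
    by (simp add: add_inf_distrib_right)
qed

lemma lattice_form_add:
  assumes "lattice_form n e g u" "lattice_form n e h v"
  shows "lattice_form n e (\<lambda>x. g x + h x) (u + v)"
  using assms
proof (induction arbitrary: h v)
  case (inf_form g u)
  from inf_form.prems show ?case
  proof induction
    case (inf_form h v)
    then show ?case using \<open>inf_form n e g u\<close>
      by (auto intro: lattice_form.inf_form inf_form_add)
  next
    case (sup h v h' v')
    show ?case
      using lattice_form.sup[OF sup.IH] by (simp add: add_sup_distrib_left)
  qed
next
  case (sup g u g' u')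
  show ?case
    using lattice_form.sup[OF sup.IH(1)[OF sup.prems] sup.IH(2)[OF sup.prems]]
    by (simp add: add_sup_distrib_right)
qed

text \<open>Distributivity pushes the infimum below the suprema, back into the normal form.\<close>

lemma lattice_form_inf:
  assumes "lattice_form n e g u" "lattice_form n e h v"
  shows "lattice_form n e (\<lambda>x. inf (g x) (h x)) (inf u v)"
  using assms
proof (induction arbitrary: h v)
  case (inf_form g u)
  from inf_form.prems show ?case
  proof induction
    case (inf_form h v)
    then show ?case using \<open>inf_form n e g u\<close>
      by (auto intro: lattice_form.inf_form inf_form.inf)
  next
    case (sup h v h' v')
    show ?case
      using lattice_form.sup[OF sup.IH]
      by (simp add: inf_commute[of u] inf_commute[of "g _"] inf_sup_distrib_lattice_group)
  qed
next
  case (sup g u g' u')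
  show ?case
    using lattice_form.sup[OF sup.IH(1)[OF sup.prems] sup.IH(2)[OF sup.prems]]
    by (simp add: inf_sup_distrib_lattice_group)
qed

lemma lattice_form_linear: "lattice_form n e (\<lambda>x. \<Sum>k<n. c k * x k) (\<Sum>k<n. c k *\<^sub>R e k)"
  by (intro lattice_form.inf_form inf_form.linear)

lemma lattice_form_uminus:
  assumes "lattice_form n e g u"
  shows "lattice_form n e (\<lambda>x. - g x) (- u)"
  using assms
proof induction
  case (inf_form g u)
  then show ?case
  proof induction
    case (linear c)
    show ?case using lattice_form_linear[of n e "\<lambda>k. - c k"] by (simp add: sum_negf)
  next
    case (inf g u h v)
    show ?case using lattice_form.sup[OF inf.IH] by (simp add: neg_inf_eq_sup)
  qed
next
  case (sup g u h v)
  show ?case using lattice_form_inf[OF sup.IH] by (simp add: neg_sup_eq_inf)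
qed

lemma lattice_form_scaleR_nonneg:
  assumes "lattice_form n e g u" "0 \<le> a"
  shows "lattice_form n e (\<lambda>x. a * g x) (a *\<^sub>R u)"
  using assms(1)
proof induction
  case (inf_form g u)
  then show ?case
  proof induction
    case (linear c)
    show ?case using lattice_form_linear[of n e "\<lambda>k. a * c k"]
      by (simp add: sum_distrib_left scaleR_sum_right mult.assoc)
  next
    case (inf g u h v)
    show ?case using lattice_form_inf[OF inf.IH] \<open>0 \<le> a\<close>
      scaleR_inf[OF \<open>0 \<le> a\<close>, of "g _" "h _"] scaleR_inf[OF \<open>0 \<le> a\<close>, of u v] by simp
  qed
next
  case (sup g u h v)
  show ?case using lattice_form.sup[OF sup.IH]
      scaleR_sup[OF \<open>0 \<le> a\<close>, of "g _" "h _"] scaleR_sup[OF \<open>0 \<le> a\<close>, of u v] by simp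
qed

lemma lattice_form_scaleR:
  assumes "lattice_form n e g u"
  shows "lattice_form n e (\<lambda>x. a * g x) (a *\<^sub>R u)"
proof (cases "0 \<le> a")
  case False
  then show ?thesis
    using lattice_form_uminus[OF lattice_form_scaleR_nonneg[OF assms, of "-a"]] by simp
qed (simp add: lattice_form_scaleR_nonneg assms)

lemma lattice_form_diff:
  assumes "lattice_form n e g u" "lattice_form n e h v"
  shows "lattice_form n e (\<lambda>x. g x - h x) (u - v)"
  using lattice_form_add[OF assms(1) lattice_form_uminus[OF assms(2)]] by simp

lemma lattice_form_abs:
  assumes "lattice_form n e g u"
  shows "lattice_form n e (\<lambda>x. \<bar>g x\<bar>) \<bar>u\<bar>"
  using lattice_form.sup[OF assms lattice_form_uminus[OF assms]]
  by (simp add: abs_lattice)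

lemma lattice_form_coordinate:
  assumes "j < n"
  shows "lattice_form n e (\<lambda>x. x j) (e j)"
proof -
  have "(\<Sum>k<n. (if k = j then 1 else 0) * x k) = x j" for x :: "nat \<Rightarrow> real"
    using assms by (simp add: if_distrib[of "\<lambda>c. c * _"] cong: if_cong)
  moreover have "(\<Sum>k<n. (if k = j then 1 else 0) *\<^sub>R e k) = e j"
    using assms by (simp add: if_distrib[of "\<lambda>c. c *\<^sub>R _"] cong: if_cong)
  ultimately show ?thesis
    using lattice_form_linear[of n e "\<lambda>k. if k = j then 1 else 0"] by simp
qed

lemma lattice_form_zero: "lattice_form n e (\<lambda>x. 0) 0"
  using lattice_form_linear[of n e "\<lambda>k. 0"] by simp

lemma lattice_form_sum:
  assumes "finite I" "\<And>i. i \<in> I \<Longrightarrow> lattice_form n e (g i) (u i)"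
  shows "lattice_form n e (\<lambda>x. \<Sum>i\<in>I. g i x) (\<Sum>i\<in>I. u i)"
  using assms
  by (induction I rule: finite_induct) (auto simp: lattice_form_zero intro!: lattice_form_add)

lemma lattice_form_Inf:
  assumes "finite I" "I \<noteq> {}" "\<And>i. i \<in> I \<Longrightarrow> lattice_form n e (g i) (u i)"
  shows "\<exists>h v. lattice_form n e h v \<and> (\<forall>x. \<forall>i\<in>I. h x \<le> g i x) \<and> (\<forall>x. \<exists>i\<in>I. h x = g i x)"
  using assms
proof (induction I rule: finite_ne_induct)
  case (singleton i)
  then show ?case by fastforce
next
  case (insert i I)
  then obtain h v where h: "lattice_form n e h v" "\<forall>x. \<forall>i\<in>I. h x \<le> g i x" "\<forall>x. \<exists>i\<in>I. h x = g i x"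
    by fastforce
  have "lattice_form n e (\<lambda>x. inf (g i x) (h x)) (inf (u i) v)"
    using insert h by (intro lattice_form_inf) auto
  moreover have "\<exists>j\<in>insert i I. inf (g i x) (h x) = g j x" for x
    using h(3) by (metis inf_real_def insertCI min_def)
  ultimately show ?case using h(2)
    by (intro exI[of _ "\<lambda>x. inf (g i x) (h x)"] exI[of _ "inf (u i) v"]) (auto intro: le_infI2)
qed

lemma lattice_form_homogeneous:
  assumes "lattice_form n e g u" "0 \<le> t"
  shows "g (\<lambda>k. t * x k) = t * g x"
  using assms(1)
proof induction
  case (inf_form g u)
  then show ?case
  proof induction
    case (linear c)
    show ?case by (simp add: sum_distrib_left algebra_simps)
  next
    case (inf g u h v)
    then show ?case using \<open>0 \<le> t\<close>
      by (auto simp: inf_real_def min_def mult_le_cancel_left)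
  qed
next
  case (sup g u h v)
  then show ?case using \<open>0 \<le> t\<close>
    by (auto simp: sup_real_def max_def mult_le_cancel_left)
qed

lemma lattice_form_cong:
  assumes "lattice_form n e g u" "\<And>k. k < n \<Longrightarrow> x k = y k"
  shows "g x = g y"
  using assms(1)
proof induction
  case (inf_form g u)
  then show ?case
    by induction (use assms(2) in \<open>auto intro: sum.cong\<close>)
qed simp

text \<open>Splits an infimum into the finite data that \<open>linear_forms_bound_nonneg\<close>
  takes after a change of sign.\<close>

lemma inf_form_minorant:
  assumes "inf_form n e g u"
  shows "\<exists>L. finite L \<and> (\<forall>x. \<exists>l\<in>L. g x = (\<Sum>k<n. l k * x k)) \<and> (\<forall>l\<in>L. u \<le> (\<Sum>k<n. l k *\<^sub>R e k))"
  using assms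
proof induction
  case (linear c)
  show ?case by (intro exI[of _ "{c}"]) auto
next
  case (inf g u h v)
  from inf.IH(1) obtain L where L: "finite L" "\<forall>x. \<exists>l\<in>L. g x = (\<Sum>k<n. l k * x k)"
    "\<forall>l\<in>L. u \<le> (\<Sum>k<n. l k *\<^sub>R e k)" by (elim exE conjE)
  from inf.IH(2) obtain L' where L': "finite L'" "\<forall>x. \<exists>l\<in>L'. h x = (\<Sum>k<n. l k * x k)"
    "\<forall>l\<in>L'. v \<le> (\<Sum>k<n. l k *\<^sub>R e k)" by (elim exE conjE)
  show ?case
  proof (intro exI[of _ "L \<union> L'"] conjI allI ballI)
    show "finite (L \<union> L')" using L L' by simp
    show "\<exists>l\<in>L \<union> L'. inf (g x) (h x) = (\<Sum>k<n. l k * x k)" for x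
    proof (cases "g x \<le> h x")
      case True
      then have "inf (g x) (h x) = g x" by (rule inf_absorb1)
      then show ?thesis using L(2) by (metis UnI1)
    next
      case False
      then have "inf (g x) (h x) = h x" by (intro inf_absorb2) simp
      then show ?thesis using L'(2) by (metis UnI2)
    qed
    show "inf u v \<le> (\<Sum>k<n. l k *\<^sub>R e k)" if "l \<in> L \<union> L'" for l
      using that L(3) L'(3) by (meson UnE le_infI1 le_infI2)
  qed
qed

text \<open>Nonpositivity is the sign to start from: a supremum is nonpositive iff both parts are,
  which leaves infima. For these, at each point some negated linear form is nonnegative, and
  elimination gives \<open>0 \<le> - u\<close>.\<close>

lemma lattice_form_nonpos:
  assumes "lattice_form n e g u" "\<And>x. g x \<le> 0"
  shows "u \<le> 0"
  using assms
proof induction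
  case (inf_form g u)
  from inf_form_minorant[OF inf_form.hyps] obtain L where L: "finite L"
      "\<forall>x. \<exists>l\<in>L. g x = (\<Sum>k<n. l k * x k)" "\<forall>l\<in>L. u \<le> (\<Sum>k<n. l k *\<^sub>R e k)"
    by (elim exE conjE)
  have "0 \<le> - u"
  proof (rule linear_forms_bound_nonneg)
    show "finite ((\<lambda>l k. - l k) ` L)" using L(1) by simp
    show "\<exists>l\<in>(\<lambda>l k. - l k) ` L. 0 \<le> (\<Sum>k<n. l k * x k)" for x
    proof -
      obtain l where "l \<in> L" "g x = (\<Sum>k<n. l k * x k)" using L(2) by (elim allE[of _ x] bexE)
      then show ?thesis using inf_form.prems[of x]
        by (intro bexI[of _ "\<lambda>k. - l k"] imageI) (simp_all add: sum_negf)
    qed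
    fix l assume "l \<in> (\<lambda>l k. - l k) ` L"
    then obtain m where "m \<in> L" "l = (\<lambda>k. - m k)" by (elim imageE)
    then show "(\<Sum>k<n. l k *\<^sub>R e k) \<le> - u" using L(3) by (simp add: sum_negf)
  qed
  then show ?case by (simp only: neg_0_le_iff_le)
next
  case (sup g u h v)
  have "g x \<le> 0" "h x \<le> 0" for x
    using sup.prems[of x] by (meson le_supE)+
  then show ?case using sup.IH by (meson le_supI)
qed

lemma lattice_form_nonneg:
  assumes "lattice_form n e g u" "\<And>x. 0 \<le> g x"
  shows "0 \<le> u"
proof -
  have "- u \<le> 0"
    by (rule lattice_form_nonpos[OF lattice_form_uminus[OF assms(1)]]) (simp add: assms(2))
  then show ?thesis by (simp only: neg_le_0_iff_le)
qed

section \<open>Existence of the Krivine calculus\<close>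

text \<open>Fixing the entries from \<open>n\<close> on to 0 makes the set compact in the product
  topology of sequences; a function in \<open>krivine_functions n\<close> does not see these
  entries.\<close>

definition l1_sphere :: "nat \<Rightarrow> (nat \<Rightarrow> real) set" where
  "l1_sphere n = {x. (\<forall>k\<ge>n. x k = 0) \<and> (\<Sum>k<n. \<bar>x k\<bar>) = 1}"

lemma compact_l1_sphere: "compact (l1_sphere n)"
proof -
  let ?B = "PiE UNIV (\<lambda>_. {-1..1}) :: (nat \<Rightarrow> real) set"
  have "compactin (product_topology (\<lambda>_. euclidean) UNIV) ?B"
    by (subst compactin_PiE) simp
  then have B: "compact ?B"
    by (simp only: euclidean_product_topology compactin_euclidean_iff)
  have "closed {x :: nat \<Rightarrow> real. n \<le> k \<longrightarrow> x k = 0}" for k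
    by (cases "n \<le> k") (auto intro!: closed_Collect_eq continuous_intros)
  then have "closed {x :: nat \<Rightarrow> real. \<forall>k. n \<le> k \<longrightarrow> x k = 0}"
    by (rule closed_Collect_all)
  moreover have "closed {x :: nat \<Rightarrow> real. (\<Sum>k<n. \<bar>x k\<bar>) = 1}"
    by (intro closed_Collect_eq continuous_intros continuous_on_product_coordinates)
  ultimately have cl: "closed (l1_sphere n)"
    unfolding l1_sphere_def by (intro closed_Collect_conj)
  have "l1_sphere n \<subseteq> ?B"
  proof
    fix x assume x: "x \<in> l1_sphere n"
    have "\<bar>x k\<bar> \<le> 1" for k
    proof (cases "k < n")
      case True
      then have "\<bar>x k\<bar> \<le> (\<Sum>k<n. \<bar>x k\<bar>)" by (intro member_le_sum) auto
      then show ?thesis using x by (simp add: l1_sphere_def)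
    qed (use x in \<open>simp add: l1_sphere_def\<close>)
    then show "x \<in> ?B" by (auto simp: abs_le_iff minus_le_iff)
  qed
  then have "l1_sphere n = ?B \<inter> l1_sphere n" by blast
  then show ?thesis using compact_Int_closed[OF B cl] by simp
qed

lemma krivine_functions_homogeneous:
  "h \<in> krivine_functions n \<Longrightarrow> 0 \<le> t \<Longrightarrow> h (\<lambda>k. t * x k) = t * h x"
  by (simp add: krivine_functions_def)

lemma krivine_functions_cong:
  "h \<in> krivine_functions n \<Longrightarrow> (\<And>k. k < n \<Longrightarrow> x k = y k) \<Longrightarrow> h x = h y"
  by (simp add: krivine_functions_def)

text \<open>The approximant is a minimum of cones: for large \<open>K\<close> the cone
  \<open>(h p + d) |x| + K |x - |x| p|\<close> lies above \<open>h\<close> and is close to it near \<open>p\<close>.\<close>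

lemma krivine_function_approx:
  fixes e :: "nat \<Rightarrow> 'e::banach_lattice"
  assumes h: "h \<in> krivine_functions n" and "0 < \<epsilon>"
  shows "\<exists>g w. lattice_form n e g w \<and> (\<forall>x. \<bar>h x - g x\<bar> \<le> \<epsilon> * (\<Sum>k<n. \<bar>x k\<bar>))"
proof -
  let ?S = "l1_sphere n"
  define d where "d = \<epsilon> / 3"
  have d: "d > 0" using \<open>0 < \<epsilon>\<close> by (simp add: d_def)
  define s :: "(nat \<Rightarrow> real) \<Rightarrow> real" where "s = (\<lambda>x. \<Sum>k<n. \<bar>x k\<bar>)"
  define D where "D = (\<lambda>p x. \<Sum>k<n. \<bar>x k - s x * p k\<bar>)"
  define G where "G = (\<lambda>p K x. (h p + d) * s x + K * D p x)"
  have s_S: "s x = 1" if "x \<in> ?S" for x using that by (simp add: s_def l1_sphere_def)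
  have D0: "0 \<le> D p x" for p x by (simp add: D_def sum_nonneg)
  have cont_h: "continuous_on UNIV h" using h by (simp add: krivine_functions_def)
  have cont_s: "continuous_on UNIV s"
    unfolding s_def by (intro continuous_intros continuous_on_product_coordinates)
  have cont_G: "continuous_on UNIV (G p K)" for p K
    unfolding G_def D_def
    by (intro continuous_intros continuous_on_product_coordinates cont_s)
  \<comment> \<open>First use of compactness: at each point of the sphere \<open>h\<close> lies
    below some cone with apex \<open>p\<close>, by the margin \<open>d\<close> at \<open>p\<close>
    and for large \<open>K\<close> elsewhere. As the cones increase with \<open>K\<close>, one
    \<open>K\<close> serves all points.\<close>
  have "\<exists>K\<ge>0. \<forall>x\<in>?S. h x < G p K x" if p: "p \<in> ?S" for p
  proof -
    have "\<exists>C\<subseteq>UNIV. finite C \<and> ?S \<subseteq> (\<Union>K\<in>C. {x. h x < G p (real K) x})"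
    proof (rule compactE_image[OF compact_l1_sphere, of UNIV "\<lambda>K. {x. h x < G p (real K) x}" n])
      show "open {x. h x < G p (real K) x}" for K
        by (intro open_Collect_less cont_h cont_G)
      show "?S \<subseteq> (\<Union>K. {x. h x < G p (real K) x})"
      proof
        fix x assume x: "x \<in> ?S"
        show "x \<in> (\<Union>K. {x. h x < G p (real K) x})"
        proof (cases "x = p")
          case True
          then have "h x < G p (real 0) x" using d x by (simp add: G_def s_S)
          then show ?thesis by blast
        next
          case False
          then obtain k where k: "x k \<noteq> p k" by blast
          then have "k < n" using x p by (metis (mono_tags) l1_sphere_def linorder_not_less mem_Collect_eq)
          then have "\<bar>x k - s x * p k\<bar> \<le> D p x" unfolding D_def
            by (intro member_le_sum) auto
          moreover have "0 < \<bar>x k - s x * p k\<bar>" using k x by (simp add: s_S)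
          ultimately have "0 < D p x" by linarith
          then obtain K :: nat where "h x - (h p + d) * s x < real K * D p x"
            using ex_less_of_nat_mult by blast
          then have "h x < G p (real K) x" by (simp add: G_def)
          then show ?thesis by blast
        qed
      qed
    qed (metis subset_UNIV)
    then obtain C where C: "finite C" "?S \<subseteq> (\<Union>K\<in>C. {x. h x < G p (real K) x})" by blast
    show ?thesis
    proof (intro exI[of _ "real (Max (insert 0 C))"] conjI ballI)
      fix x assume "x \<in> ?S"
      then obtain K where K: "K \<in> C" "h x < G p (real K) x" using C by blast
      have "K \<le> Max (insert 0 C)" using C K by (intro Max_ge) auto
      then have "G p (real K) x \<le> G p (real (Max (insert 0 C))) x"
        unfolding G_def by (intro add_left_mono mult_right_mono D0 of_nat_mono)
      then show "h x < G p (real (Max (insert 0 C))) x" using K by linarith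
    qed simp
  qed
  then obtain K where K: "\<And>p x. p \<in> ?S \<Longrightarrow> x \<in> ?S \<Longrightarrow> h x < G p (K p) x" by metis
  \<comment> \<open>Second use of compactness: at its apex each cone is only \<open>d\<close> above
    \<open>h\<close>, so finitely many apices have a minimum within
    \<open>3 * d = \<epsilon>\<close> of \<open>h\<close>.\<close>
  obtain P where P: "P \<subseteq> ?S" "finite P" "?S \<subseteq> (\<Union>p\<in>P. {x. G p (K p) x < h x + 3 * d})"
  proof (rule compactE_image[OF compact_l1_sphere, of ?S "\<lambda>p. {x. G p (K p) x < h x + 3 * d}" n])
    show "open {x. G p (K p) x < h x + 3 * d}" for p
      by (intro open_Collect_less continuous_intros cont_h cont_G)
    show "?S \<subseteq> (\<Union>p\<in>?S. {x. G p (K p) x < h x + 3 * d})"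
    proof
      fix p assume p: "p \<in> ?S"
      have "D p p = 0" using p by (simp add: D_def s_S)
      then have "G p (K p) p < h p + 3 * d" using p d by (simp add: G_def s_S)
      then show "p \<in> (\<Union>p\<in>?S. {x. G p (K p) x < h x + 3 * d})" using p by blast
    qed
  qed
  have form_s: "lattice_form n e s (\<Sum>k<n. \<bar>e k\<bar>)"
    unfolding s_def by (intro lattice_form_sum lattice_form_abs lattice_form_coordinate) auto
  have "\<exists>u. lattice_form n e (G p (K p)) u" for p
  proof -
    have "lattice_form n e (\<lambda>x. x k - s x * p k) (e k - p k *\<^sub>R (\<Sum>k<n. \<bar>e k\<bar>))" if "k < n" for k
      using lattice_form_diff[OF lattice_form_coordinate[OF that] lattice_form_scaleR[OF form_s, of "p k"]]
      by (simp add: mult.commute)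
    then have "lattice_form n e (D p) (\<Sum>k<n. \<bar>e k - p k *\<^sub>R (\<Sum>k<n. \<bar>e k\<bar>)\<bar>)"
      unfolding D_def by (intro lattice_form_sum lattice_form_abs) auto
    from lattice_form_add[OF lattice_form_scaleR[OF form_s] lattice_form_scaleR[OF this]]
    show ?thesis unfolding G_def by blast
  qed
  then obtain u where u: "\<And>p. lattice_form n e (G p (K p)) (u p)" by metis
  have "\<exists>g w. lattice_form n e g w \<and> (\<forall>x\<in>?S. \<bar>h x - g x\<bar> \<le> \<epsilon>)"
  proof (cases "P = {}")
    \<comment> \<open>This occurs only for \<open>n = 0\<close>, where the sphere is empty.\<close>
    case True
    then have "?S = {}" using P(3) by blast
    then show ?thesis using lattice_form_zero by blast
  next
    case False
    from lattice_form_Inf[OF P(2) False, of n e "\<lambda>p. G p (K p)" u] u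
    obtain g w where g: "lattice_form n e g w" "\<forall>x. \<forall>p\<in>P. g x \<le> G p (K p) x"
      "\<forall>x. \<exists>p\<in>P. g x = G p (K p) x" by blast
    have "\<bar>h x - g x\<bar> \<le> \<epsilon>" if x: "x \<in> ?S" for x
    proof -
      obtain p where "p \<in> P" "g x = G p (K p) x" using g(3) by blast
      then have "h x < g x" using K x P(1) by auto
      moreover obtain p' where "p' \<in> P" "G p' (K p') x < h x + 3 * d" using x P(3) by blast
      then have "g x < h x + 3 * d" using g(2) by (meson order_le_less_trans)
      ultimately show ?thesis by (simp add: d_def)
    qed
    then show ?thesis using g(1) by blast
  qed
  then obtain g w where g: "lattice_form n e g w" "\<And>x. x \<in> ?S \<Longrightarrow> \<bar>h x - g x\<bar> \<le> \<epsilon>" by blast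
  have "\<bar>h x - g x\<bar> \<le> \<epsilon> * s x" for x
  proof -
    have "0 \<le> s x" by (simp add: s_def sum_nonneg)
    \<comment> \<open>Normalisation for the homogeneity argument; truncating after \<open>n\<close>
      entries puts \<open>y\<close> on the sphere and is invisible to \<open>h\<close> and
      \<open>g\<close>.\<close>
    define y where "y = (\<lambda>k. if k < n then x k / s x else 0)"
    show ?thesis
    proof (cases "s x = 0")
      case True
      then have "x k = 0" if "k < n" for k
        using that by (simp add: s_def sum_nonneg_eq_0_iff)
      then have x0: "x k = 0 * x k" if "k < n" for k using that by simp
      have "h x = h (\<lambda>k. 0 * x k)" by (rule krivine_functions_cong[OF h x0])
      also have "\<dots> = 0 * h x" by (rule krivine_functions_homogeneous[OF h order_refl])
      finally have "h x = 0" by simp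
      have "g x = g (\<lambda>k. 0 * x k)" by (rule lattice_form_cong[OF g(1) x0])
      also have "\<dots> = 0 * g x" by (rule lattice_form_homogeneous[OF g(1) order_refl])
      finally show ?thesis using \<open>h x = 0\<close> True by simp
    next
      case False
      with \<open>0 \<le> s x\<close> have pos: "0 < s x" by simp
      have "(\<Sum>k<n. \<bar>y k\<bar>) = (\<Sum>k<n. \<bar>x k\<bar> / s x)"
        using pos by (intro sum.cong) (auto simp: y_def)
      also have "\<dots> = 1" using pos by (simp add: sum_divide_distrib[symmetric] s_def)
      finally have y: "y \<in> ?S" by (simp add: l1_sphere_def y_def)
      have xy: "x k = s x * y k" if "k < n" for k using pos that by (simp add: y_def)
      have "h x = h (\<lambda>k. s x * y k)" by (rule krivine_functions_cong[OF h xy])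
      then have "h x = s x * h y" by (simp only: krivine_functions_homogeneous[OF h \<open>0 \<le> s x\<close>])
      moreover have "g x = g (\<lambda>k. s x * y k)" by (rule lattice_form_cong[OF g(1) xy])
      then have "g x = s x * g y" by (simp only: lattice_form_homogeneous[OF g(1) \<open>0 \<le> s x\<close>])
      ultimately have "\<bar>h x - g x\<bar> = s x * \<bar>h y - g y\<bar>"
        using pos by (simp add: right_diff_distrib[symmetric] abs_mult)
      also have "\<dots> \<le> s x * \<epsilon>" using g(2)[OF y] pos by (intro mult_left_mono) auto
      finally show ?thesis by (simp add: mult.commute)
    qed
  qed
  then show ?thesis using g(1) unfolding s_def by blast
qed

text \<open>Errors are measured in the order, with the same \<open>\<epsilon>\<close> for functions
  and for elements: such bounds pass through lattice operations, and monotonicity of the norm turns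
  them into norm bounds.\<close>

definition krivine_value :: "nat \<Rightarrow> (nat \<Rightarrow> 'e::banach_lattice) \<Rightarrow> ((nat \<Rightarrow> real) \<Rightarrow> real) \<Rightarrow> 'e \<Rightarrow> bool" where
  "krivine_value n e h v \<longleftrightarrow> (\<forall>\<epsilon>>0. \<exists>g w. lattice_form n e g w \<and>
    (\<forall>x. \<bar>h x - g x\<bar> \<le> \<epsilon> * (\<Sum>k<n. \<bar>x k\<bar>)) \<and> \<bar>v - w\<bar> \<le> \<epsilon> *\<^sub>R (\<Sum>k<n. \<bar>e k\<bar>))"

lemma krivine_value_lattice_form:
  assumes "lattice_form n e h v"
  shows "krivine_value n e h v"
  unfolding krivine_value_def
proof (intro allI impI exI conjI)
  fix \<epsilon> :: real assume "0 < \<epsilon>"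
  show "\<bar>h x - h x\<bar> \<le> \<epsilon> * (\<Sum>k<n. \<bar>x k\<bar>)" for x
    using \<open>0 < \<epsilon>\<close> by (simp add: sum_nonneg)
  have "0 \<le> (\<Sum>k<n. \<bar>e k\<bar>)" by (intro sum_nonneg abs_ge_zero)
  then show "\<bar>v - v\<bar> \<le> \<epsilon> *\<^sub>R (\<Sum>k<n. \<bar>e k\<bar>)"
    using \<open>0 < \<epsilon>\<close> by (simp add: scaleR_nonneg_nonneg)
qed (rule assms)

text \<open>The hypothesis says that a certain lattice-linear function is nonnegative, the
  conclusion that its value is: here inequalities move from real functions to the lattice.\<close>

lemma lattice_form_close:
  assumes g: "lattice_form n e g w" and g': "lattice_form n e g' w'"
    and close: "\<And>x. \<bar>g x - g' x\<bar> \<le> \<epsilon> * (\<Sum>k<n. \<bar>x k\<bar>)"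
  shows "\<bar>w - w'\<bar> \<le> \<epsilon> *\<^sub>R (\<Sum>k<n. \<bar>e k\<bar>)"
proof -
  have s: "lattice_form n e (\<lambda>x. \<Sum>k<n. \<bar>x k\<bar>) (\<Sum>k<n. \<bar>e k\<bar>)"
    by (intro lattice_form_sum lattice_form_abs lattice_form_coordinate) auto
  have "lattice_form n e (\<lambda>x. \<epsilon> * (\<Sum>k<n. \<bar>x k\<bar>) - \<bar>g x - g' x\<bar>) (\<epsilon> *\<^sub>R (\<Sum>k<n. \<bar>e k\<bar>) - \<bar>w - w'\<bar>)"
    by (intro lattice_form_diff lattice_form_scaleR lattice_form_abs s g g')
  then have "0 \<le> \<epsilon> *\<^sub>R (\<Sum>k<n. \<bar>e k\<bar>) - \<bar>w - w'\<bar>"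
    by (rule lattice_form_nonneg) (simp add: close)
  then show ?thesis by (simp only: diff_ge_0_iff_ge)
qed

lemma krivine_value_unique:
  assumes "krivine_value n e h v" "krivine_value n e h v'"
  shows "v = v'"
proof -
  let ?U = "\<Sum>k<n. \<bar>e k\<bar>"
  have U: "0 \<le> ?U" by (intro sum_nonneg abs_ge_zero)
  have le: "norm (v - v') \<le> (4 * \<epsilon>) * norm ?U" if \<epsilon>: "0 < \<epsilon>" for \<epsilon>
  proof -
    obtain g w where g: "lattice_form n e g w" "\<And>x. \<bar>h x - g x\<bar> \<le> \<epsilon> * (\<Sum>k<n. \<bar>x k\<bar>)"
      "\<bar>v - w\<bar> \<le> \<epsilon> *\<^sub>R ?U" using assms(1) \<epsilon> unfolding krivine_value_def by blast
    obtain g' w' where g': "lattice_form n e g' w'" "\<And>x. \<bar>h x - g' x\<bar> \<le> \<epsilon> * (\<Sum>k<n. \<bar>x k\<bar>)"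
      "\<bar>v' - w'\<bar> \<le> \<epsilon> *\<^sub>R ?U" using assms(2) \<epsilon> unfolding krivine_value_def by blast
    have "\<bar>g x - g' x\<bar> \<le> (2 * \<epsilon>) * (\<Sum>k<n. \<bar>x k\<bar>)" for x
      using g(2)[of x] g'(2)[of x] by linarith
    then have ww: "\<bar>w - w'\<bar> \<le> (2 * \<epsilon>) *\<^sub>R ?U"
      by (rule lattice_form_close[OF g(1) g'(1)])
    have "\<bar>v - v'\<bar> = \<bar>(v - w) + (w - w') + - (v' - w')\<bar>" by simp
    also have "\<dots> \<le> \<bar>v - w\<bar> + \<bar>w - w'\<bar> + \<bar>v' - w'\<bar>"
      by (metis abs_triangle_ineq abs_minus_cancel add_right_mono order_trans)
    also have "\<dots> \<le> \<epsilon> *\<^sub>R ?U + (2 * \<epsilon>) *\<^sub>R ?U + \<epsilon> *\<^sub>R ?U"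
      by (intro add_mono g g' ww)
    also have "\<dots> = (4 * \<epsilon>) *\<^sub>R ?U" by (simp add: scaleR_add_left[symmetric])
    finally have "norm \<bar>v - v'\<bar> \<le> norm ((4 * \<epsilon>) *\<^sub>R ?U)"
      by (intro norm_mono_nonneg abs_ge_zero)
    then show ?thesis using \<epsilon> by simp
  qed
  have "norm (v - v') \<le> 0"
  proof (rule field_le_epsilon)
    fix r :: real assume "0 < r"
    \<comment> \<open>Adding 1 avoids a division by zero when all \<open>e k\<close> vanish.\<close>
    define N where "N = norm ?U + 1"
    have n1: "0 < N" unfolding N_def by (rule add_nonneg_pos) auto
    define \<epsilon> where "\<epsilon> = r / (4 * N)"
    then have "0 < \<epsilon>" using \<open>0 < r\<close> n1 by (simp add: \<epsilon>_def)
    from le[OF this] have "norm (v - v') \<le> 4 * \<epsilon> * norm ?U" .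
    also have "\<dots> \<le> 4 * \<epsilon> * N" using \<open>0 < \<epsilon>\<close> by (simp add: N_def)
    also have "\<dots> = r" using n1 by (simp add: \<epsilon>_def)
    finally show "norm (v - v') \<le> 0 + r" by simp
  qed
  then show ?thesis by simp
qed

text \<open>Values of approximants with errors tending to 0 form a Cauchy sequence by
  \<open>lattice_form_close\<close>. Completeness gives the limit, and the order bounds survive
  because the positive cone is closed.\<close>

lemma krivine_value_exists:
  assumes h: "h \<in> krivine_functions n"
  shows "\<exists>v. krivine_value n e h (v :: 'e::banach_lattice)"
proof -
  let ?U = "\<Sum>k<n. \<bar>e k\<bar>"
  have U: "0 \<le> ?U" by (intro sum_nonneg abs_ge_zero)
  define r where "r = (\<lambda>i. inverse (real (Suc i)))"
  have r: "0 < r i" for i by (simp add: r_def)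
  have r0: "r \<longlonglongrightarrow> 0" unfolding r_def by (rule LIMSEQ_inverse_real_of_nat)
  have "\<forall>i. \<exists>g w. lattice_form n e g w \<and> (\<forall>x. \<bar>h x - g x\<bar> \<le> r i * (\<Sum>k<n. \<bar>x k\<bar>))"
    using krivine_function_approx[OF h r] by blast
  then obtain g w where g: "\<And>i. lattice_form n e (g i) (w i)"
      "\<And>i x. \<bar>h x - g i x\<bar> \<le> r i * (\<Sum>k<n. \<bar>x k\<bar>)" by metis
  have ww: "\<bar>w i - w j\<bar> \<le> (r i + r j) *\<^sub>R ?U" for i j
  proof (rule lattice_form_close[OF g(1) g(1)])
    fix x show "\<bar>g i x - g j x\<bar> \<le> (r i + r j) * (\<Sum>k<n. \<bar>x k\<bar>)"
      using g(2)[of x i] g(2)[of x j] by (simp add: distrib_right)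
  qed
  have nww: "norm (w i - w j) \<le> (r i + r j) * norm ?U" for i j
  proof -
    have "norm \<bar>w i - w j\<bar> \<le> norm ((r i + r j) *\<^sub>R ?U)"
      by (rule norm_mono_nonneg[OF abs_ge_zero ww])
    then show ?thesis using r[of i] r[of j] by simp
  qed
  have "Cauchy w"
  proof (rule metric_CauchyI)
    fix \<epsilon> :: real assume "0 < \<epsilon>"
    define B where "B = norm ?U + 1"
    have n1: "0 < B" unfolding B_def by (rule add_nonneg_pos) auto
    define \<delta> where "\<delta> = \<epsilon> / (2 * B)"
    then have "0 < \<delta>" using \<open>0 < \<epsilon>\<close> n1 by (simp add: \<delta>_def)
    with r0 obtain N where N: "\<And>i. i \<ge> N \<Longrightarrow> r i < \<delta>"
      by (metis order_tendstoD(2) eventually_sequentially)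
    have "dist (w i) (w j) < \<epsilon>" if "i \<ge> N" "j \<ge> N" for i j
    proof -
      have "dist (w i) (w j) \<le> (r i + r j) * norm ?U" using nww by (simp add: dist_norm)
      also have "\<dots> \<le> (r i + r j) * B"
        using r[of i] r[of j] by (intro mult_left_mono) (auto simp: B_def)
      also have "\<dots> < (2 * \<delta>) * B"
        using N[OF that(1)] N[OF that(2)] n1 by (intro mult_strict_right_mono) auto
      also have "\<dots> = \<epsilon>" using n1 by (simp add: \<delta>_def)
      finally show ?thesis .
    qed
    then show "\<exists>M. \<forall>i\<ge>M. \<forall>j\<ge>M. dist (w i) (w j) < \<epsilon>" by blast
  qed
  then obtain v where v: "w \<longlonglongrightarrow> v" by (metis Cauchy_convergent convergent_def)
  have vw: "\<bar>v - w i\<bar> \<le> r i *\<^sub>R ?U" for i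
  proof -
    have "(\<lambda>j. (r i + r j) *\<^sub>R ?U - \<bar>w j - w i\<bar>) \<longlonglongrightarrow> (r i + 0) *\<^sub>R ?U - \<bar>v - w i\<bar>"
      by (intro tendsto_intros tendsto_abs_lattice v r0)
    moreover have "0 \<le> (r i + r j) *\<^sub>R ?U - \<bar>w j - w i\<bar>" for j
      using ww[of j i] by (simp only: diff_ge_0_iff_ge add.commute)
    ultimately have "0 \<le> (r i + 0) *\<^sub>R ?U - \<bar>v - w i\<bar>"
      by (rule tendsto_nonneg_lattice[OF _ sequentially_bot])
    then show ?thesis by (simp only: diff_ge_0_iff_ge add_0_right)
  qed
  have "krivine_value n e h v"
    unfolding krivine_value_def
  proof (intro allI impI)
    fix \<epsilon> :: real assume "0 < \<epsilon>"
    with r0 obtain i where i: "r i < \<epsilon>"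
      by (metis order_tendstoD(2) eventually_sequentially order_refl)
    have "\<bar>h x - g i x\<bar> \<le> \<epsilon> * (\<Sum>k<n. \<bar>x k\<bar>)" for x
      by (rule order_trans[OF g(2)]) (intro mult_right_mono sum_nonneg, use i in auto)
    moreover have "\<bar>v - w i\<bar> \<le> \<epsilon> *\<^sub>R ?U"
      by (rule order_trans[OF vw]) (intro scaleR_right_mono U, use i in auto)
    ultimately show "\<exists>g w. lattice_form n e g w \<and> (\<forall>x. \<bar>h x - g x\<bar> \<le> \<epsilon> * (\<Sum>k<n. \<bar>x k\<bar>)) \<and>
        \<bar>v - w\<bar> \<le> \<epsilon> *\<^sub>R ?U"
      using g(1) by blast
  qed
  then show ?thesis by blast
qed

text \<open>Addition, supremum and infimum satisfy the same Lipschitz estimate, so one argument,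
  spending half of the error on each operand, treats all three.\<close>

lemma krivine_value_binary:
  assumes g: "krivine_value n e g u" and h: "krivine_value n e h v"
    and form: "\<And>g u h v. lattice_form n e g u \<Longrightarrow> lattice_form n e h v \<Longrightarrow>
      lattice_form n e (\<lambda>x. f (g x) (h x)) (F u v)"
    and f: "\<And>a b c d. \<bar>f a b - f c d\<bar> \<le> \<bar>a - c\<bar> + \<bar>b - d\<bar>"
    and F: "\<And>a b c d. \<bar>F a b - F c d\<bar> \<le> \<bar>a - c\<bar> + \<bar>b - d\<bar>"
  shows "krivine_value n e (\<lambda>x. f (g x) (h x)) (F u v)"
  unfolding krivine_value_def
proof (intro allI impI)
  let ?U = "\<Sum>k<n. \<bar>e k\<bar>"
  fix \<epsilon> :: real assume "0 < \<epsilon>"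
  then have e2: "0 < \<epsilon> / 2" by simp
  obtain g' u' where g': "lattice_form n e g' u'" "\<And>x. \<bar>g x - g' x\<bar> \<le> (\<epsilon> / 2) * (\<Sum>k<n. \<bar>x k\<bar>)"
    "\<bar>u - u'\<bar> \<le> (\<epsilon> / 2) *\<^sub>R ?U" using g e2 unfolding krivine_value_def by blast
  obtain h' v' where h': "lattice_form n e h' v'" "\<And>x. \<bar>h x - h' x\<bar> \<le> (\<epsilon> / 2) * (\<Sum>k<n. \<bar>x k\<bar>)"
    "\<bar>v - v'\<bar> \<le> (\<epsilon> / 2) *\<^sub>R ?U" using h e2 unfolding krivine_value_def by blast
  show "\<exists>g' w. lattice_form n e g' w \<and>
      (\<forall>x. \<bar>f (g x) (h x) - g' x\<bar> \<le> \<epsilon> * (\<Sum>k<n. \<bar>x k\<bar>)) \<and> \<bar>F u v - w\<bar> \<le> \<epsilon> *\<^sub>R ?U"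
  proof (intro exI conjI allI)
    show "lattice_form n e (\<lambda>x. f (g' x) (h' x)) (F u' v')" by (intro form g' h')
    show "\<bar>f (g x) (h x) - f (g' x) (h' x)\<bar> \<le> \<epsilon> * (\<Sum>k<n. \<bar>x k\<bar>)" for x
      using f[of "g x" "h x" "g' x" "h' x"] g'(2)[of x] h'(2)[of x] by simp
    have "\<bar>F u v - F u' v'\<bar> \<le> \<bar>u - u'\<bar> + \<bar>v - v'\<bar>" by (rule F)
    also have "\<dots> \<le> (\<epsilon> / 2) *\<^sub>R ?U + (\<epsilon> / 2) *\<^sub>R ?U" by (intro add_mono g' h')
    also have "\<dots> = \<epsilon> *\<^sub>R ?U" by (simp add: scaleR_add_left[symmetric])
    finally show "\<bar>F u v - F u' v'\<bar> \<le> \<epsilon> *\<^sub>R ?U" .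
  qed
qed

lemma abs_scaleR_lattice: "\<bar>a *\<^sub>R x\<bar> = \<bar>a\<bar> *\<^sub>R \<bar>x :: 'e::banach_lattice\<bar>"
proof (cases "0 \<le> a")
  case True
  have "\<bar>a *\<^sub>R x\<bar> = sup (a *\<^sub>R x) (a *\<^sub>R (- x))" by (simp only: abs_lattice scaleR_minus_right)
  also have "\<dots> = a *\<^sub>R sup x (- x)" by (rule scaleR_sup[OF True, symmetric])
  finally show ?thesis using True by (simp only: abs_lattice[of x] abs_of_nonneg)
next
  case False
  then have a: "0 \<le> - a" by simp
  have "\<bar>a *\<^sub>R x\<bar> = sup ((- a) *\<^sub>R (- x)) ((- a) *\<^sub>R x)"
    by (simp only: abs_lattice scaleR_minus_left scaleR_minus_right minus_minus)
  also have "\<dots> = (- a) *\<^sub>R sup (- x) x" by (rule scaleR_sup[OF a, symmetric])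
  finally show ?thesis using False by (simp only: abs_lattice[of x] sup_commute abs_of_nonpos)
qed

lemma krivine_value_scaleR:
  assumes "krivine_value n e h v"
  shows "krivine_value n e (\<lambda>x. a * h x) (a *\<^sub>R v)"
  unfolding krivine_value_def
proof (intro allI impI)
  let ?U = "\<Sum>k<n. \<bar>e k\<bar>"
  have U: "0 \<le> ?U" by (intro sum_nonneg abs_ge_zero)
  fix \<epsilon> :: real assume "0 < \<epsilon>"
  then have "0 < \<epsilon> / (\<bar>a\<bar> + 1)" by simp
  with assms obtain g w where g: "lattice_form n e g w"
      "\<And>x. \<bar>h x - g x\<bar> \<le> (\<epsilon> / (\<bar>a\<bar> + 1)) * (\<Sum>k<n. \<bar>x k\<bar>)"
      "\<bar>v - w\<bar> \<le> (\<epsilon> / (\<bar>a\<bar> + 1)) *\<^sub>R ?U" unfolding krivine_value_def by blast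
  have le: "\<bar>a\<bar> * (\<epsilon> / (\<bar>a\<bar> + 1)) \<le> \<epsilon>"
    using \<open>0 < \<epsilon>\<close> by (simp add: field_simps)
  show "\<exists>g w. lattice_form n e g w \<and> (\<forall>x. \<bar>a * h x - g x\<bar> \<le> \<epsilon> * (\<Sum>k<n. \<bar>x k\<bar>)) \<and>
      \<bar>a *\<^sub>R v - w\<bar> \<le> \<epsilon> *\<^sub>R ?U"
  proof (intro exI conjI allI)
    show "lattice_form n e (\<lambda>x. a * g x) (a *\<^sub>R w)" by (rule lattice_form_scaleR[OF g(1)])
    show "\<bar>a * h x - a * g x\<bar> \<le> \<epsilon> * (\<Sum>k<n. \<bar>x k\<bar>)" for x
    proof -
      have "\<bar>a * h x - a * g x\<bar> = \<bar>a\<bar> * \<bar>h x - g x\<bar>"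
        by (simp add: right_diff_distrib[symmetric] abs_mult)
      also have "\<dots> \<le> \<bar>a\<bar> * ((\<epsilon> / (\<bar>a\<bar> + 1)) * (\<Sum>k<n. \<bar>x k\<bar>))"
        by (intro mult_left_mono g) auto
      also have "\<dots> = (\<bar>a\<bar> * (\<epsilon> / (\<bar>a\<bar> + 1))) * (\<Sum>k<n. \<bar>x k\<bar>)" by (simp only: mult.assoc)
      also have "\<dots> \<le> \<epsilon> * (\<Sum>k<n. \<bar>x k\<bar>)" by (intro mult_right_mono le sum_nonneg) auto
      finally show ?thesis .
    qed
    have "\<bar>a *\<^sub>R v - a *\<^sub>R w\<bar> = \<bar>a\<bar> *\<^sub>R \<bar>v - w\<bar>"
      by (simp only: scaleR_diff_right[symmetric] abs_scaleR_lattice)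
    also have "\<dots> \<le> \<bar>a\<bar> *\<^sub>R ((\<epsilon> / (\<bar>a\<bar> + 1)) *\<^sub>R ?U)"
      by (intro scaleR_left_mono g) auto
    also have "\<dots> = (\<bar>a\<bar> * (\<epsilon> / (\<bar>a\<bar> + 1))) *\<^sub>R ?U" by (simp only: scaleR_scaleR)
    also have "\<dots> \<le> \<epsilon> *\<^sub>R ?U" by (rule scaleR_right_mono[OF le U])
    finally show "\<bar>a *\<^sub>R v - a *\<^sub>R w\<bar> \<le> \<epsilon> *\<^sub>R ?U" .
  qed
qed

text \<open>Since \<open>krivine\<close> is a choice, only existence makes it satisfy the axioms of
  a calculus and gives \<open>q_convex\<close> its meaning.\<close>

theorem krivine_calculus_exists: "\<exists>\<Phi>. is_krivine_calculus n (e :: nat \<Rightarrow> 'e::banach_lattice) \<Phi>"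
proof -
  define \<Phi> where "\<Phi> = (\<lambda>h. SOME v. krivine_value n e h v)"
  have eq: "\<Phi> h = v" if "krivine_value n e h v" for h v
    unfolding \<Phi>_def using that by (metis someI krivine_value_unique)
  have val: "krivine_value n e h (\<Phi> h)" if "h \<in> krivine_functions n" for h
    using krivine_value_exists[OF that] eq by blast
  have "is_krivine_calculus n e \<Phi>"
    unfolding is_krivine_calculus_def
  proof (intro conjI allI impI ballI)
    show "\<Phi> (\<lambda>x. x k) = e k" if "k < n" for k
      by (intro eq krivine_value_lattice_form lattice_form_coordinate that)
    show "\<Phi> (\<lambda>x. a * h x) = a *\<^sub>R \<Phi> h" if "h \<in> krivine_functions n" for a h
      by (intro eq krivine_value_scaleR val that)
    fix g h assume gh: "g \<in> krivine_functions n" "h \<in> krivine_functions n"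
    show "\<Phi> (\<lambda>x. g x + h x) = \<Phi> g + \<Phi> h"
      by (intro eq krivine_value_binary[where f = "(+)" and F = "(+)"] val gh
          lattice_form_add abs_diff_triangle_ineq)
    show "\<Phi> (\<lambda>x. sup (g x) (h x)) = sup (\<Phi> g) (\<Phi> h)"
      by (intro eq krivine_value_binary[where f = sup and F = sup] val gh
          lattice_form.sup abs_sup_diff_le)
    show "\<Phi> (\<lambda>x. inf (g x) (h x)) = inf (\<Phi> g) (\<Phi> h)"
      by (intro eq krivine_value_binary[where f = inf and F = inf] val gh
          lattice_form_inf abs_inf_diff_le)
  qed
  then show ?thesis by blast
qed

section \<open>Suprema in q-convex lattices\<close>

lemma q_norm_krivine_function:
  assumes "0 < q"
  shows "(\<lambda>x. (\<Sum>k<n. \<bar>x k\<bar> powr q) powr (1 / q)) \<in> krivine_functions n"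
  unfolding krivine_functions_def
proof (intro CollectI conjI allI impI)
  show "continuous_on UNIV (\<lambda>x :: nat \<Rightarrow> real. (\<Sum>k<n. \<bar>x k\<bar> powr q) powr (1 / q))"
    using assms
    by (intro continuous_on_powr' continuous_intros continuous_on_product_coordinates)
       (auto intro!: sum_nonneg)
next
  fix x y :: "nat \<Rightarrow> real" assume "\<forall>k<n. x k = y k"
  then show "(\<Sum>k<n. \<bar>x k\<bar> powr q) powr (1 / q) = (\<Sum>k<n. \<bar>y k\<bar> powr q) powr (1 / q)" by simp
next
  fix t :: real and x :: "nat \<Rightarrow> real" assume t: "0 \<le> t"
  have "(\<Sum>k<n. \<bar>t * x k\<bar> powr q) = t powr q * (\<Sum>k<n. \<bar>x k\<bar> powr q)"
    using t by (simp add: abs_mult powr_mult sum_distrib_left)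
  then show "(\<Sum>k<n. \<bar>t * x k\<bar> powr q) powr (1 / q) = t * (\<Sum>k<n. \<bar>x k\<bar> powr q) powr (1 / q)"
    using t assms by (simp add: powr_mult sum_nonneg powr_powr)
qed

lemma coordinate_krivine_function: "k < n \<Longrightarrow> (\<lambda>x. x k) \<in> krivine_functions n"
  by (simp add: krivine_functions_def)

text \<open>The hypothesis on \<open>u\<close> speaks only of majorants of the \<open>l i\<close>,
  so it also fits a supremum of other elements that the \<open>l i\<close> dominate. In the proof
  the majorant is the value of the q-norm in the calculus: the q-norm dominates each coordinate, and
  a calculus preserving suprema is monotone.\<close>

lemma q_convex_sup_bound:
  assumes "q_convex TYPE('e::banach_lattice) q" "0 < q"
  shows "\<exists>C\<ge>0. \<forall>I :: 'i set. \<forall>l :: 'i \<Rightarrow> 'e. \<forall>u. finite I \<longrightarrow> 0 \<le> u \<longrightarrow>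
    (\<forall>w. 0 \<le> w \<longrightarrow> (\<forall>i\<in>I. l i \<le> w) \<longrightarrow> u \<le> w) \<longrightarrow>
    norm u \<le> C * (\<Sum>i\<in>I. norm (l i) powr q) powr (1 / q)"
proof -
  obtain C where C: "\<And>n (e :: nat \<Rightarrow> 'e). norm (krivine n e (\<lambda>x. (\<Sum>k<n. \<bar>x k\<bar> powr q) powr (1 / q)))
      \<le> C * (\<Sum>k<n. norm (e k) powr q) powr (1 / q)"
    using assms(1) unfolding q_convex_def by blast
  show ?thesis
  proof (intro exI[of _ "\<bar>C\<bar>"] conjI allI impI)
    fix I :: "'i set" and l :: "'i \<Rightarrow> 'e" and u :: 'e
    assume I: "finite I" and u0: "0 \<le> u" and u: "\<forall>w. 0 \<le> w \<longrightarrow> (\<forall>i\<in>I. l i \<le> w) \<longrightarrow> u \<le> w"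
    define n where "n = card I"
    obtain b where b: "bij_betw b {..<n} I"
      using ex_bij_betw_nat_finite[OF I] by (auto simp: n_def lessThan_atLeast0)
    define e where "e = (\<lambda>k. l (b k))"
    define \<Phi> where "\<Phi> = krivine n e"
    define h :: "(nat \<Rightarrow> real) \<Rightarrow> real" where "h = (\<lambda>x. (\<Sum>k<n. \<bar>x k\<bar> powr q) powr (1 / q))"
    have cal: "is_krivine_calculus n e \<Phi>"
      unfolding \<Phi>_def krivine_def using someI_ex[OF krivine_calculus_exists] .
    have h: "h \<in> krivine_functions n"
      unfolding h_def by (rule q_norm_krivine_function[OF assms(2)])
    have h0: "0 \<le> h x" for x by (simp add: h_def)
    have sup: "\<Phi> (\<lambda>x. sup (f x) (g x)) = sup (\<Phi> f) (\<Phi> g)"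
      if "f \<in> krivine_functions n" "g \<in> krivine_functions n" for f g
      using cal that unfolding is_krivine_calculus_def by blast
    \<comment> \<open>The constant 0 enters as a multiple of \<open>h\<close>, because the calculus
      prescribes the value of multiples.\<close>
    have zero: "(\<lambda>x. 0 * h x) \<in> krivine_functions n"
      by (simp add: krivine_functions_def)
    have "\<Phi> (\<lambda>x. 0 * h x) = 0 *\<^sub>R \<Phi> h"
      using cal h unfolding is_krivine_calculus_def by blast
    moreover have "(\<lambda>x. sup (h x) (0 * h x)) = h" using h0 by (simp add: fun_eq_iff sup_absorb1)
    ultimately have "\<Phi> h = sup (\<Phi> h) 0" using sup[OF h zero] by simp
    then have pos: "0 \<le> \<Phi> h" by (metis sup_ge2)
    have "l i \<le> \<Phi> h" if "i \<in> I" for i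
    proof -
      have "i \<in> b ` {..<n}" using bij_betw_imp_surj_on[OF b] that by simp
      then obtain k where k: "k < n" "i = b k" by (elim imageE) simp
      have "x k \<le> h x" for x
      proof -
        have "\<bar>x k\<bar> powr q \<le> (\<Sum>k<n. \<bar>x k\<bar> powr q)" using k by (intro member_le_sum) auto
        then have "(\<bar>x k\<bar> powr q) powr (1 / q) \<le> h x"
          unfolding h_def using assms(2) by (intro powr_mono2) auto
        then show ?thesis using assms(2) by (simp add: powr_powr)
      qed
      then have "(\<lambda>x. sup (h x) (x k)) = h" by (simp add: fun_eq_iff sup_absorb1)
      then have "\<Phi> h = sup (\<Phi> h) (\<Phi> (\<lambda>x. x k))"
        using sup[OF h coordinate_krivine_function[OF k(1)]] by simp
      moreover have "\<Phi> (\<lambda>x. x k) = e k" using cal k(1) unfolding is_krivine_calculus_def by blast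
      ultimately have "e k \<le> \<Phi> h" by (metis sup_ge2)
      then show ?thesis by (simp add: e_def k(2))
    qed
    then have "u \<le> \<Phi> h" using u pos by blast
    then have "norm u \<le> norm (\<Phi> h)" by (rule norm_mono_nonneg[OF u0])
    also have "\<dots> \<le> C * (\<Sum>k<n. norm (e k) powr q) powr (1 / q)"
      unfolding \<Phi>_def h_def by (rule C)
    also have "\<dots> \<le> \<bar>C\<bar> * (\<Sum>k<n. norm (e k) powr q) powr (1 / q)"
      by (intro mult_right_mono) auto
    also have "(\<Sum>k<n. norm (e k) powr q) = (\<Sum>i\<in>I. norm (l i) powr q)"
      unfolding e_def by (rule sum.reindex_bij_betw[OF b])
    finally show "norm u \<le> \<bar>C\<bar> * (\<Sum>i\<in>I. norm (l i) powr q) powr (1 / q)" .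
  qed simp
qed

section \<open>The Bochner integral in arbitrary Banach spaces\<close>

abbreviation simple_integrable :: "'a measure \<Rightarrow> ('a \<Rightarrow> 'b::real_vector) \<Rightarrow> bool" where
  "simple_integrable \<equiv> Bochner_Integration.simple_bochner_integrable"

abbreviation simple_int :: "'a measure \<Rightarrow> ('a \<Rightarrow> 'b::real_vector) \<Rightarrow> 'b" where
  "simple_int \<equiv> Bochner_Integration.simple_bochner_integral"

lemma simple_integrable_compose:
  assumes "simple_integrable M s" "p 0 = 0"
  shows "simple_integrable M (\<lambda>x. p (s x))"
  using simple_bochner_integrable_compose2[where p = "\<lambda>x y. p x", of M s s] assms by simp

lemma simple_integrable_add:
  "simple_integrable M s \<Longrightarrow> simple_integrable M t \<Longrightarrow> simple_integrable M (\<lambda>x. s x + t x)"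
  using simple_bochner_integrable_compose2[where p = "(+)", of M s t] by simp

lemma simple_integrable_diff:
  fixes s t :: "'a \<Rightarrow> 'b::real_vector"
  shows "simple_integrable M s \<Longrightarrow> simple_integrable M t \<Longrightarrow> simple_integrable M (\<lambda>x. s x - t x)"
  using simple_bochner_integrable_compose2[where p = "(-)", of M s t] by simp

lemma simple_integrable_zero: "simple_integrable M (\<lambda>x. 0)"
  by (intro simple_bochner_integrable.intros) auto

lemma simple_integrable_indicator_scaleR:
  assumes "simple_integrable M s" "A \<in> sets M"
  shows "simple_integrable M (\<lambda>x. indicator A x *\<^sub>R s x)"
proof (rule simple_bochner_integrable.intros)
  have s: "simple_function M s" "emeasure M {y\<in>space M. s y \<noteq> 0} \<noteq> \<infinity>"
    using assms(1) by (auto elim: simple_bochner_integrable.cases)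
  show "simple_function M (\<lambda>x. indicat_real A x *\<^sub>R s x)"
    using s(1) assms(2) by (intro simple_function_compose2[where h = scaleR] simple_function_indicator)
  have "emeasure M {y\<in>space M. indicat_real A y *\<^sub>R s y \<noteq> 0} \<le> emeasure M {y\<in>space M. s y \<noteq> 0}"
  proof (rule emeasure_mono)
    have "{y\<in>space M. s y \<noteq> 0} = s -` (UNIV - {0}) \<inter> space M" by auto
    then show "{y\<in>space M. s y \<noteq> 0} \<in> sets M" using simple_functionD(2)[OF s(1)] by simp
  qed auto
  then show "emeasure M {y\<in>space M. indicat_real A y *\<^sub>R s y \<noteq> 0} \<noteq> \<infinity>"
    using s(2) by (auto simp: top_unique)
qed

lemma simple_int_norm_le:
  fixes s :: "'a \<Rightarrow> 'b::real_normed_vector"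
  assumes "simple_integrable M s"
  shows "ennreal (norm (simple_int M s)) \<le> (\<integral>\<^sup>+x. norm (s x) \<partial>M)"
proof -
  have n: "simple_integrable M (\<lambda>x. norm (s x))" by (rule simple_integrable_compose[OF assms]) simp
  have "ennreal (norm (simple_int M s)) \<le> ennreal (simple_int M (\<lambda>x. norm (s x)))"
    by (intro ennreal_leI simple_bochner_integral_norm_bound assms)
  also have "\<dots> = (\<integral>\<^sup>+x. norm (s x) \<partial>M)"
    by (intro simple_bochner_integral_eq_nn_integral n) simp
  finally show ?thesis .
qed

lemma simple_integrable_indicator:
  assumes "A \<in> sets M" "emeasure M A < \<infinity>"
  shows "simple_integrable M (\<lambda>x. indicator A x *\<^sub>R b)"
    and "simple_int M (\<lambda>x. indicator A x *\<^sub>R b) = measure M A *\<^sub>R b"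
proof -
  have i: "simple_integrable M (indicat_real A)"
  proof (rule simple_bochner_integrable.intros)
    show "simple_function M (indicat_real A)" using assms(1) by (rule simple_function_indicator)
    have "{y\<in>space M. indicat_real A y \<noteq> 0} = A"
      using sets.sets_into_space[OF assms(1)] by (auto simp: indicator_def)
    then show "emeasure M {y\<in>space M. indicat_real A y \<noteq> 0} \<noteq> \<infinity>" using assms(2) by auto
  qed
  then show "simple_integrable M (\<lambda>x. indicator A x *\<^sub>R b)"
    by (rule simple_integrable_compose) simp
  have "linear (\<lambda>r. r *\<^sub>R b)" by (rule linearI) (simp_all add: scaleR_add_left)
  from simple_bochner_integral_linear[OF this i]
  have "simple_int M (\<lambda>x. indicator A x *\<^sub>R b) = simple_int M (indicat_real A) *\<^sub>R b" .
  moreover have "ennreal (simple_int M (indicat_real A)) = (\<integral>\<^sup>+x. indicat_real A x \<partial>M)"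
    by (intro simple_bochner_integral_eq_nn_integral i) simp
  then have "ennreal (simple_int M (indicat_real A)) = emeasure M A"
    using assms(1) by (simp add: ennreal_indicator)
  then have "enn2real (ennreal (simple_int M (indicat_real A))) = measure M A"
    by (simp only: measure_def)
  then have "simple_int M (indicat_real A) = measure M A" by simp
  ultimately show "simple_int M (\<lambda>x. indicator A x *\<^sub>R b) = measure M A *\<^sub>R b" by simp
qed

lemma strongly_measurable_simple:
  assumes "simple_integrable M s"
  shows "strongly_measurable M s"
  unfolding strongly_measurable_def using assms by (intro exI[of _ "\<lambda>_. s"]) simp

lemma strongly_measurable_compose2:
  assumes "strongly_measurable M f" "strongly_measurable M g"
    and "p 0 0 = 0"
    and "\<And>a b s t. s \<longlonglongrightarrow> a \<Longrightarrow> t \<longlonglongrightarrow> b \<Longrightarrow> (\<lambda>i. p (s i) (t i)) \<longlonglongrightarrow> p a b"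
  shows "strongly_measurable M (\<lambda>x. p (f x) (g x))"
proof -
  obtain s t where s: "\<forall>i. simple_integrable M (s i)" "AE x in M. (\<lambda>i. s i x) \<longlonglongrightarrow> f x"
    and t: "\<forall>i. simple_integrable M (t i)" "AE x in M. (\<lambda>i. t i x) \<longlonglongrightarrow> g x"
    using assms(1,2) unfolding strongly_measurable_def by blast
  show ?thesis unfolding strongly_measurable_def
  proof (intro exI conjI allI)
    show "simple_integrable M (\<lambda>x. p (s i x) (t i x))" for i
      using simple_bochner_integrable_compose2[where p = p, of M "s i" "t i"] s t assms(3) by blast
    show "AE x in M. (\<lambda>i. p (s i x) (t i x)) \<longlonglongrightarrow> p (f x) (g x)"
      using s(2) t(2) by eventually_elim (rule assms(4))
  qed
qed

lemma strongly_measurable_compose: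
  assumes "strongly_measurable M f" "p 0 = 0"
    and "\<And>a s. s \<longlonglongrightarrow> a \<Longrightarrow> (\<lambda>i. p (s i)) \<longlonglongrightarrow> p a"
  shows "strongly_measurable M (\<lambda>x. p (f x))"
  using strongly_measurable_compose2[OF assms(1,1), of "\<lambda>x y. p x"] assms(2,3) by blast

lemma strongly_measurable_add:
  "strongly_measurable M f \<Longrightarrow> strongly_measurable M g \<Longrightarrow> strongly_measurable M (\<lambda>x. f x + g x)"
  by (rule strongly_measurable_compose2[where p = plus]) (simp_all add: tendsto_add)

lemma strongly_measurable_diff:
  "strongly_measurable M f \<Longrightarrow> strongly_measurable M g \<Longrightarrow> strongly_measurable M (\<lambda>x. f x - g x)"
  by (rule strongly_measurable_compose2[where p = minus]) (simp_all add: tendsto_diff)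

lemma strongly_measurable_norm:
  "strongly_measurable M f \<Longrightarrow> strongly_measurable M (\<lambda>x. norm (f x))"
  by (rule strongly_measurable_compose[where p = norm]) (simp_all add: tendsto_norm)

lemma strongly_measurable_abs:
  fixes f :: "'a \<Rightarrow> 'e::banach_lattice"
  shows "strongly_measurable M f \<Longrightarrow> strongly_measurable M (\<lambda>x. \<bar>f x\<bar>)"
  by (rule strongly_measurable_compose[where p = abs]) (simp_all add: tendsto_abs_lattice)

lemma strongly_measurable_indicator_scaleR:
  assumes "strongly_measurable M f" "A \<in> sets M"
  shows "strongly_measurable M (\<lambda>x. indicator A x *\<^sub>R f x)"
proof -
  obtain s where s: "\<forall>i. simple_integrable M (s i)" "AE x in M. (\<lambda>i. s i x) \<longlonglongrightarrow> f x"
    using assms(1) unfolding strongly_measurable_def by blast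
  show ?thesis unfolding strongly_measurable_def
  proof (intro exI conjI allI)
    show "simple_integrable M (\<lambda>x. indicator A x *\<^sub>R s i x)" for i
      using s assms(2) by (intro simple_integrable_indicator_scaleR) auto
    show "AE x in M. (\<lambda>i. indicat_real A x *\<^sub>R s i x) \<longlonglongrightarrow> indicat_real A x *\<^sub>R f x"
      using s(2) by eventually_elim (intro tendsto_intros)
  qed
qed

lemma strongly_measurable_norm_AE_measurable:
  assumes "strongly_measurable M f"
  shows "\<exists>h\<in>borel_measurable M. AE x in M. norm (f x) = (h x :: real)"
proof -
  obtain s where s: "\<And>i. simple_integrable M (s i)" "AE x in M. (\<lambda>i. s i x) \<longlonglongrightarrow> f x"
    using assms unfolding strongly_measurable_def by blast
  have "(\<lambda>x. norm (s i x)) \<in> borel_measurable M" for i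
    using simple_integrable_compose[OF s(1)[of i], of norm]
    by (auto elim!: simple_bochner_integrable.cases intro: borel_measurable_simple_function)
  then have "(\<lambda>x. lim (\<lambda>i. norm (s i x))) \<in> borel_measurable M"
    by (rule borel_measurable_lim_metric)
  moreover have "AE x in M. norm (f x) = lim (\<lambda>i. norm (s i x))"
    using s(2) by eventually_elim (metis limI tendsto_norm)
  ultimately show ?thesis by (intro bexI[of _ "\<lambda>x. lim (\<lambda>i. norm (s i x))"])
qed

text \<open>Strong measurability holds only up to null sets, while additivity of
  \<open>nn_integral\<close> asks for measurable integrands; hence the passage to Borel versions of
  the two norms.\<close>

lemma nn_integral_norm_triangle:
  assumes "strongly_measurable M f" "strongly_measurable M g"
    and "\<And>x. norm (h x) \<le> norm (f x) + norm (g x)"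
  shows "(\<integral>\<^sup>+x. norm (h x) \<partial>M) \<le> (\<integral>\<^sup>+x. norm (f x) \<partial>M) + (\<integral>\<^sup>+x. norm (g x) \<partial>M)"
proof -
  obtain f' g' :: "'a \<Rightarrow> real" where f': "f' \<in> borel_measurable M" "AE x in M. norm (f x) = f' x"
    and g': "g' \<in> borel_measurable M" "AE x in M. norm (g x) = g' x"
    using assms(1,2) strongly_measurable_norm_AE_measurable by metis
  have "(\<integral>\<^sup>+x. norm (h x) \<partial>M) \<le> (\<integral>\<^sup>+x. ennreal (f' x) + ennreal (g' x) \<partial>M)"
  proof (rule nn_integral_mono_AE)
    show "AE x in M. ennreal (norm (h x)) \<le> ennreal (f' x) + ennreal (g' x)"
      using f'(2) g'(2)
    proof eventually_elim
      case (elim x)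
      have "ennreal (norm (h x)) \<le> ennreal (norm (f x) + norm (g x))"
        by (intro ennreal_leI assms(3))
      also have "\<dots> = ennreal (norm (f x)) + ennreal (norm (g x))"
        by (intro ennreal_plus) auto
      finally show ?case using elim by simp
    qed
  qed
  also have "\<dots> = (\<integral>\<^sup>+x. ennreal (f' x) \<partial>M) + (\<integral>\<^sup>+x. ennreal (g' x) \<partial>M)"
    using f'(1) g'(1) by (intro nn_integral_add) auto
  also have "(\<integral>\<^sup>+x. ennreal (f' x) \<partial>M) = (\<integral>\<^sup>+x. norm (f x) \<partial>M)"
    by (rule nn_integral_cong_AE) (use f'(2) in \<open>eventually_elim, simp\<close>)
  also have "(\<integral>\<^sup>+x. ennreal (g' x) \<partial>M) = (\<integral>\<^sup>+x. norm (g x) \<partial>M)"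
    by (rule nn_integral_cong_AE) (use g'(2) in \<open>eventually_elim, simp\<close>)
  finally show ?thesis .
qed

definition L1_approx :: "'a measure \<Rightarrow> ('a \<Rightarrow> 'b::real_normed_vector) \<Rightarrow> (nat \<Rightarrow> 'a \<Rightarrow> 'b) \<Rightarrow> bool" where
  "L1_approx M f s \<longleftrightarrow> (\<forall>i. simple_integrable M (s i)) \<and>
    (\<lambda>i. \<integral>\<^sup>+x. norm (f x - s i x) \<partial>M) \<longlonglongrightarrow> 0"

lemma has_bochner_int_iff:
  "has_bochner_int M f v \<longleftrightarrow> strongly_measurable M f \<and>
    (\<exists>s. L1_approx M f s \<and> (\<lambda>i. simple_int M (s i)) \<longlonglongrightarrow> v)"
  unfolding has_bochner_int_def L1_approx_def by blast

lemma simple_int_dist_le: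
  assumes f: "strongly_measurable M f" and s: "simple_integrable M s" and t: "simple_integrable M t"
  shows "ennreal (norm (simple_int M s - simple_int M t)) \<le>
    (\<integral>\<^sup>+x. norm (f x - s x) \<partial>M) + (\<integral>\<^sup>+x. norm (f x - t x) \<partial>M)"
proof -
  have "ennreal (norm (simple_int M s - simple_int M t)) =
      ennreal (norm (simple_int M (\<lambda>x. s x - t x)))"
    by (simp add: simple_bochner_integral_diff[OF s t])
  also have "\<dots> \<le> (\<integral>\<^sup>+x. norm (s x - t x) \<partial>M)"
    by (intro simple_int_norm_le simple_integrable_diff s t)
  also have "\<dots> \<le> (\<integral>\<^sup>+x. norm (f x - s x) \<partial>M) + (\<integral>\<^sup>+x. norm (f x - t x) \<partial>M)"
  proof (intro nn_integral_norm_triangle strongly_measurable_diff f strongly_measurable_simple s t)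
    show "norm (s x - t x) \<le> norm (f x - s x) + norm (f x - t x)" for x
      using norm_triangle_ineq4[of "f x - t x" "f x - s x"] by (simp add: add.commute)
  qed
  finally show ?thesis .
qed

lemma L1_approx_limit_unique:
  assumes f: "strongly_measurable M f" and s: "L1_approx M f s" and t: "L1_approx M f t"
    and v: "(\<lambda>i. simple_int M (s i)) \<longlonglongrightarrow> v"
  shows "(\<lambda>i. simple_int M (t i)) \<longlonglongrightarrow> v"
proof -
  have "(\<lambda>i. (\<integral>\<^sup>+x. norm (f x - s i x) \<partial>M) + (\<integral>\<^sup>+x. norm (f x - t i x) \<partial>M)) \<longlonglongrightarrow> 0 + 0"
    using s t unfolding L1_approx_def by (intro tendsto_add) blast+
  then have lim: "(\<lambda>i. (\<integral>\<^sup>+x. norm (f x - s i x) \<partial>M) + (\<integral>\<^sup>+x. norm (f x - t i x) \<partial>M)) \<longlonglongrightarrow> 0"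
    by simp
  have "(\<lambda>i. ennreal (norm (simple_int M (s i) - simple_int M (t i)))) \<longlonglongrightarrow> 0"
  proof (rule tendsto_sandwich[OF _ _ tendsto_const lim])
    show "\<forall>\<^sub>F i in sequentially. ennreal (norm (simple_int M (s i) - simple_int M (t i))) \<le>
        (\<integral>\<^sup>+x. norm (f x - s i x) \<partial>M) + (\<integral>\<^sup>+x. norm (f x - t i x) \<partial>M)"
      using s t unfolding L1_approx_def by (intro always_eventually allI simple_int_dist_le f) blast+
  qed simp_all
  then have "(\<lambda>i. norm (simple_int M (s i) - simple_int M (t i))) \<longlonglongrightarrow> 0"
    by (subst (asm) ennreal_tendsto_0_iff) auto
  then have "(\<lambda>i. simple_int M (s i) - simple_int M (t i)) \<longlonglongrightarrow> 0"
    by (rule tendsto_norm_zero_cancel)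
  from tendsto_diff[OF v this] show ?thesis by simp
qed

lemma has_bochner_int_unique:
  assumes "has_bochner_int M f v" "has_bochner_int M f w"
  shows "v = w"
  using assms L1_approx_limit_unique LIMSEQ_unique unfolding has_bochner_int_iff by metis

lemma bochner_int_eq: "has_bochner_int M f v \<Longrightarrow> bochner_int M f = v"
  unfolding bochner_int_def using has_bochner_int_unique by blast

lemma L1_approx_convergent:
  fixes f :: "'a \<Rightarrow> 'b::banach"
  assumes f: "strongly_measurable M f" and s: "L1_approx M f s"
  shows "convergent (\<lambda>i. simple_int M (s i))"
proof (rule Cauchy_convergent[OF metric_CauchyI])
  fix \<epsilon> :: real assume "0 < \<epsilon>"
  then have "(0::ennreal) < ennreal (\<epsilon> / 2)" by simp
  moreover have lim: "(\<lambda>i. \<integral>\<^sup>+x. norm (f x - s i x) \<partial>M) \<longlonglongrightarrow> 0" and si: "\<And>i. simple_integrable M (s i)"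
    using s unfolding L1_approx_def by auto
  ultimately obtain N where N: "\<And>i. i \<ge> N \<Longrightarrow> (\<integral>\<^sup>+x. norm (f x - s i x) \<partial>M) < ennreal (\<epsilon> / 2)"
    using order_tendstoD(2)[OF lim] unfolding eventually_sequentially by metis
  have "dist (simple_int M (s i)) (simple_int M (s j)) < \<epsilon>" if "i \<ge> N" "j \<ge> N" for i j
  proof -
    have "ennreal (norm (simple_int M (s i) - simple_int M (s j))) < ennreal (\<epsilon> / 2) + ennreal (\<epsilon> / 2)"
      by (rule order_le_less_trans[OF simple_int_dist_le[OF f si si]])
         (intro add_strict_mono N that)
    also have "\<dots> = ennreal \<epsilon>" using \<open>0 < \<epsilon>\<close> by (simp flip: ennreal_plus)
    finally show ?thesis using \<open>0 < \<epsilon>\<close> by (simp add: dist_norm ennreal_less_iff)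
  qed
  then show "\<exists>N. \<forall>i\<ge>N. \<forall>j\<ge>N. dist (simple_int M (s i)) (simple_int M (s j)) < \<epsilon>" by blast
qed

text \<open>If \<open>P\<close> does not increase the distance to the integrand, it carries
  approximations of \<open>f\<close> to approximations of \<open>g\<close>. Both integrals are
  exposed as limits along one sequence, so inequalities between simple integrals pass to them. Used
  for the norm, the absolute value and restriction to a set.\<close>

lemma has_bochner_int_dominated:
  fixes f :: "'a \<Rightarrow> 'b::real_normed_vector" and g :: "'a \<Rightarrow> 'c::banach"
  assumes f: "has_bochner_int M f v" and g: "strongly_measurable M g"
    and P: "\<And>s. simple_integrable M s \<Longrightarrow> simple_integrable M (P s)"
    and le: "\<And>s x. norm (g x - P s x) \<le> norm (f x - s x)"
  obtains s w where "L1_approx M f s" "(\<lambda>i. simple_int M (s i)) \<longlonglongrightarrow> v"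
    "has_bochner_int M g w" "(\<lambda>i. simple_int M (P (s i))) \<longlonglongrightarrow> w"
proof -
  obtain s where s: "L1_approx M f s" "(\<lambda>i. simple_int M (s i)) \<longlonglongrightarrow> v"
    using f unfolding has_bochner_int_iff by blast
  have a: "L1_approx M g (\<lambda>i. P (s i))"
    unfolding L1_approx_def
  proof (intro conjI allI)
    show "simple_integrable M (P (s i))" for i using s(1) P unfolding L1_approx_def by blast
    show "(\<lambda>i. \<integral>\<^sup>+x. norm (g x - P (s i) x) \<partial>M) \<longlonglongrightarrow> 0"
    proof (rule tendsto_sandwich[OF _ _ tendsto_const])
      show "(\<lambda>i. \<integral>\<^sup>+x. norm (f x - s i x) \<partial>M) \<longlonglongrightarrow> 0" using s(1) unfolding L1_approx_def by blast
    qed (auto intro!: nn_integral_mono le ennreal_leI always_eventually)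
  qed
  then obtain w where "(\<lambda>i. simple_int M (P (s i))) \<longlonglongrightarrow> w"
    using L1_approx_convergent[OF g] unfolding convergent_def by blast
  with a g s that show ?thesis unfolding has_bochner_int_iff by blast
qed

lemma has_bochner_int_simple:
  assumes "simple_integrable M s"
  shows "has_bochner_int M s (simple_int M s)"
  unfolding has_bochner_int_iff L1_approx_def
  using assms by (intro conjI strongly_measurable_simple exI[of _ "\<lambda>_. s"]) auto

lemma has_bochner_int_indicator:
  fixes b :: "'b::real_normed_vector"
  assumes "A \<in> sets M" "emeasure M A < \<infinity>"
  shows "has_bochner_int M (\<lambda>x. indicator A x *\<^sub>R b) (measure M A *\<^sub>R b)"
  using has_bochner_int_simple[OF simple_integrable_indicator(1)[OF assms, of b]]
  by (simp only: simple_integrable_indicator(2)[OF assms])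

lemma has_bochner_int_add:
  assumes f: "has_bochner_int M f v" and g: "has_bochner_int M g w"
  shows "has_bochner_int M (\<lambda>x. f x + g x) (v + w)"
proof -
  obtain s where s: "\<And>i. simple_integrable M (s i)" "(\<lambda>i. \<integral>\<^sup>+x. norm (f x - s i x) \<partial>M) \<longlonglongrightarrow> 0"
      "(\<lambda>i. simple_int M (s i)) \<longlonglongrightarrow> v"
    using f unfolding has_bochner_int_iff L1_approx_def by blast
  obtain t where t: "\<And>i. simple_integrable M (t i)" "(\<lambda>i. \<integral>\<^sup>+x. norm (g x - t i x) \<partial>M) \<longlonglongrightarrow> 0"
      "(\<lambda>i. simple_int M (t i)) \<longlonglongrightarrow> w"
    using g unfolding has_bochner_int_iff L1_approx_def by blast
  have m: "strongly_measurable M f" "strongly_measurable M g"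
    using f g unfolding has_bochner_int_iff by auto
  show ?thesis unfolding has_bochner_int_iff L1_approx_def
  proof (intro conjI exI[of _ "\<lambda>i x. s i x + t i x"] allI strongly_measurable_add m simple_integrable_add s(1) t(1))
    show "(\<lambda>i. \<integral>\<^sup>+x. norm (f x + g x - (s i x + t i x)) \<partial>M) \<longlonglongrightarrow> 0"
    proof (rule tendsto_sandwich[OF _ _ tendsto_const])
      show "(\<lambda>i. (\<integral>\<^sup>+x. norm (f x - s i x) \<partial>M) + (\<integral>\<^sup>+x. norm (g x - t i x) \<partial>M)) \<longlonglongrightarrow> 0"
        using tendsto_add[OF s(2) t(2)] by simp
      show "\<forall>\<^sub>F i in sequentially. (\<integral>\<^sup>+x. norm (f x + g x - (s i x + t i x)) \<partial>M) \<le>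
          (\<integral>\<^sup>+x. norm (f x - s i x) \<partial>M) + (\<integral>\<^sup>+x. norm (g x - t i x) \<partial>M)"
        by (intro always_eventually allI nn_integral_norm_triangle strongly_measurable_diff m
            strongly_measurable_simple s t norm_diff_triangle_ineq)
    qed simp
    show "(\<lambda>i. simple_int M (\<lambda>x. s i x + t i x)) \<longlonglongrightarrow> v + w"
      using tendsto_add[OF s(3) t(3)] by (simp add: simple_bochner_integral_add s(1) t(1))
  qed
qed

lemma simple_int_zero: "simple_int M (\<lambda>x. 0) = 0"
  unfolding Bochner_Integration.simple_bochner_integral_def by (intro sum.neutral) auto

lemma has_bochner_int_zero: "has_bochner_int M (\<lambda>x. 0) 0"
  using has_bochner_int_simple[OF simple_integrable_zero, of M] by (simp only: simple_int_zero)

lemma has_bochner_int_strongly_measurable: "has_bochner_int M f v \<Longrightarrow> strongly_measurable M f"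
  by (simp add: has_bochner_int_def)

lemma has_bochner_int_sum:
  assumes "finite I" "\<And>i. i \<in> I \<Longrightarrow> has_bochner_int M (f i) (v i)"
  shows "has_bochner_int M (\<lambda>x. \<Sum>i\<in>I. f i x) (\<Sum>i\<in>I. v i)"
  using assms
  by (induction I rule: finite_induct) (auto simp: has_bochner_int_zero intro!: has_bochner_int_add)

lemma has_bochner_int_AE_zero:
  assumes f: "has_bochner_int M f v" and "AE x in M. f x = 0"
  shows "v = 0"
proof -
  obtain s where s: "L1_approx M f s" "(\<lambda>i. simple_int M (s i)) \<longlonglongrightarrow> v"
    using f unfolding has_bochner_int_iff by blast
  have "(\<integral>\<^sup>+x. norm (f x - 0) \<partial>M) = (\<integral>\<^sup>+x. 0 \<partial>M)"
    by (rule nn_integral_cong_AE) (use assms(2) in \<open>eventually_elim, simp\<close>)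
  then have "L1_approx M f (\<lambda>i x. 0)"
    unfolding L1_approx_def by (simp add: simple_integrable_zero)
  then have "(\<lambda>i. simple_int M (\<lambda>x. 0 :: 'b)) \<longlonglongrightarrow> v"
    using L1_approx_limit_unique s f unfolding has_bochner_int_iff by blast
  then have "v = simple_int M (\<lambda>x. 0)" using LIMSEQ_unique tendsto_const by blast
  then show ?thesis by (simp only: simple_int_zero)
qed

lemma bochner_integrable_norm:
  assumes f: "has_bochner_int M f v"
  shows "\<exists>r. has_bochner_int M (\<lambda>x. norm (f x)) r \<and> norm v \<le> r"
proof -
  obtain s w where s: "L1_approx M f s" "(\<lambda>i. simple_int M (s i)) \<longlonglongrightarrow> v"
      "has_bochner_int M (\<lambda>x. norm (f x)) w" "(\<lambda>i. simple_int M (\<lambda>x. norm (s i x))) \<longlonglongrightarrow> w"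
  proof (rule has_bochner_int_dominated[OF f, of "\<lambda>x. norm (f x)" "\<lambda>s x. norm (s x)"])
    show "strongly_measurable M (\<lambda>x. norm (f x))"
      by (intro strongly_measurable_norm has_bochner_int_strongly_measurable[OF f])
    show "simple_integrable M (\<lambda>x. norm (s x))" if "simple_integrable M s" for s :: "_ \<Rightarrow> 'b"
      by (rule simple_integrable_compose[OF that]) simp
    show "norm (norm (f x) - norm (s x)) \<le> norm (f x - s x)" for s x
      by (simp add: norm_triangle_ineq3)
  qed
  have "norm v \<le> w"
  proof (rule LIMSEQ_le[OF tendsto_norm[OF s(2)] s(4)])
    show "\<exists>N. \<forall>i\<ge>N. norm (simple_int M (s i)) \<le> simple_int M (\<lambda>x. norm (s i x))"
      using s(1) unfolding L1_approx_def by (blast intro: simple_bochner_integral_norm_bound)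
  qed
  then show ?thesis using s(3) by blast
qed

lemma simple_int_nonneg:
  fixes s :: "'a \<Rightarrow> 'e::banach_lattice"
  shows "(\<And>x. 0 \<le> s x) \<Longrightarrow> 0 \<le> simple_int M s"
  unfolding Bochner_Integration.simple_bochner_integral_def
  by (intro sum_nonneg scaleR_nonneg_nonneg measure_nonneg) blast

lemma bochner_integrable_abs:
  fixes f :: "'a \<Rightarrow> 'e::banach_lattice"
  assumes f: "has_bochner_int M f v"
  shows "\<exists>w. has_bochner_int M (\<lambda>x. \<bar>f x\<bar>) w \<and> 0 \<le> w"
proof -
  obtain s w where s: "L1_approx M f s" "(\<lambda>i. simple_int M (s i)) \<longlonglongrightarrow> v"
      "has_bochner_int M (\<lambda>x. \<bar>f x\<bar>) w" "(\<lambda>i. simple_int M (\<lambda>x. \<bar>s i x\<bar>)) \<longlonglongrightarrow> w"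
  proof (rule has_bochner_int_dominated[OF f, of "\<lambda>x. \<bar>f x\<bar>" "\<lambda>s x. \<bar>s x\<bar>"])
    show "strongly_measurable M (\<lambda>x. \<bar>f x\<bar>)"
      by (intro strongly_measurable_abs has_bochner_int_strongly_measurable[OF f])
    show "simple_integrable M (\<lambda>x. \<bar>s x\<bar>)" if "simple_integrable M s" for s :: "_ \<Rightarrow> 'e"
      by (rule simple_integrable_compose[OF that]) (rule abs_zero)
    show "norm (\<bar>f x\<bar> - \<bar>s x\<bar>) \<le> norm (f x - s x)" for s x
      by (rule norm_abs_diff_le)
  qed
  have "0 \<le> w"
    by (rule tendsto_nonneg_lattice[OF s(4) sequentially_bot]) (intro simple_int_nonneg abs_ge_zero)
  then show ?thesis using s(3) by blast
qed

lemma locally_integrable_indicator: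
  fixes f :: "'a::topological_space \<Rightarrow> 'b::banach"
  assumes "locally_integrable M f" "A \<in> sets M" "compact K" "A \<subseteq> K"
  shows "bochner_integrable M (\<lambda>x. indicator A x *\<^sub>R f x)"
proof -
  obtain v where v: "has_bochner_int M (\<lambda>x. indicator K x *\<^sub>R f x) v"
    using assms(1,3) unfolding locally_integrable_def bochner_integrable_def by blast
  have AK: "(\<lambda>x. indicator A x *\<^sub>R f x) = (\<lambda>x. indicator A x *\<^sub>R (indicator K x *\<^sub>R f x))"
    using assms(4) by (auto simp: indicator_def fun_eq_iff)
  obtain w where "has_bochner_int M (\<lambda>x. indicator A x *\<^sub>R f x) w"
  proof (rule has_bochner_int_dominated[OF v, of "\<lambda>x. indicator A x *\<^sub>R f x" "\<lambda>s x. indicator A x *\<^sub>R s x"])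
    show "strongly_measurable M (\<lambda>x. indicator A x *\<^sub>R f x)"
      unfolding AK
      by (rule strongly_measurable_indicator_scaleR[OF has_bochner_int_strongly_measurable[OF v] assms(2)])
    show "simple_integrable M (\<lambda>x. indicator A x *\<^sub>R s x)" if "simple_integrable M s" for s :: "_ \<Rightarrow> 'b"
      by (rule simple_integrable_indicator_scaleR[OF that assms(2)])
    show "norm (indicator A x *\<^sub>R f x - indicator A x *\<^sub>R s x) \<le> norm (indicator K x *\<^sub>R f x - s x)" for s x
      using assms(4) by (auto simp: indicator_def)
  qed
  then show ?thesis unfolding bochner_integrable_def by blast
qed

section \<open>Dyadic cubes\<close>

text \<open>Floors turn the geometry into integer arithmetic: passing to a coarser cube divides the
  index, and the remainder tells the position inside.\<close>

lemma mem_dyadic_cube: "x \<in> dyadic_cube k m \<longleftrightarrow> (\<forall>i. \<lfloor>2 powi k * x $ i\<rfloor> = m $ i)"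
proof -
  have pos: "(2::real) powi k > 0" by simp
  have inv: "(2::real) powi (-k) = 1 / 2 powi k" by (simp add: power_int_minus field_simps)
  have "x \<in> dyadic_cube k m \<longleftrightarrow>
      (\<exists>y. (\<forall>i. 0 \<le> y $ i \<and> y $ i < 1) \<and> (\<forall>i. x $ i = (1 / 2 powi k) * (y $ i + of_int (m $ i))))"
    by (auto simp: dyadic_cube_def image_iff vec_eq_iff inv)
  also have "\<dots> \<longleftrightarrow> (\<forall>i. 0 \<le> 2 powi k * x $ i - of_int (m $ i) \<and> 2 powi k * x $ i - of_int (m $ i) < 1)"
    (is "?l = ?r")
  proof
    assume ?l
    then obtain y where y: "\<forall>i. 0 \<le> y $ i \<and> y $ i < 1"
      "\<forall>i. x $ i = (1 / 2 powi k) * (y $ i + of_int (m $ i))" by blast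
    have "2 powi k * x $ i - of_int (m $ i) = y $ i" for i using y(2) pos by simp
    then show ?r using y(1) by simp
  next
    assume ?r
    then show ?l using pos
      by (intro exI[of _ "\<chi> i. 2 powi k * x $ i - of_int (m $ i)"]) simp
  qed
  also have "\<dots> \<longleftrightarrow> (\<forall>i. \<lfloor>2 powi k * x $ i\<rfloor> = m $ i)"
    by (auto simp: floor_eq_iff algebra_simps)
  finally show ?thesis .
qed

text \<open>The index at the coarser scale is the integer quotient of the finer one by
  \<open>2 ^ j\<close>, so one common point decides the coarse index for the whole finer
  cube.\<close>

lemma dyadic_cubes_laminar_aux:
  assumes "x \<in> dyadic_cube k m" "x \<in> dyadic_cube (k + int j) m'"
  shows "dyadic_cube (k + int j) m' \<subseteq> dyadic_cube k m"
proof
  fix z assume z: "z \<in> dyadic_cube (k + int j) m'"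
  have fl: "\<lfloor>2 powi k * y\<rfloor> = \<lfloor>2 powi (k + int j) * y\<rfloor> div 2 ^ j" for y :: real
  proof -
    have "2 powi k * y = 2 powi (k + int j) * y / of_int (2 ^ j)"
      by (simp add: power_int_add)
    then show ?thesis by (simp only: floor_divide_real_eq_div zero_le_power zero_le_numeral)
  qed
  show "z \<in> dyadic_cube k m" unfolding mem_dyadic_cube
  proof
    fix i
    have "\<lfloor>2 powi k * z $ i\<rfloor> = m' $ i div 2 ^ j" using z by (simp add: fl mem_dyadic_cube)
    also have "\<dots> = \<lfloor>2 powi k * x $ i\<rfloor>" using assms(2) by (simp add: fl mem_dyadic_cube)
    also have "\<dots> = m $ i" using assms(1) by (simp add: mem_dyadic_cube)
    finally show "\<lfloor>2 powi k * z $ i\<rfloor> = m $ i" .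
  qed
qed

lemma dyadic_cubes_laminar:
  assumes "P \<in> dyadic_cubes" "Q \<in> dyadic_cubes"
  shows "P \<subseteq> Q \<or> Q \<subseteq> P \<or> P \<inter> Q = {}"
proof (cases "P \<inter> Q = {}")
  case False
  then obtain x where x: "x \<in> P" "x \<in> Q" by blast
  obtain k m l r where P: "P = dyadic_cube k m" and Q: "Q = dyadic_cube l r"
    using assms unfolding dyadic_cubes_def by blast
  show ?thesis
  proof (cases "k \<le> l")
    case True
    then obtain j where j: "l = k + int j" by (metis zle_iff_zadd)
    show ?thesis using dyadic_cubes_laminar_aux[of x k m j r] x unfolding P Q j by blast
  next
    case False
    then obtain j where j: "k = l + int j" by (metis zle_iff_zadd nle_le)
    show ?thesis using dyadic_cubes_laminar_aux[of x l r j m] x unfolding P Q j by blast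
  qed
qed simp

text \<open>Enclosing the half-open cube between an open and a closed box of equal volume yields
  both its measure and its boundedness.\<close>

lemma dyadic_cube_between:
  fixes m :: "int ^ 'n" and k :: int
  defines "a \<equiv> (\<chi> i. of_int (m $ i) / 2 powi k) :: real ^ 'n"
    and "b \<equiv> (\<chi> i. (of_int (m $ i) + 1) / 2 powi k)"
  shows "box a b \<subseteq> dyadic_cube k m" "dyadic_cube k m \<subseteq> cbox a b"
    and "b - a = (\<chi> i. 1 / 2 powi k)"
proof -
  have pos: "(2::real) powi k > 0" by simp
  show "box a b \<subseteq> dyadic_cube k m"
    using pos by (auto simp: mem_box_cart mem_dyadic_cube floor_eq_iff a_def b_def field_simps
        less_imp_le)
  show "dyadic_cube k m \<subseteq> cbox a b"
  proof
    fix x assume x: "x \<in> dyadic_cube k m"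
    have "of_int (m $ i) \<le> 2 powi k * x $ i \<and> 2 powi k * x $ i < of_int (m $ i) + 1" for i
      using x by (simp add: mem_dyadic_cube floor_eq_iff)
    then show "x \<in> cbox a b"
      using pos by (auto simp: mem_box_cart a_def b_def field_simps less_imp_le)
  qed
  show "b - a = (\<chi> i. 1 / 2 powi k)"
    by (simp add: vec_eq_iff a_def b_def diff_divide_distrib[symmetric])
qed

lemma dyadic_cube_borel: "(dyadic_cube k m :: (real ^ 'n) set) \<in> sets borel"
proof -
  have "(\<lambda>x :: real ^ 'n. x $ i) \<in> borel_measurable borel" for i
    by (intro borel_measurable_continuous_onI continuous_intros)
  then have "Measurable.pred borel (\<lambda>x :: real ^ 'n. \<forall>i. \<lfloor>2 powi k * x $ i\<rfloor> = m $ i)"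
    by measurable
  then have "{x \<in> space (borel :: (real ^ 'n) measure). \<forall>i. \<lfloor>2 powi k * x $ i\<rfloor> = m $ i} \<in> sets borel" by (rule predE)
  moreover have "{x \<in> space (borel :: (real ^ 'n) measure). \<forall>i. \<lfloor>2 powi k * x $ i\<rfloor> = m $ i} = dyadic_cube k m"
    by (auto simp: mem_dyadic_cube)
  ultimately show ?thesis by (simp only:)
qed

lemma dyadic_cube_subset_compact: "\<exists>K. compact K \<and> dyadic_cube k m \<subseteq> K"
  using dyadic_cube_between(2)[of k m] compact_cbox by blast

definition dyadic_volume :: "'n::finite itself \<Rightarrow> int \<Rightarrow> real" where
  "dyadic_volume _ k = (1 / 2 powi k) ^ CARD('n)"

lemma dyadic_volume_pos: "0 < dyadic_volume TYPE('n::finite) k"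
  by (simp add: dyadic_volume_def)

lemma dyadic_volume_Suc:
  "dyadic_volume TYPE('n::finite) (k + 1) = dyadic_volume TYPE('n) k / 2 ^ CARD('n)"
  by (simp add: dyadic_volume_def power_int_add power_divide power_mult_distrib)

lemma emeasure_dyadic_cube:
  "emeasure lborel (dyadic_cube k m :: (real ^ 'n) set) = ennreal (dyadic_volume TYPE('n) k)"
proof -
  define a b where "a = ((\<chi> i. of_int (m $ i) / 2 powi k) :: real ^ 'n)"
    and "b = ((\<chi> i. (of_int (m $ i) + 1) / 2 powi k) :: real ^ 'n)"
  note between = dyadic_cube_between[where m = m and k = k, folded a_def b_def]
  have inner: "(b - a) \<bullet> u = 1 / 2 powi k" if u: "u \<in> Basis" for u
  proof -
    obtain i where "u = axis i 1" using axis_inverse[OF u] by blast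
    then show ?thesis by (simp add: between(3) inner_axis)
  qed
  have le: "a \<bullet> u \<le> b \<bullet> u" if "u \<in> Basis" for u
  proof -
    have "0 \<le> (b - a) \<bullet> u" by (simp add: inner[OF that])
    then show ?thesis by (simp add: inner_diff_left)
  qed
  have "(\<Prod>u\<in>Basis. (b - a) \<bullet> u) = dyadic_volume TYPE('n) k"
    by (simp add: inner dyadic_volume_def)
  then have "emeasure lborel (box a b) = ennreal (dyadic_volume TYPE('n) k)"
    "emeasure lborel (cbox a b) = ennreal (dyadic_volume TYPE('n) k)"
    by (simp_all add: emeasure_lborel_box emeasure_lborel_cbox le)
  moreover have "emeasure lborel (box a b) \<le> emeasure lborel (dyadic_cube k m)"
    "emeasure lborel (dyadic_cube k m) \<le> emeasure lborel (cbox a b)"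
    using between by (auto intro!: emeasure_mono simp: dyadic_cube_borel)
  ultimately show ?thesis by simp
qed

lemma measure_dyadic_cube:
  "measure lborel (dyadic_cube k m :: (real ^ 'n) set) = dyadic_volume TYPE('n) k"
  using dyadic_volume_pos[where 'n = 'n, of k] by (simp add: measure_def emeasure_dyadic_cube)

definition child_index :: "int ^ 'n \<Rightarrow> 'n set \<Rightarrow> int ^ 'n" where
  "child_index m S = (\<chi> i. 2 * m $ i + of_bool (i \<in> S))"

text \<open>The parities of the fine indices of a point single out the one child that contains
  it.\<close>

lemma mem_dyadic_cube_child:
  "x \<in> dyadic_cube (k + 1) (child_index m S) \<longleftrightarrow>
    x \<in> dyadic_cube k m \<and> S = {i. odd \<lfloor>2 powi (k + 1) * x $ i\<rfloor>}"
proof -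
  have fl: "\<lfloor>2 powi k * y\<rfloor> = \<lfloor>2 powi (k + 1) * y\<rfloor> div 2" for y :: real
  proof -
    have "2 powi k * y = 2 powi (k + 1) * y / of_int 2"
      by (simp add: power_int_add)
    then show ?thesis by (simp only: floor_divide_real_eq_div zero_le_numeral)
  qed
  have int: "z = 2 * w + of_bool P \<longleftrightarrow> z div 2 = w \<and> (P \<longleftrightarrow> odd z)" for z w :: int and P
    by (cases P; simp; presburger)
  show ?thesis
    unfolding mem_dyadic_cube fl child_index_def vec_lambda_beta int by auto
qed

section \<open>Dyadic step functions as trees\<close>

text \<open>A tree describes a step function on a dyadic cube; the children of a node are its
  dyadic children, indexed by the sets of coordinates in which the upper half is taken.\<close>

datatype ('i, 'e) dtree = Leaf 'e | Node "'i set \<Rightarrow> ('i, 'e) dtree"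

primrec tree_mean :: "('i::finite, 'e::real_vector) dtree \<Rightarrow> 'e" where
  "tree_mean (Leaf b) = b"
| "tree_mean (Node c) = (1 / 2 ^ CARD('i)) *\<^sub>R (\<Sum>S\<in>UNIV. tree_mean (c S))"

primrec tree_fun :: "('n, 'e) dtree \<Rightarrow> int \<Rightarrow> int ^ 'n \<Rightarrow> real ^ 'n \<Rightarrow> 'e::real_vector" where
  "tree_fun (Leaf b) = (\<lambda>k m x. indicator (dyadic_cube k m) x *\<^sub>R b)"
| "tree_fun (Node c) = (\<lambda>k m x. \<Sum>S\<in>UNIV. tree_fun (c S) (k + 1) (child_index m S) x)"

primrec tree_cubes :: "('n, 'e) dtree \<Rightarrow> int \<Rightarrow> int ^ 'n \<Rightarrow> (real ^ 'n) set set" where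
  "tree_cubes (Leaf b) = (\<lambda>k m. {dyadic_cube k m})"
| "tree_cubes (Node c) = (\<lambda>k m. insert (dyadic_cube k m) (\<Union>S. tree_cubes (c S) (k + 1) (child_index m S)))"

text \<open>The argument \<open>s\<close> collects the means on the way down, so each leaf ends with
  the value of the martingale maximal function on its cube. Keeping the result a tree of the same
  shape lets \<open>tree_mean\<close> integrate functions of it.\<close>

primrec tree_max :: "('i::finite, 'e::banach_lattice) dtree \<Rightarrow> 'e \<Rightarrow> ('i, 'e) dtree" where
  "tree_max (Leaf b) = (\<lambda>s. Leaf (sup s b))"
| "tree_max (Node c) = (\<lambda>s. Node (\<lambda>S. tree_max (c S) (sup s (tree_mean (Node c)))))"

definition nonneg_tree :: "('i, 'e::banach_lattice) dtree \<Rightarrow> bool" where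
  "nonneg_tree t \<longleftrightarrow> (\<forall>b\<in>set_dtree t. 0 \<le> b)"

lemma nonneg_tree_simps [simp]:
  "nonneg_tree (Leaf b) \<longleftrightarrow> 0 \<le> b"
  "nonneg_tree (Node c) \<longleftrightarrow> (\<forall>S. nonneg_tree (c S))"
  by (auto simp: nonneg_tree_def)

lemma card_UNIV_set: "card (UNIV :: 'i::finite set set) = 2 ^ CARD('i)"
  by (metis Pow_UNIV card_Pow finite)

lemma tree_mean_nonneg: "nonneg_tree t \<Longrightarrow> 0 \<le> tree_mean (t :: ('i::finite, 'e::banach_lattice) dtree)"
proof (induction t)
  case (Node c)
  then have "0 \<le> tree_mean (c S)" for S by simp
  then show ?case by (simp only: tree_mean.simps) (intro scaleR_nonneg_nonneg sum_nonneg, auto)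
qed simp

lemma tree_mean_map_mono:
  fixes g h :: "'e \<Rightarrow> real"
  assumes "\<And>b. b \<in> set_dtree t \<Longrightarrow> g b \<le> h b"
  shows "tree_mean (map_dtree g t) \<le> tree_mean (map_dtree h (t :: ('i::finite, 'e) dtree))"
  using assms
proof (induction t)
  case (Node c)
  have "tree_mean (map_dtree g (c S)) \<le> tree_mean (map_dtree h (c S))" for S
    by (rule Node.IH) (use Node.prems in auto)
  then show ?case by (auto intro!: divide_right_mono sum_mono)
qed simp

lemma tree_mean_map_const:
  "tree_mean (map_dtree (\<lambda>_. a) t) = (a::real)"
  for t :: "('i::finite, 'e) dtree"
  by (induction t) (simp_all add: card_UNIV_set)

lemma tree_mean_map_cmult:
  "tree_mean (map_dtree (\<lambda>b. a * g b) t) = a * tree_mean (map_dtree g t)"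
  for t :: "('i::finite, 'e) dtree" and a :: real
  by (induction t) (simp_all add: sum_distrib_left)

lemma norm_tree_mean_le:
  "norm (tree_mean t) \<le> tree_mean (map_dtree norm t)"
  for t :: "('i::finite, 'e::real_normed_vector) dtree"
proof (induction t)
  case (Node c)
  have "norm (\<Sum>S\<in>UNIV. tree_mean (c S)) \<le> (\<Sum>S\<in>UNIV. tree_mean (map_dtree norm (c S)))"
    by (rule sum_norm_le) (use Node in auto)
  then show ?case by (simp add: divide_right_mono)
qed simp

lemma tree_fun_outside: "x \<notin> dyadic_cube k m \<Longrightarrow> tree_fun t k m x = 0"
proof (induction t arbitrary: k m)
  case (Node c)
  then have "tree_fun (c S) (k + 1) (child_index m S) x = 0" for S
    by (simp add: mem_dyadic_cube_child)
  then show ?case by simp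
qed simp

lemma tree_fun_Node:
  assumes "x \<in> dyadic_cube (k + 1) (child_index m S)"
  shows "tree_fun (Node c) k m x = tree_fun (c S) (k + 1) (child_index m S) x"
proof -
  have "tree_fun (c R) (k + 1) (child_index m R) x = 0" if "R \<noteq> S" for R
    using assms that by (intro tree_fun_outside) (simp add: mem_dyadic_cube_child)
  then have "(\<Sum>R\<in>UNIV. tree_fun (c R) (k + 1) (child_index m R) x) =
      (\<Sum>R\<in>{S}. tree_fun (c R) (k + 1) (child_index m R) x)"
    by (intro sum.mono_neutral_right) auto
  then show ?thesis by simp
qed

lemma dyadic_cube_has_child:
  assumes "x \<in> dyadic_cube k m"
  obtains S where "x \<in> dyadic_cube (k + 1) (child_index m S)"
  using assms by (auto simp: mem_dyadic_cube_child)

lemma map_tree_fun: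
  assumes "g 0 = 0"
  shows "g (tree_fun t k m x) = tree_fun (map_dtree g t) k m x"
proof (induction t arbitrary: k m)
  case (Leaf b)
  show ?case using assms by (simp add: indicator_def)
next
  case (Node c)
  show ?case
  proof (cases "x \<in> dyadic_cube k m")
    case True
    then obtain S where S: "x \<in> dyadic_cube (k + 1) (child_index m S)"
      by (rule dyadic_cube_has_child)
    show ?thesis
      using Node.IH[of "c S"] tree_fun_Node[OF S, of c] tree_fun_Node[OF S, of "map_dtree g \<circ> c"]
      by (simp add: comp_def)
  next
    case False
    then show ?thesis by (simp only: tree_fun_outside[OF False] assms)
  qed
qed

lemma tree_fun_nonneg:
  assumes "nonneg_tree t"
  shows "0 \<le> tree_fun t k m (x :: real ^ 'n)"
  using assms
proof (induction t arbitrary: k m)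
  case (Leaf b)
  then show ?case by (cases "x \<in> dyadic_cube k m") simp_all
next
  case (Node c)
  then have "0 \<le> tree_fun (c S) (k + 1) (child_index m S) x" for S by simp
  then show ?case by (simp only: tree_fun.simps) (intro sum_nonneg, auto)
qed

lemma tree_cubes_finite: "finite (tree_cubes t k m)"
  by (induction t arbitrary: k m) auto

lemma tree_cubes_dyadic: "tree_cubes t k m \<subseteq> dyadic_cubes"
proof (induction t arbitrary: k m)
  case (Node c)
  then have "tree_cubes (c S) (k + 1) (child_index m S) \<subseteq> dyadic_cubes" for S by simp
  then show ?case by (auto simp: dyadic_cubes_def)
qed (auto simp: dyadic_cubes_def)

lemma has_bochner_int_tree_fun:
  fixes t :: "('n::finite, 'e::real_normed_vector) dtree"
  shows "has_bochner_int lborel (tree_fun t k m) (dyadic_volume TYPE('n) k *\<^sub>R tree_mean t)"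
proof (induction t arbitrary: k m)
  case (Leaf b)
  show ?case
    using has_bochner_int_indicator[of "dyadic_cube k m" lborel b]
    by (simp add: dyadic_cube_borel emeasure_dyadic_cube measure_dyadic_cube)
next
  case (Node c)
  have "has_bochner_int lborel (\<lambda>x. \<Sum>S\<in>UNIV. tree_fun (c S) (k + 1) (child_index m S) x)
      (\<Sum>S\<in>UNIV. dyadic_volume TYPE('n) (k + 1) *\<^sub>R tree_mean (c S))"
    by (intro has_bochner_int_sum Node.IH) auto
  then show ?case by (simp add: dyadic_volume_Suc scaleR_sum_right)
qed

text \<open>For real leaves the standard Bochner integral is available and connects to
  \<open>nn_integral\<close>, in terms of which the L^p norms are defined.\<close>

lemma nn_integral_tree_fun:
  fixes t :: "('n::finite, real) dtree"
  assumes "\<And>b. b \<in> set_dtree t \<Longrightarrow> 0 \<le> b"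
  shows "(\<integral>\<^sup>+x. ennreal (tree_fun t k m x) \<partial>lborel) = ennreal (dyadic_volume TYPE('n) k * tree_mean t)"
    and "tree_fun t k m x \<ge> 0"
proof -
  have *: "has_bochner_integral lborel (tree_fun t k m) (dyadic_volume TYPE('n) k * tree_mean t)"
  proof (induction t arbitrary: k m)
    case (Leaf b)
    have "has_bochner_integral lborel (\<lambda>x. indicat_real (dyadic_cube k m) x *\<^sub>R b)
        (measure lborel (dyadic_cube k m :: (real ^ 'n) set) *\<^sub>R b)"
      by (intro has_bochner_integral_scaleR_left has_bochner_integral_real_indicator)
         (simp_all add: dyadic_cube_borel emeasure_dyadic_cube)
    then show ?case by (simp add: measure_dyadic_cube)
  next
    case (Node c)
    have "has_bochner_integral lborel (\<lambda>x. \<Sum>S\<in>UNIV. tree_fun (c S) (k + 1) (child_index m S) x)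
        (\<Sum>S\<in>UNIV. dyadic_volume TYPE('n) (k + 1) * tree_mean (c S))"
      by (intro has_bochner_integral_sum Node.IH) auto
    then show ?case by (simp add: dyadic_volume_Suc sum_distrib_left)
  qed
  have nn: "tree_fun t k m x \<ge> 0" for x
    using assms by (intro tree_fun_nonneg) (simp add: nonneg_tree_def)
  then show "tree_fun t k m x \<ge> 0" by simp
  show "(\<integral>\<^sup>+x. ennreal (tree_fun t k m x) \<partial>lborel) = ennreal (dyadic_volume TYPE('n) k * tree_mean t)"
    using * nn by (subst nn_integral_eq_integral) (auto simp: has_bochner_integral_iff)
qed

lemma average_tree:
  fixes t :: "('n::finite, 'e::real_normed_vector) dtree"
  assumes "\<And>x. x \<in> dyadic_cube k m \<Longrightarrow> F x = tree_fun t k m x"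
  shows "average lborel (dyadic_cube k m) F = tree_mean t"
proof -
  have "(\<lambda>x. indicator (dyadic_cube k m) x *\<^sub>R F x) = tree_fun t k m"
  proof
    fix x show "indicator (dyadic_cube k m) x *\<^sub>R F x = tree_fun t k m x"
      by (cases "x \<in> dyadic_cube k m") (simp_all add: assms tree_fun_outside)
  qed
  then show ?thesis
    using bochner_int_eq[OF has_bochner_int_tree_fun[of t k m]] dyadic_volume_pos[where 'n = 'n, of k]
    by (simp add: average_def measure_dyadic_cube)
qed

text \<open>The invariant is that the accumulated supremum \<open>s\<close> stays below
  \<open>U\<close>. \<open>F\<close> has to agree with the tree only on the current cube, so that
  the hypothesis passes to the children.\<close>

lemma tree_max_le:
  fixes t :: "('n::finite, 'e::banach_lattice) dtree"
  assumes g: "\<And>u w. 0 \<le> u \<Longrightarrow> u \<le> w \<Longrightarrow> g u \<le> (g w :: real)"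
    and "nonneg_tree t" "0 \<le> s"
    and "\<And>x. x \<in> dyadic_cube k m \<Longrightarrow> s \<le> U x"
    and "\<And>x. x \<in> dyadic_cube k m \<Longrightarrow> F x = tree_fun t k m x"
    and "\<And>Q x. Q \<in> tree_cubes t k m \<Longrightarrow> x \<in> Q \<Longrightarrow> average lborel Q F \<le> U x"
    and "x \<in> dyadic_cube k m"
  shows "tree_fun (map_dtree g (tree_max t s)) k m x \<le> g (U x)"
  using assms(2-)
proof (induction t arbitrary: k m s)
  case (Leaf b)
  have "average lborel (dyadic_cube k m) F = b"
    using average_tree[of k m F "Leaf b"] Leaf.prems(4) by simp
  then have "b \<le> U x" using Leaf.prems(5,6) by fastforce
  then have "sup s b \<le> U x" using Leaf.prems(3,6) by (intro le_supI) auto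
  moreover have "0 \<le> sup s b" using Leaf.prems(2) by (rule order_trans) (rule sup_ge1)
  ultimately show ?case using g Leaf.prems(6) by simp
next
  case (Node c)
  let ?a = "tree_mean (Node c)"
  obtain S where S: "x \<in> dyadic_cube (k + 1) (child_index m S)"
    using Node.prems(6) by (rule dyadic_cube_has_child)
  have avg: "average lborel (dyadic_cube k m) F = ?a"
    by (rule average_tree) (rule Node.prems(4))
  have "tree_fun (map_dtree g (tree_max (c S) (sup s ?a))) (k + 1) (child_index m S) x \<le> g (U x)"
  proof (rule Node.IH)
    show "c S \<in> range c" by simp
    show "nonneg_tree (c S)" using Node.prems(1) by simp
    show "0 \<le> sup s ?a" using Node.prems(2) by (rule order_trans) (rule sup_ge1)
    show "sup s ?a \<le> U y" if y: "y \<in> dyadic_cube (k + 1) (child_index m S)" for y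
    proof -
      have yk: "y \<in> dyadic_cube k m" using y by (simp add: mem_dyadic_cube_child)
      then have "average lborel (dyadic_cube k m) F \<le> U y" by (intro Node.prems(5)) auto
      then show ?thesis using Node.prems(3)[OF yk] avg by (intro le_supI) simp_all
    qed
    show "F y = tree_fun (c S) (k + 1) (child_index m S) y"
      if y: "y \<in> dyadic_cube (k + 1) (child_index m S)" for y
      using y tree_fun_Node[OF y, of c] Node.prems(4)[of y] by (simp add: mem_dyadic_cube_child)
    show "average lborel Q F \<le> U y"
      if "Q \<in> tree_cubes (c S) (k + 1) (child_index m S)" "y \<in> Q" for Q y
      using that by (intro Node.prems(5)) auto
  qed (rule S)
  then show ?case
    using tree_fun_Node[OF S, of "\<lambda>S. map_dtree g (tree_max (c S) (sup s ?a))"]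
    by (simp add: comp_def)
qed

section \<open>The weak-type inequality for dyadic trees\<close>

lemma Sup_fin_insert_least:
  fixes w :: "'e::lattice"
  assumes "finite A" "s \<le> w" "\<And>a. a \<in> A \<Longrightarrow> a \<le> w"
  shows "Sup_fin (insert s A) \<le> w"
  by (rule Sup_fin.boundedI) (use assms in auto)

lemma Sup_fin_insert_ge:
  fixes s :: "'e::lattice"
  assumes "finite A" "a \<in> insert s A"
  shows "a \<le> Sup_fin (insert s A)"
  using assms by (intro Sup_fin.coboundedI) auto

lemma lattice_maximal_ge:
  assumes "finite D"
  shows "0 \<le> lattice_maximal M D f x"
    and "Q \<in> D \<Longrightarrow> x \<in> Q \<Longrightarrow> average M Q (\<lambda>y. \<bar>f y\<bar>) \<le> lattice_maximal M D f x"
proof -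
  let ?A = "(\<lambda>Q. indicator Q x *\<^sub>R average M Q (\<lambda>y. \<bar>f y\<bar>)) ` D"
  show "0 \<le> lattice_maximal M D f x"
    unfolding lattice_maximal_def using assms by (intro Sup_fin_insert_ge) blast+
  assume Q: "Q \<in> D" "x \<in> Q"
  have "indicator Q x *\<^sub>R average M Q (\<lambda>y. \<bar>f y\<bar>) \<le> lattice_maximal M D f x"
    unfolding lattice_maximal_def using assms Q(1) by (intro Sup_fin_insert_ge) blast+
  then show "average M Q (\<lambda>y. \<bar>f y\<bar>) \<le> lattice_maximal M D f x" using Q(2) by simp
qed

text \<open>Rooting the tree at a unit cube makes \<open>tree_mean\<close> an integral, and the
  cubes of the tree serve as the collection. One constant fits all trees because the
  Hardy--Littlewood bound is uniform over finite collections.\<close>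

lemma tree_strong_type:
  assumes "hardy_littlewood_property TYPE('n::finite) TYPE('e::banach_lattice)"
  shows "\<exists>p>1. \<exists>K\<ge>0. \<forall>t :: ('n, 'e) dtree. nonneg_tree t \<longrightarrow>
    tree_mean (map_dtree (\<lambda>v. norm v powr p) (tree_max t 0)) \<le>
      K * tree_mean (map_dtree (\<lambda>v. norm v powr p) t)"
proof -
  obtain p C where p: "1 < p" and HL: "\<forall>D \<subseteq> (dyadic_cubes :: (real ^ 'n) set set). finite D \<longrightarrow>
      (\<forall>f :: real ^ 'n \<Rightarrow> 'e. in_Lp lborel p f \<longrightarrow>
        in_Lp lborel p (lattice_maximal lborel D f) \<and>
        Lp_norm lborel p (lattice_maximal lborel D f) \<le> C * Lp_norm lborel p f)"
    using assms unfolding hardy_littlewood_property_def by (elim exE conjE)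
  let ?g = "\<lambda>v :: 'e. norm v powr p"
  define K where "K = \<bar>C\<bar> powr p"
  have "tree_mean (map_dtree ?g (tree_max t 0)) \<le> K * tree_mean (map_dtree ?g t)"
    if t: "nonneg_tree t" for t :: "('n, 'e) dtree"
  proof -
    define f where "f = tree_fun t 0 (0 :: int ^ 'n)"
    define D where "D = tree_cubes t 0 (0 :: int ^ 'n)"
    define U where "U = lattice_maximal lborel D f"
    have fin: "finite D" unfolding D_def by (rule tree_cubes_finite)
    have vol: "dyadic_volume TYPE('n) 0 = 1" by (simp add: dyadic_volume_def)
    have "0 \<le> f x" for x unfolding f_def by (rule tree_fun_nonneg[OF t])
    then have abs_f: "\<bar>f x\<bar> = f x" for x by (simp only: abs_of_nonneg)
    have pow_f: "norm (f x) powr p = tree_fun (map_dtree ?g t) 0 0 x" for x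
      unfolding f_def using p by (intro map_tree_fun[where g = ?g]) simp
    have nn: "(\<integral>\<^sup>+x. ennreal (tree_fun (map_dtree ?g t') 0 0 x) \<partial>lborel) = ennreal (tree_mean (map_dtree ?g t'))"
      for t' :: "('n, 'e) dtree"
    proof -
      have "0 \<le> b" if "b \<in> set_dtree (map_dtree ?g t')" for b
        using that by (auto simp: dtree.set_map)
      then show ?thesis
        using nn_integral_tree_fun(1)[of "map_dtree ?g t'" 0 0] unfolding vol by simp
    qed
    have mean_nn: "0 \<le> tree_mean (map_dtree ?g t')" for t' :: "('n, 'e) dtree"
      using tree_mean_map_mono[of t' "\<lambda>_. 0" ?g] tree_mean_map_const[of 0 t'] by simp
    have int_f: "(\<integral>\<^sup>+x. norm (f x) powr p \<partial>lborel) = ennreal (tree_mean (map_dtree ?g t))"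
      by (simp only: pow_f nn)
    have "in_Lp lborel p f"
      unfolding in_Lp_def
    proof
      show "strongly_measurable lborel f"
        unfolding f_def by (rule has_bochner_int_strongly_measurable[OF has_bochner_int_tree_fun])
      show "(\<integral>\<^sup>+x. norm (f x) powr p \<partial>lborel) < \<infinity>" by (simp add: int_f)
    qed
    moreover have "D \<subseteq> dyadic_cubes" unfolding D_def by (rule tree_cubes_dyadic)
    ultimately have U: "in_Lp lborel p U" "Lp_norm lborel p U \<le> C * Lp_norm lborel p f"
      using HL fin unfolding U_def by simp_all
    define I where "I = enn2real (\<integral>\<^sup>+x. norm (U x) powr p \<partial>lborel)"
    have I: "(\<integral>\<^sup>+x. norm (U x) powr p \<partial>lborel) = ennreal I" "0 \<le> I"
      using U(1) by (auto simp: in_Lp_def I_def)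
    have Lf: "Lp_norm lborel p f = tree_mean (map_dtree ?g t) powr (1 / p)"
      unfolding Lp_norm_def int_f by (simp add: mean_nn)
    have "I powr (1 / p) \<le> C * tree_mean (map_dtree ?g t) powr (1 / p)"
      using U(2) unfolding Lf by (simp add: Lp_norm_def I_def)
    also have "\<dots> \<le> \<bar>C\<bar> * tree_mean (map_dtree ?g t) powr (1 / p)"
      by (intro mult_right_mono) auto
    finally have "(I powr (1 / p)) powr p \<le> (\<bar>C\<bar> * tree_mean (map_dtree ?g t) powr (1 / p)) powr p"
      using p by (intro powr_mono2) auto
    then have IK: "I \<le> K * tree_mean (map_dtree ?g t)"
      using p I(2) mean_nn[of t] by (simp add: powr_mult powr_powr K_def)
    have "tree_fun (map_dtree ?g (tree_max t 0)) 0 0 x \<le> norm (U x) powr p" for x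
    proof (cases "x \<in> dyadic_cube 0 (0 :: int ^ 'n)")
      case True
      show ?thesis
      proof (rule tree_max_le[where F = "\<lambda>y. \<bar>f y\<bar>" and g = ?g and U = U])
        show "norm u powr p \<le> norm w powr p" if "0 \<le> u" "u \<le> w" for u w :: 'e
          using p that by (intro powr_mono2 norm_mono_nonneg) auto
        show "0 \<le> U y" for y unfolding U_def by (rule lattice_maximal_ge[OF fin])
        show "\<bar>f y\<bar> = tree_fun t 0 0 y" for y by (simp only: abs_f) (simp only: f_def)
        show "average lborel Q (\<lambda>y. \<bar>f y\<bar>) \<le> U y" if "Q \<in> tree_cubes t 0 0" "y \<in> Q" for Q y
          unfolding U_def using that by (intro lattice_maximal_ge(2)[OF fin]) (simp_all add: D_def)
        show "nonneg_tree t" by (rule t)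
        show "x \<in> dyadic_cube 0 0" by (rule True)
      qed (rule order_refl)
    qed (simp add: tree_fun_outside)
    then have "(\<integral>\<^sup>+x. ennreal (tree_fun (map_dtree ?g (tree_max t 0)) 0 0 x) \<partial>lborel) \<le>
        (\<integral>\<^sup>+x. norm (U x) powr p \<partial>lborel)"
      by (intro nn_integral_mono ennreal_leI)
    then have "tree_mean (map_dtree ?g (tree_max t 0)) \<le> I"
      unfolding nn I(1) using I(2) by (simp add: ennreal_le_iff)
    then show ?thesis using IK by linarith
  qed
  moreover have "0 \<le> K" by (simp add: K_def)
  ultimately show ?thesis using p by blast
qed

text \<open>Calderon--Zygmund decomposition at height \<open>T\<close>: the maximal subtrees on which the mean of
  the norm exceeds \<open>T\<close> are replaced by their means.\<close>

primrec tree_cut :: "real \<Rightarrow> ('i::finite, 'e::real_normed_vector) dtree \<Rightarrow> ('i, 'e) dtree" where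
  "tree_cut T (Leaf b) = Leaf b"
| "tree_cut T (Node c) = (if T < tree_mean (map_dtree norm (Node c)) then Leaf (tree_mean (Node c))
    else Node (\<lambda>S. tree_cut T (c S)))"

text \<open>The relative volume of the union of the stopped cubes. A leaf of norm above
  \<open>T\<close> counts as stopped, although \<open>tree_cut\<close> keeps it unchanged.\<close>

primrec tree_stopped :: "real \<Rightarrow> ('i::finite, 'e::real_normed_vector) dtree \<Rightarrow> real" where
  "tree_stopped T (Leaf b) = of_bool (T < norm b)"
| "tree_stopped T (Node c) = (if T < tree_mean (map_dtree norm (Node c)) then 1
    else (1 / 2 ^ CARD('i)) * (\<Sum>S\<in>UNIV. tree_stopped T (c S)))"

text \<open>The distribution function of the maximal function at height \<open>T\<close>. The
  supremum \<open>s\<close> collected above the root remains an argument because it is the state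
  variable of the Bellman function.\<close>

definition tree_bad :: "real \<Rightarrow> ('i::finite, 'e::banach_lattice) dtree \<Rightarrow> 'e \<Rightarrow> real" where
  "tree_bad T t s = tree_mean (map_dtree (\<lambda>v. of_bool (T < norm v)) (tree_max t s))"

lemma tree_bad_Leaf: "tree_bad T (Leaf b) s = of_bool (T < norm (sup s b))"
  by (simp add: tree_bad_def)

lemma tree_bad_Node:
  "tree_bad T (Node c :: ('i::finite, 'e::banach_lattice) dtree) s =
    (1 / 2 ^ CARD('i)) * (\<Sum>S\<in>UNIV. tree_bad T (c S) (sup s (tree_mean (Node c))))"
  by (simp add: tree_bad_def comp_def)

lemma tree_bad_bounds: "0 \<le> tree_bad T t s" "tree_bad T t s \<le> 1"
  using tree_mean_map_mono[of "tree_max t s" "\<lambda>_. 0" "\<lambda>v. of_bool (T < norm v)"]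
    tree_mean_map_mono[of "tree_max t s" "\<lambda>v. of_bool (T < norm v)" "\<lambda>_. 1"]
    tree_mean_map_const[of 0 "tree_max t s"] tree_mean_map_const[of 1 "tree_max t s"]
  by (simp_all add: tree_bad_def)

lemma tree_mean_norm_nonneg: "0 \<le> tree_mean (map_dtree norm t)"
  for t :: "('i::finite, 'e::real_normed_vector) dtree"
  using norm_tree_mean_le[of t] norm_ge_zero order_trans by blast

text \<open>Markov's inequality over the stopped cubes, which are disjoint and on each of which the
  mean of the norm exceeds \<open>T\<close>.\<close>

lemma tree_stopped_le:
  assumes "0 < T"
  shows "tree_stopped T t \<le> tree_mean (map_dtree norm t) / T"
proof (induction t)
  case (Node c)
  show ?case
  proof (cases "T < tree_mean (map_dtree norm (Node c))")
    case False
    have "(\<Sum>S\<in>UNIV. tree_stopped T (c S)) \<le> (\<Sum>S\<in>UNIV. tree_mean (map_dtree norm (c S)) / T)"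
      by (intro sum_mono Node) auto
    then have "(1 / 2 ^ CARD('a)) * (\<Sum>S\<in>UNIV. tree_stopped T (c S)) \<le>
        (1 / 2 ^ CARD('a)) * (\<Sum>S\<in>UNIV. tree_mean (map_dtree norm (c S)) / T)"
      by (intro mult_left_mono) auto
    then show ?thesis using False by (simp add: sum_divide_distrib[symmetric] mult.commute comp_def)
  qed (use assms in \<open>simp add: field_simps\<close>)
qed (use assms in \<open>simp add: divide_simps\<close>)

lemma tree_mean_cut: "tree_mean (tree_cut T t) = tree_mean t"
  by (induction t) simp_all

lemma tree_mean_norm_cut_le: "tree_mean (map_dtree norm (tree_cut T t)) \<le> tree_mean (map_dtree norm t)"
proof (induction t)
  case (Node c)
  show ?case
  proof (cases "T < tree_mean (map_dtree norm (Node c))")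
    case True
    then show ?thesis using norm_tree_mean_le[of "Node c"] by simp
  next
    case False
    have "(\<Sum>S\<in>UNIV. tree_mean (map_dtree norm (tree_cut T (c S)))) \<le>
        (\<Sum>S\<in>UNIV. tree_mean (map_dtree norm (c S)))"
      by (intro sum_mono Node) auto
    then show ?thesis using False by (simp add: comp_def divide_right_mono)
  qed
qed simp

lemma nonneg_tree_cut: "nonneg_tree t \<Longrightarrow> nonneg_tree (tree_cut T t)"
proof (induction t)
  case (Node c)
  then show ?case using tree_mean_nonneg[of "Node c"] by (auto simp del: tree_mean.simps)
qed simp

text \<open>A leaf of the cut tree has a parent that was not cut, and a child's mean of the norm is
  at most \<open>2 ^ CARD('i)\<close> times its parent's. For the root the second hypothesis takes
  the place of the parent.\<close>

lemma tree_cut_leaves: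
  fixes t :: "('i::finite, 'e::real_normed_vector) dtree"
  assumes "0 < T" "tree_mean (map_dtree norm t) \<le> 2 ^ CARD('i) * T" "b \<in> set_dtree (tree_cut T t)"
  shows "norm b \<le> 2 ^ CARD('i) * T"
  using assms(2,3)
proof (induction t)
  case (Node c)
  show ?case
  proof (cases "T < tree_mean (map_dtree norm (Node c))")
    case True
    then have "b = tree_mean (Node c)" using Node.prems(2) by simp
    then show ?thesis using norm_tree_mean_le[of "Node c"] Node.prems(1) by simp
  next
    case False
    then obtain S where S: "b \<in> set_dtree (tree_cut T (c S))" using Node.prems(2) by auto
    have "tree_mean (map_dtree norm (c S)) \<le> (\<Sum>S\<in>UNIV. tree_mean (map_dtree norm (c S)))"
      by (intro member_le_sum tree_mean_norm_nonneg) auto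
    also have "\<dots> \<le> 2 ^ CARD('i) * T"
      using False by (simp add: comp_def field_simps)
    finally show ?thesis using Node.IH[of "c S"] S by simp
  qed
qed simp

text \<open>Cutting preserves the means of all remaining nodes, so the maximal function changes only
  on stopped cubes.\<close>

lemma tree_bad_cut: "tree_bad T t s \<le> tree_bad T (tree_cut T t) s + tree_stopped T t"
proof (induction t arbitrary: s)
  case (Leaf b)
  show ?case by simp
next
  case (Node c)
  show ?case
  proof (cases "T < tree_mean (map_dtree norm (Node c))")
    case True
    then have "tree_stopped T (Node c) = 1" by simp
    then show ?thesis
      using tree_bad_bounds(2)[of T "Node c" s] tree_bad_bounds(1)[of T "tree_cut T (Node c)" s] by linarith
  next
    case False
    let ?a = "tree_mean (Node c)"
    have a: "tree_mean (Node (\<lambda>S. tree_cut T (c S))) = ?a" by (simp add: tree_mean_cut)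
    have "(\<Sum>S\<in>UNIV. tree_bad T (c S) (sup s ?a)) \<le>
        (\<Sum>S\<in>UNIV. tree_bad T (tree_cut T (c S)) (sup s ?a) + tree_stopped T (c S))"
      by (intro sum_mono Node) auto
    then have "tree_bad T (Node c) s \<le> (1 / 2 ^ CARD('a)) *
        (\<Sum>S\<in>UNIV. tree_bad T (tree_cut T (c S)) (sup s ?a) + tree_stopped T (c S))"
      unfolding tree_bad_Node by (intro mult_left_mono) auto
    also have "\<dots> = tree_bad T (Node (\<lambda>S. tree_cut T (c S))) s + (1 / 2 ^ CARD('a)) * (\<Sum>S\<in>UNIV. tree_stopped T (c S))"
      unfolding tree_bad_Node a by (simp add: sum.distrib distrib_left)
    finally show ?thesis using False by simp
  qed
qed

text \<open>Chebyshev's inequality in L^p for the cut tree, whose leaves have norm at most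
  \<open>2 ^ CARD('n) * T\<close>, plus the volume of the stopped cubes. There is no oscillating
  part to estimate, because the cut tree has the same maximal function off the stopped
  cubes.\<close>

theorem tree_weak_type:
  assumes "hardy_littlewood_property TYPE('n::finite) TYPE('e::banach_lattice)"
  shows "\<exists>C>0. \<forall>T>0. \<forall>t :: ('n, 'e) dtree. nonneg_tree t \<longrightarrow>
    tree_bad T t 0 \<le> C / T * tree_mean (map_dtree norm t)"
proof -
  obtain p K where p: "1 < p" and K: "0 \<le> K"
    and strong: "\<And>t :: ('n, 'e) dtree. nonneg_tree t \<Longrightarrow>
      tree_mean (map_dtree (\<lambda>v. norm v powr p) (tree_max t 0)) \<le>
      K * tree_mean (map_dtree (\<lambda>v. norm v powr p) t)"
    using tree_strong_type[OF assms] by blast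
  define L :: real where "L = 2 ^ CARD('n)"
  have L: "1 \<le> L" by (simp add: L_def)
  \<comment> \<open>\<open>K * L powr (p - 1)\<close> comes from the cut tree, 1 from the stopped
    cubes.\<close>
  define C where "C = K * L powr (p - 1) + 1"
  have C: "1 \<le> C" using K by (simp add: C_def)
  have "tree_bad T t 0 \<le> C / T * tree_mean (map_dtree norm t)"
    if T: "0 < T" and t: "nonneg_tree t" for T and t :: "('n, 'e) dtree"
  proof (cases "T < tree_mean (map_dtree norm t)")
    case True
    \<comment> \<open>Here the claimed bound exceeds 1; the opposite case provides the root
      hypothesis of \<open>tree_cut_leaves\<close>.\<close>
    have "tree_bad T t 0 \<le> 1" by (rule tree_bad_bounds)
    also have "1 \<le> tree_mean (map_dtree norm t) / T" using True T by simp
    also have "\<dots> \<le> C * (tree_mean (map_dtree norm t) / T)"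
      using mult_right_mono[OF C, of "tree_mean (map_dtree norm t) / T"] True T by simp
    finally show ?thesis by simp
  next
    case False
    define u where "u = tree_cut T t"
    define N where "N = tree_mean (map_dtree norm t)"
    have N0: "0 \<le> N" unfolding N_def by (rule tree_mean_norm_nonneg)
    have "T \<le> L * T" using mult_right_mono[OF L, of T] T by simp
    then have "N \<le> L * T" using False by (simp add: N_def)
    then have leaves: "norm b \<le> L * T" if "b \<in> set_dtree u" for b
      using tree_cut_leaves[OF T, of t b] that by (simp add: L_def u_def N_def)
    have "tree_mean (map_dtree (\<lambda>v. norm v powr p) u) \<le>
        tree_mean (map_dtree (\<lambda>v. (L * T) powr (p - 1) * norm v) u)"
    proof (rule tree_mean_map_mono)
      fix b assume b: "b \<in> set_dtree u"
      have "norm b powr p = norm b powr (p - 1) * norm b"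
        by (cases "b = 0") (use p in \<open>simp_all add: powr_diff\<close>)
      also have "\<dots> \<le> (L * T) powr (p - 1) * norm b"
        using p leaves[OF b] by (intro mult_right_mono powr_mono2) auto
      finally show "norm b powr p \<le> (L * T) powr (p - 1) * norm b" .
    qed
    also have "\<dots> = (L * T) powr (p - 1) * tree_mean (map_dtree norm u)"
      by (rule tree_mean_map_cmult)
    also have "\<dots> \<le> (L * T) powr (p - 1) * N"
      unfolding u_def N_def by (intro mult_left_mono tree_mean_norm_cut_le) auto
    finally have up: "tree_mean (map_dtree (\<lambda>v. norm v powr p) u) \<le> (L * T) powr (p - 1) * N" .
    have "tree_bad T u 0 \<le> tree_mean (map_dtree (\<lambda>v. T powr (-p) * norm v powr p) (tree_max u 0))"
      unfolding tree_bad_def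
    proof (rule tree_mean_map_mono)
      fix b :: 'e
      show "of_bool (T < norm b) \<le> T powr (-p) * norm b powr p"
      proof (cases "T < norm b")
        case True
        then have "T powr p \<le> norm b powr p" using T p by (intro powr_mono2) auto
        then show ?thesis using True T by (simp add: powr_minus field_simps)
      qed simp
    qed
    also have "\<dots> = T powr (-p) * tree_mean (map_dtree (\<lambda>v. norm v powr p) (tree_max u 0))"
      by (rule tree_mean_map_cmult)
    also have "\<dots> \<le> T powr (-p) * (K * ((L * T) powr (p - 1) * N))"
    proof (rule mult_left_mono)
      have "tree_mean (map_dtree (\<lambda>v. norm v powr p) (tree_max u 0)) \<le>
          K * tree_mean (map_dtree (\<lambda>v. norm v powr p) u)"
        unfolding u_def by (intro strong nonneg_tree_cut t)
      also have "\<dots> \<le> K * ((L * T) powr (p - 1) * N)" by (intro mult_left_mono up K)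
      finally show "tree_mean (map_dtree (\<lambda>v. norm v powr p) (tree_max u 0)) \<le>
          K * ((L * T) powr (p - 1) * N)" .
    qed simp
    also have "\<dots> = K * L powr (p - 1) * (T powr (-p) * T powr (p - 1)) * N"
      using L T by (simp add: powr_mult)
    also have "T powr (-p) * T powr (p - 1) = T powr (-p + (p - 1))"
      by (rule powr_add[symmetric])
    also have "\<dots> = 1 / T" using T by (simp add: powr_neg_one)
    finally have bu: "tree_bad T u 0 \<le> K * L powr (p - 1) * (1 / T) * N" .
    have "tree_bad T t 0 \<le> tree_bad T u 0 + tree_stopped T t" unfolding u_def by (rule tree_bad_cut)
    also have "\<dots> \<le> K * L powr (p - 1) * (1 / T) * N + N / T"
      unfolding N_def by (intro add_mono bu[unfolded N_def] tree_stopped_le T)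
    also have "\<dots> = C / T * N" using T by (simp add: C_def field_simps)
    finally show ?thesis unfolding N_def .
  qed
  then show ?thesis using C by (intro exI[of _ C]) auto
qed

section \<open>Transference to arbitrary measures\<close>

text \<open>Halving the distance to the nearer endpoint halves the infimum of the difference.\<close>

lemma midpoint_concave_above_chord:
  fixes \<phi> :: "real \<Rightarrow> real"
  assumes mid: "\<And>x y. x \<in> {0..1} \<Longrightarrow> y \<in> {0..1} \<Longrightarrow> (\<phi> x + \<phi> y) / 2 \<le> \<phi> ((x + y) / 2)"
    and bdd: "\<And>x. x \<in> {0..1} \<Longrightarrow> B \<le> \<phi> x"
    and u: "u \<in> {0..1}"
  shows "(1 - u) * \<phi> 0 + u * \<phi> 1 \<le> \<phi> u"
proof -
  define l where "l = (\<lambda>x. (1 - x) * \<phi> 0 + x * \<phi> 1)"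
  define g where "g = (\<lambda>x. \<phi> x - l x)"
  have g01: "g 0 = 0" "g 1 = 0" by (simp_all add: g_def l_def)
  have gmid: "(g x + g y) / 2 \<le> g ((x + y) / 2)" if "x \<in> {0..1}" "y \<in> {0..1}" for x y
  proof -
    define z where "z = (x + y) / 2"
    have "l z = (l x + l y) / 2" by (simp add: l_def z_def field_simps)
    then have "(g x + g y) / 2 = (\<phi> x + \<phi> y) / 2 - l z"
      by (simp add: g_def add_divide_distrib diff_divide_distrib)
    also have "\<dots> \<le> \<phi> z - l z" using mid[OF that] by (simp only: z_def diff_right_mono)
    finally show ?thesis by (simp only: g_def z_def)
  qed
  define m where "m = (INF x\<in>{0..1}. g x)"
  have "B - (\<bar>\<phi> 0\<bar> + \<bar>\<phi> 1\<bar>) \<le> g x" if "x \<in> {0..1}" for x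
  proof -
    have "\<bar>(1 - x) * \<phi> 0\<bar> \<le> 1 * \<bar>\<phi> 0\<bar>" unfolding abs_mult
      by (rule mult_right_mono) (use that in auto)
    moreover have "\<bar>x * \<phi> 1\<bar> \<le> 1 * \<bar>\<phi> 1\<bar>" unfolding abs_mult
      by (rule mult_right_mono) (use that in auto)
    ultimately show ?thesis using bdd[OF that] unfolding g_def l_def by linarith
  qed
  then have bb: "bdd_below (g ` {0..1})" by (intro bdd_belowI2)
  have m_le: "m \<le> g x" if "x \<in> {0..1}" for x
    unfolding m_def using bb that by (rule cINF_lower)
  have "m / 2 \<le> g x" if x: "x \<in> {0..1}" for x
  proof (cases "x \<le> 1 / 2")
    case True
    have "(g 0 + g (2 * x)) / 2 \<le> g ((0 + 2 * x) / 2)" using True x by (intro gmid) auto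
    moreover have "m \<le> g (2 * x)" using True x by (intro m_le) auto
    ultimately show ?thesis by (simp add: g01)
  next
    case False
    have "(g 1 + g (2 * x - 1)) / 2 \<le> g ((1 + (2 * x - 1)) / 2)" using False x by (intro gmid) auto
    moreover have "m \<le> g (2 * x - 1)" using False x by (intro m_le) auto
    ultimately show ?thesis by (simp add: g01)
  qed
  then have "m / 2 \<le> (INF x\<in>{0..1}. g x)" by (intro cINF_greatest) simp_all
  then have "m / 2 \<le> m" by (simp only: m_def)
  then have "0 \<le> g u" using m_le[OF u] by linarith
  then show ?thesis by (simp add: g_def l_def)
qed

lemma tree_bad_mono:
  assumes "nonneg_tree t" "0 \<le> s" "s \<le> s'"
  shows "tree_bad T t s \<le> tree_bad T t s'"
  using assms
proof (induction t arbitrary: s s')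
  case (Leaf b)
  have "0 \<le> sup s b" using Leaf.prems(2) by (rule order_trans) (rule sup_ge1)
  moreover have "sup s b \<le> sup s' b" using Leaf.prems(3) by (rule sup_mono) (rule order_refl)
  ultimately have "norm (sup s b) \<le> norm (sup s' b)" by (rule norm_mono_nonneg)
  then show ?case by (auto simp: tree_bad_Leaf)
next
  case (Node c)
  let ?a = "tree_mean (Node c)"
  have "0 \<le> sup s ?a" using Node.prems(2) by (rule order_trans) (rule sup_ge1)
  moreover have "sup s ?a \<le> sup s' ?a" using Node.prems(3) by (rule sup_mono) (rule order_refl)
  ultimately have "tree_bad T (c S) (sup s ?a) \<le> tree_bad T (c S) (sup s' ?a)" for S
    using Node.prems(1) by (intro Node.IH) auto
  then show ?case unfolding tree_bad_Node by (intro mult_left_mono sum_mono) auto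
qed

text \<open>\<open>tree_max\<close> takes the root mean into the supremum anyway, so having it there
  beforehand changes nothing.\<close>

lemma tree_bad_sup_mean: "tree_bad T t (sup s (tree_mean t)) = tree_bad T t s"
proof (cases t)
  case (Leaf b)
  have "sup (sup s b) b = sup s b" by (simp only: sup_assoc sup_idem)
  then show ?thesis by (simp only: Leaf tree_mean.simps tree_bad_Leaf)
next
  case (Node c)
  have "sup (sup s (tree_mean t)) (tree_mean t) = sup s (tree_mean t)" by (simp only: sup_assoc sup_idem)
  then show ?thesis by (simp only: Node tree_bad_Node)
qed

text \<open>Halving along one arbitrarily chosen coordinate: exactly half of the
  \<open>2 ^ CARD('i)\<close> children carry \<open>t\<close>, which simulates a binary splitting in
  any dimension.\<close>

definition split_tree :: "('i, 'e) dtree \<Rightarrow> ('i, 'e) dtree \<Rightarrow> ('i, 'e) dtree" where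
  "split_tree t t' = Node (\<lambda>S. if (SOME i. True) \<in> S then t else t')"

text \<open>Complementation exchanges the sets that contain \<open>i\<close> with those that do
  not.\<close>

lemma sum_split_sets:
  fixes a b :: "'v::real_vector" and i :: "'i::finite"
  shows "(1 / 2 ^ CARD('i)) *\<^sub>R (\<Sum>S\<in>UNIV. if i \<in> S then a else b) = (1 / 2) *\<^sub>R (a + b)"
proof -
  have "(\<Sum>S\<in>UNIV. if i \<in> S then a else b) = (\<Sum>S\<in>UNIV. if i \<in> - S then a else b)"
    by (rule sum.reindex_bij_witness[of _ uminus uminus]) auto
  then have "(\<Sum>S\<in>UNIV. if i \<in> S then a else b) + (\<Sum>S\<in>UNIV. if i \<in> S then a else b) =
      (\<Sum>S\<in>UNIV. (if i \<in> S then a else b) + (if i \<in> - S then a else b))"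
    by (simp only: sum.distrib)
  also have "\<dots> = (\<Sum>S\<in>(UNIV :: 'i set set). a + b)"
    by (intro sum.cong) (auto simp: add.commute)
  also have "\<dots> = (2 ^ CARD('i)) *\<^sub>R (a + b)"
    by (simp add: card_UNIV_set sum_constant_scaleR)
  finally have "2 *\<^sub>R (\<Sum>S\<in>UNIV. if i \<in> S then a else b) = (2 ^ CARD('i)) *\<^sub>R (a + b)"
    by (simp only: scaleR_2)
  then have "(1 / (2 * 2 ^ CARD('i))) *\<^sub>R (2 *\<^sub>R (\<Sum>S\<in>UNIV. if i \<in> S then a else b)) =
      (1 / (2 * 2 ^ CARD('i))) *\<^sub>R ((2 ^ CARD('i)) *\<^sub>R (a + b))"
    by (simp only:)
  then show ?thesis by simp
qed

text \<open>The last claim is an inequality because the new root inserts its own mean into the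
  running supremum, which can only enlarge the bad part.\<close>

lemma split_tree:
  fixes t t' :: "('i::finite, 'e::banach_lattice) dtree"
  shows "tree_mean (split_tree t t') = (1 / 2) *\<^sub>R (tree_mean t + tree_mean t')"
    and "tree_mean (map_dtree norm (split_tree t t')) =
      (tree_mean (map_dtree norm t) + tree_mean (map_dtree norm t')) / 2"
    and "nonneg_tree t \<Longrightarrow> nonneg_tree t' \<Longrightarrow> nonneg_tree (split_tree t t')"
    and "nonneg_tree t \<Longrightarrow> nonneg_tree t' \<Longrightarrow> 0 \<le> s \<Longrightarrow>
      (tree_bad T t s + tree_bad T t' s) / 2 \<le> tree_bad T (split_tree t t') s"
proof -
  let ?i = "SOME i :: 'i. True"
  show m: "tree_mean (split_tree t t') = (1 / 2) *\<^sub>R (tree_mean t + tree_mean t')"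
    using sum_split_sets[of ?i "tree_mean t" "tree_mean t'"]
    by (simp add: split_tree_def if_distrib[of tree_mean])
  show "tree_mean (map_dtree norm (split_tree t t')) =
      (tree_mean (map_dtree norm t) + tree_mean (map_dtree norm t')) / 2"
    using sum_split_sets[of ?i "tree_mean (map_dtree norm t)" "tree_mean (map_dtree norm t')"]
    by (simp add: split_tree_def comp_def if_distrib[of "map_dtree norm"] if_distrib[of tree_mean])
  show "nonneg_tree (split_tree t t')" if "nonneg_tree t" "nonneg_tree t'"
    using that by (simp add: split_tree_def)
  assume nn: "nonneg_tree t" "nonneg_tree t'" "0 \<le> s"
  let ?s = "sup s (tree_mean (split_tree t t'))"
  have le: "tree_bad T r s \<le> tree_bad T r ?s" if "nonneg_tree r" for r :: "('i, 'e) dtree"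
    using that nn(3) by (intro tree_bad_mono sup_ge1)
  have "(1 / 2 ^ CARD('i)) * (\<Sum>S\<in>UNIV. tree_bad T (if ?i \<in> S then t else t') ?s) =
      (tree_bad T t ?s + tree_bad T t' ?s) / 2"
    using sum_split_sets[of ?i "tree_bad T t ?s" "tree_bad T t' ?s"]
    by (simp add: if_distrib[of "\<lambda>r. tree_bad T r ?s"])
  then have "tree_bad T (split_tree t t') s = (tree_bad T t ?s + tree_bad T t' ?s) / 2"
    by (simp only: split_tree_def tree_bad_Node)
  then show "(tree_bad T t s + tree_bad T t' s) / 2 \<le> tree_bad T (split_tree t t') s"
    using le[OF nn(1)] le[OF nn(2)] by simp
qed

text \<open>The Bellman function of the weak-type inequality. It is concave in the mean \<open>a\<close>, which turns the
  inequality for dyadic splittings into one for splittings into parts of arbitrary proportions.\<close>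

definition bellman :: "'i::finite itself \<Rightarrow> real \<Rightarrow> real \<Rightarrow> 'e::banach_lattice \<Rightarrow> 'e \<Rightarrow> real" where
  "bellman _ T c a s = (SUP t\<in>{t :: ('i, 'e) dtree. nonneg_tree t \<and> tree_mean t = a}.
    tree_bad T t s - c * tree_mean (map_dtree norm t))"

lemma bellman_ge:
  assumes "0 \<le> c" "nonneg_tree (t :: ('i::finite, 'e::banach_lattice) dtree)" "tree_mean t = a"
  shows "tree_bad T t s - c * tree_mean (map_dtree norm t) \<le> bellman TYPE('i) T c a s"
  unfolding bellman_def
proof (rule cSUP_upper)
  have "tree_bad T r s - c * tree_mean (map_dtree norm r) \<le> 1" for r :: "('i, 'e) dtree"
    using tree_bad_bounds(2)[of T r s] mult_nonneg_nonneg[OF assms(1) tree_mean_norm_nonneg[of r]]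
    by linarith
  then show "bdd_above ((\<lambda>t. tree_bad T t s - c * tree_mean (map_dtree norm t)) `
      {t :: ('i, 'e) dtree. nonneg_tree t \<and> tree_mean t = a})"
    by (intro bdd_aboveI2)
qed (use assms in simp)

lemma bellman_le:
  fixes a :: "'e::banach_lattice"
  assumes "0 \<le> a"
    and "\<And>t :: ('i::finite, 'e) dtree. nonneg_tree t \<Longrightarrow> tree_mean t = a \<Longrightarrow>
      tree_bad T t s - c * tree_mean (map_dtree norm t) \<le> B"
  shows "bellman TYPE('i) T c a s \<le> B"
  unfolding bellman_def
proof (rule cSUP_least)
  have "Leaf a \<in> {t :: ('i, 'e) dtree. nonneg_tree t \<and> tree_mean t = a}" using assms(1) by simp
  then show "{t :: ('i, 'e) dtree. nonneg_tree t \<and> tree_mean t = a} \<noteq> {}" by blast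
qed (use assms(2) in blast)

text \<open>The one-leaf tree is a competitor for every mean. It provides the base of the induction
  over cubes as well as the lower bound that concavity requires.\<close>

lemma bellman_ge_leaf:
  assumes "0 \<le> c" "0 \<le> a" "0 \<le> s"
  shows "of_bool (T < norm s) - c * norm a \<le> bellman TYPE('i::finite) T c (a :: 'e::banach_lattice) s"
proof -
  have "norm s \<le> norm (sup s a)" using assms(3) by (rule norm_mono_nonneg) (rule sup_ge1)
  then show ?thesis
    using bellman_ge[of c "Leaf a :: ('i, 'e) dtree" a T s] assms(1,2)
    by (auto simp: tree_bad_Leaf of_bool_def split: if_splits)
qed

lemma bellman_sup: "bellman TYPE('i::finite) T c a (sup s a) = bellman TYPE('i) T c a s"
  unfolding bellman_def by (intro SUP_cong) (auto simp: tree_bad_sup_mean)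

text \<open>Competitors for \<open>a\<close> and \<open>b\<close>, joined under a common root,
  compete for the midpoint.\<close>

lemma bellman_midpoint:
  fixes a b :: "'e::banach_lattice"
  assumes c: "0 \<le> c" and ab: "0 \<le> a" "0 \<le> b" and s: "0 \<le> s"
  shows "(bellman TYPE('i::finite) T c a s + bellman TYPE('i) T c b s) / 2 \<le>
    bellman TYPE('i) T c ((1 / 2) *\<^sub>R (a + b)) s"
proof -
  let ?v = "\<lambda>t :: ('i, 'e) dtree. tree_bad T t s - c * tree_mean (map_dtree norm t)"
  let ?m = "bellman TYPE('i) T c ((1 / 2) *\<^sub>R (a + b)) s"
  have *: "?v t + ?v t' \<le> 2 * ?m" if t: "nonneg_tree t" "tree_mean t = a"
    and t': "nonneg_tree t'" "tree_mean t' = b" for t t'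
  proof -
    have "?v (split_tree t t') \<le> ?m"
      by (rule bellman_ge[OF c]) (simp_all only: split_tree t t')
    moreover have "(?v t + ?v t') / 2 \<le> ?v (split_tree t t')"
      using split_tree(4)[OF t(1) t'(1) s, of T] by (simp add: split_tree(2) field_simps)
    ultimately have "(?v t + ?v t') / 2 \<le> ?m" by (rule order_trans[rotated])
    then show ?thesis by (simp only: divide_le_eq_numeral1 mult.commute)
  qed
  \<comment> \<open>The two suprema are taken one after the other, each time with the other term
    moved to the right-hand side.\<close>
  have "bellman TYPE('i) T c a s \<le> 2 * ?m - bellman TYPE('i) T c b s"
  proof (rule bellman_le[OF ab(1)])
    fix t :: "('i, 'e) dtree" assume t: "nonneg_tree t" "tree_mean t = a"
    have "bellman TYPE('i) T c b s \<le> 2 * ?m - ?v t"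
    proof (rule bellman_le[OF ab(2)])
      fix t' :: "('i, 'e) dtree" assume "nonneg_tree t'" "tree_mean t' = b"
      from *[OF t this] show "?v t' \<le> 2 * ?m - ?v t" by linarith
    qed
    then show "?v t \<le> 2 * ?m - bellman TYPE('i) T c b s" by linarith
  qed
  moreover have "(x + y) / 2 \<le> z" if "x \<le> 2 * z - y" for x y z :: real
    using that by simp
  ultimately show ?thesis by blast
qed

text \<open>Along a segment the Bellman function is midpoint concave and, by
  \<open>bellman_ge_leaf\<close>, bounded below, which excludes the pathological midpoint concave
  functions.\<close>

lemma bellman_concave:
  fixes a b :: "'e::banach_lattice"
  assumes c: "0 \<le> c" and ab: "0 \<le> a" "0 \<le> b" and s: "0 \<le> s" and u: "u \<in> {0..1}"
  shows "(1 - u) * bellman TYPE('i::finite) T c a s + u * bellman TYPE('i) T c b s \<le>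
    bellman TYPE('i) T c ((1 - u) *\<^sub>R a + u *\<^sub>R b) s"
proof -
  define z where "z = (\<lambda>x. (1 - x) *\<^sub>R a + x *\<^sub>R b)"
  define \<phi> where "\<phi> = (\<lambda>x. bellman TYPE('i) T c (z x) s)"
  have z0: "0 \<le> z x" if "x \<in> {0..1}" for x
    unfolding z_def using that ab by (intro add_nonneg_nonneg scaleR_nonneg_nonneg) auto
  have "(1 - u) * \<phi> 0 + u * \<phi> 1 \<le> \<phi> u"
  proof (rule midpoint_concave_above_chord[OF _ _ u])
    fix x y :: real assume xy: "x \<in> {0..1}" "y \<in> {0..1}"
    have "z ((x + y) / 2) = (1 / 2) *\<^sub>R (z x + z y)"
    proof -
      have "1 - (x + y) / 2 = (1 / 2) * (1 - x) + (1 / 2) * (1 - y)" "(x + y) / 2 = (1 / 2) * x + (1 / 2) * y"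
        by (simp_all add: field_simps)
      then show ?thesis
        unfolding z_def by (simp only: scaleR_add_left scaleR_add_right scaleR_scaleR[symmetric]) simp
    qed
    then show "(\<phi> x + \<phi> y) / 2 \<le> \<phi> ((x + y) / 2)"
      unfolding \<phi>_def using bellman_midpoint[OF c z0[OF xy(1)] z0[OF xy(2)] s] by simp
  next
    fix x :: real assume x: "x \<in> {0..1}"
    have "norm (z x) \<le> norm ((1 - x) *\<^sub>R a) + norm (x *\<^sub>R b)" unfolding z_def by (rule norm_triangle_ineq)
    also have "\<dots> \<le> 1 * norm a + 1 * norm b"
      unfolding norm_scaleR using x by (intro add_mono mult_right_mono) auto
    finally have "c * norm (z x) \<le> c * (norm a + norm b)" using c by (intro mult_left_mono) auto
    moreover have "of_bool (T < norm s) - c * norm (z x) \<le> \<phi> x"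
      unfolding \<phi>_def by (rule bellman_ge_leaf[OF c z0[OF x] s])
    moreover have "(0::real) \<le> of_bool (T < norm s)" by simp
    ultimately show "- (c * (norm a + norm b)) \<le> \<phi> x" by linarith
  qed
  then show ?thesis by (simp add: \<phi>_def z_def)
qed

section \<open>Laminar families and finitely additive vector measures\<close>

definition laminar :: "'a set set \<Rightarrow> bool" where
  "laminar F \<longleftrightarrow> {} \<notin> F \<and> (\<forall>P\<in>F. \<forall>Q\<in>F. P \<subseteq> Q \<or> Q \<subseteq> P \<or> P \<inter> Q = {})"

lemma laminar_nested: "laminar F \<Longrightarrow> P \<in> F \<Longrightarrow> Q \<in> F \<Longrightarrow> P \<subseteq> Q \<or> Q \<subseteq> P \<or> P \<inter> Q = {}"
  by (simp only: laminar_def)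

lemma laminar_subset:
  assumes "laminar F" "G \<subseteq> F"
  shows "laminar G"
  unfolding laminar_def
proof (intro conjI ballI)
  show "{} \<notin> G" using assms unfolding laminar_def by (metis subsetD)
  show "P \<subseteq> Q \<or> Q \<subseteq> P \<or> P \<inter> Q = {}" if "P \<in> G" "Q \<in> G" for P Q
    using that assms(2) by (intro laminar_nested[OF assms(1)]) (simp_all only: subsetD)
qed

text \<open>A maximal member \<open>Q\<close> separates the other members into those strictly inside
  and those disjoint from it, two smaller families for inductions. Excluding the empty set keeps
  \<open>Q\<close> out of the second family.\<close>

lemma laminar_split:
  assumes "finite F" "laminar F" "F \<noteq> {}"
  obtains Q where "Q \<in> F" "F = insert Q ({P\<in>F. P \<subset> Q} \<union> {P\<in>F. P \<inter> Q = {}})"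
    "card {P\<in>F. P \<subset> Q} < card F" "card {P\<in>F. P \<inter> Q = {}} < card F"
proof -
  obtain Q where Q: "Q \<in> F" "\<And>P. P \<in> F \<Longrightarrow> Q \<subseteq> P \<Longrightarrow> Q = P"
    using finite_has_maximal[OF assms(1,3)] by blast
  have "P = Q \<or> P \<subset> Q \<or> P \<inter> Q = {}" if "P \<in> F" for P
    using laminar_nested[OF assms(2) that Q(1)] Q(2)[OF that] by (elim disjE) (simp_all add: psubset_eq)
  then have "F = insert Q ({P\<in>F. P \<subset> Q} \<union> {P\<in>F. P \<inter> Q = {}})"
    using Q(1) by (intro set_eqI) (simp, metis)
  moreover have "card {P\<in>F. P \<subset> Q} < card F"
    using Q(1) by (intro psubset_card_mono assms(1)) blast
  moreover have "card {P\<in>F. P \<inter> Q = {}} < card F"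
  proof (intro psubset_card_mono assms(1))
    have "Q \<noteq> {}" using Q(1) assms(2) unfolding laminar_def by metis
    then show "{P\<in>F. P \<inter> Q = {}} \<subset> F" using Q(1) by auto
  qed
  ultimately show thesis using that Q(1) by blast
qed

text \<open>In the application \<open>m\<close> is the measure, \<open>v\<close> the integral of the
  absolute value and \<open>N\<close> the integral of the norm. A ring of bounded sets keeps all
  values finite even if the total measure is infinite, and finitely many cubes call for finite
  additivity only.\<close>

locale dominated_vector_measure =
  fixes \<R> :: "'a set set" and m N :: "'a set \<Rightarrow> real" and v :: "'a set \<Rightarrow> 'e::banach_lattice"
  assumes empty: "{} \<in> \<R>"
    and Un: "A \<in> \<R> \<Longrightarrow> B \<in> \<R> \<Longrightarrow> A \<union> B \<in> \<R>"
    and Diff: "A \<in> \<R> \<Longrightarrow> B \<in> \<R> \<Longrightarrow> A - B \<in> \<R>"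
    and m_add: "A \<in> \<R> \<Longrightarrow> B \<in> \<R> \<Longrightarrow> A \<inter> B = {} \<Longrightarrow> m (A \<union> B) = m A + m B"
    and N_add: "A \<in> \<R> \<Longrightarrow> B \<in> \<R> \<Longrightarrow> A \<inter> B = {} \<Longrightarrow> N (A \<union> B) = N A + N B"
    and v_add: "A \<in> \<R> \<Longrightarrow> B \<in> \<R> \<Longrightarrow> A \<inter> B = {} \<Longrightarrow> v (A \<union> B) = v A + v B"
    and m_nonneg: "A \<in> \<R> \<Longrightarrow> 0 \<le> m A"
    and v_nonneg: "A \<in> \<R> \<Longrightarrow> 0 \<le> v A"
    and norm_v_le: "A \<in> \<R> \<Longrightarrow> norm (v A) \<le> N A"
    and v_null: "A \<in> \<R> \<Longrightarrow> m A = 0 \<Longrightarrow> v A = 0"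
begin

definition avg :: "'a set \<Rightarrow> 'e" where
  "avg A = (1 / m A) *\<^sub>R v A"

definition path_sup :: "'a set set \<Rightarrow> 'e \<Rightarrow> 'a \<Rightarrow> 'e" where
  "path_sup F s x = Sup_fin (insert s (avg ` {Q\<in>F. x \<in> Q}))"

definition level_set :: "real \<Rightarrow> 'a set set \<Rightarrow> 'e \<Rightarrow> 'a set \<Rightarrow> 'a set" where
  "level_set T F s A = {x\<in>A. T < norm (path_sup F s x)}"

lemma N_nonneg: "A \<in> \<R> \<Longrightarrow> 0 \<le> N A"
  by (rule order_trans[OF norm_ge_zero norm_v_le])

lemma m_empty: "m {} = 0"
  using m_add[OF empty empty] by simp

lemma avg_nonneg: "A \<in> \<R> \<Longrightarrow> 0 \<le> avg A"
  unfolding avg_def by (intro scaleR_nonneg_nonneg v_nonneg) (simp_all add: m_nonneg)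

lemma subset_split:
  assumes "A \<in> \<R>" "B \<in> \<R>" "B \<subseteq> A"
  shows "m A = m B + m (A - B)" "N A = N B + N (A - B)" "v A = v B + v (A - B)"
proof -
  have eq: "B \<union> (A - B) = A" using assms(3) by blast
  have dis: "B \<inter> (A - B) = {}" by blast
  note ab = assms(2) Diff[OF assms(1,2)] dis
  show "m A = m B + m (A - B)" "N A = N B + N (A - B)" "v A = v B + v (A - B)"
    using m_add[OF ab] N_add[OF ab] v_add[OF ab] by (simp_all only: eq)
qed

lemma m_mono: "A \<in> \<R> \<Longrightarrow> B \<in> \<R> \<Longrightarrow> B \<subseteq> A \<Longrightarrow> m B \<le> m A"
  using subset_split(1)[of A B] m_nonneg[OF Diff[of A B]] by simp

lemma N_mono: "A \<in> \<R> \<Longrightarrow> B \<in> \<R> \<Longrightarrow> B \<subseteq> A \<Longrightarrow> N B \<le> N A"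
  using subset_split(2)[of A B] N_nonneg[OF Diff[of A B]] by simp

text \<open>Concavity with weight \<open>m (A - B) / m A\<close>, multiplied by \<open>m A\<close>.
  A null part has zero \<open>v\<close>, so that \<open>A\<close> and the other part then have the
  same average.\<close>

lemma bellman_split:
  assumes A: "A \<in> \<R>" and B: "B \<in> \<R>" "B \<subseteq> A" and c: "0 \<le> c" and s: "0 \<le> s"
  shows "m B * bellman TYPE('i::finite) T c (avg B) s + m (A - B) * bellman TYPE('i) T c (avg (A - B)) s
    \<le> m A * bellman TYPE('i) T c (avg A) s"
proof -
  have D: "A - B \<in> \<R>" by (rule Diff[OF A B(1)])
  note split = subset_split[OF A B]
  consider "m B = 0" | "m (A - B) = 0" | "0 < m B" "0 < m (A - B)"
    using m_nonneg[OF B(1)] m_nonneg[OF D] by linarith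
  then show ?thesis
  proof cases
    case 1
    then have "avg A = avg (A - B)" by (simp add: avg_def split v_null[OF B(1)])
    then show ?thesis using 1 by (simp add: split)
  next
    case 2
    then have "avg A = avg B" by (simp add: avg_def split v_null[OF D])
    then show ?thesis using 2 by (simp add: split)
  next
    case 3
    have pos: "0 < m A" using 3 by (simp add: split)
    define u where "u = m (A - B) / m A"
    have u: "u \<in> {0..1}" using 3 pos by (simp add: u_def split)
    have u': "1 - u = m B / m A" using pos by (simp add: u_def split field_simps)
    have "(1 - u) *\<^sub>R avg B = (1 / m A) *\<^sub>R v B"
      unfolding u' avg_def using 3 by simp
    moreover have "u *\<^sub>R avg (A - B) = (1 / m A) *\<^sub>R v (A - B)"
      unfolding u_def avg_def using 3 by simp
    ultimately have "(1 - u) *\<^sub>R avg B + u *\<^sub>R avg (A - B) = avg A"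
      by (simp only: avg_def[of A] split(3) scaleR_add_right)
    then have "(1 - u) * bellman TYPE('i) T c (avg B) s + u * bellman TYPE('i) T c (avg (A - B)) s
        \<le> bellman TYPE('i) T c (avg A) s"
      using bellman_concave[OF c avg_nonneg[OF B(1)] avg_nonneg[OF D] s u, where 'i = 'i and T = T] by simp
    then have "m A * ((1 - u) * bellman TYPE('i) T c (avg B) s + u * bellman TYPE('i) T c (avg (A - B)) s)
        \<le> m A * bellman TYPE('i) T c (avg A) s"
      using pos by (intro mult_left_mono) auto
    moreover have "m A * ((1 - u) * x + u * y) = m B * x + m (A - B) * y" for x y
      unfolding u' using pos by (simp add: u_def distrib_left)
    ultimately show ?thesis by simp
  qed
qed

lemma path_sup_insert:
  assumes "finite F" "Q \<in> F" "x \<in> Q" "{P\<in>F. x \<in> P} = insert Q {P\<in>F'. x \<in> P}" "finite F'"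
  shows "path_sup F s x = path_sup F' (sup s (avg Q)) x"
proof -
  let ?A = "avg ` {P\<in>F'. x \<in> P}"
  have fin: "finite ?A" using assms(5) by simp
  have "path_sup F s x = Sup_fin (insert s (insert (avg Q) ?A))"
    unfolding path_sup_def by (simp only: assms(4) image_insert)
  also have "\<dots> = Sup_fin (insert (sup s (avg Q)) ?A)"
  proof (cases "?A = {}")
    case True
    show ?thesis unfolding True by (simp only: Sup_fin.insert[of "{avg Q}"] finite.intros
      insert_not_empty Sup_fin.singleton simp_thms)
  next
    case False
    have "Sup_fin (insert s (insert (avg Q) ?A)) = sup s (sup (avg Q) (Sup_fin ?A))"
      using fin False by (simp only: Sup_fin.insert finite_insert insert_not_empty simp_thms)
    also have "\<dots> = Sup_fin (insert (sup s (avg Q)) ?A)"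
      by (simp only: Sup_fin.insert[OF fin False] sup_assoc)
    finally show ?thesis .
  qed
  finally show ?thesis unfolding path_sup_def .
qed

text \<open>Induction on the family: a maximal member \<open>Q\<close> is treated with the enlarged
  supremum \<open>sup s (avg Q)\<close>, the rest \<open>A - Q\<close> with \<open>s\<close>, and
  \<open>bellman_split\<close> joins the two. Membership in \<open>\<R>\<close> is carried along
  because additivity of \<open>m\<close> is applied to the level sets.\<close>

lemma level_set_bellman:
  assumes "finite F" "F \<subseteq> \<R>" "laminar F" "\<And>Q. Q \<in> F \<Longrightarrow> Q \<subseteq> A" "A \<in> \<R>" "0 \<le> s" and c: "0 \<le> c"
  shows "level_set T F s A \<in> \<R> \<and>
    m (level_set T F s A) - c * N A \<le> m A * bellman TYPE('i::finite) T c (avg A) s"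
  using assms(1-6)
proof (induction "card F" arbitrary: F A s rule: less_induct)
  case less
  show ?case
  proof (cases "F = {}")
    case True
    have ps: "path_sup F s x = s" for x
    proof -
      have "{Q\<in>F. x \<in> Q} = {}" using True by simp
      then show ?thesis by (simp only: path_sup_def image_empty Sup_fin.singleton)
    qed
    have lev: "level_set T F s A = (if T < norm s then A else {})"
      unfolding level_set_def ps by simp
    have "m (level_set T F s A) = m A * of_bool (T < norm s)"
      unfolding lev by (simp add: m_empty)
    moreover have "m A * (of_bool (T < norm s) - c * norm (avg A)) \<le> m A * bellman TYPE('i) T c (avg A) s"
      by (intro mult_left_mono bellman_ge_leaf c avg_nonneg less.prems m_nonneg)
    moreover have "m A * (c * norm (avg A)) \<le> c * N A"
    proof -
      have "m A * norm (avg A) \<le> N A"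
        using norm_v_le[OF less.prems(5)] m_nonneg[OF less.prems(5)] N_nonneg[OF less.prems(5)]
        by (cases "m A = 0") (simp_all add: avg_def)
      then have "c * (m A * norm (avg A)) \<le> c * N A" using c by (rule mult_left_mono)
      then show ?thesis by (simp only: mult.left_commute)
    qed
    ultimately have "m (level_set T F s A) - c * N A \<le> m A * bellman TYPE('i) T c (avg A) s"
      unfolding right_diff_distrib by linarith
    moreover have "level_set T F s A \<in> \<R>" unfolding lev using empty less.prems(5) by simp
    ultimately show ?thesis by blast
  next
    case False
    obtain Q where Q: "Q \<in> F" and F: "F = insert Q ({P\<in>F. P \<subset> Q} \<union> {P\<in>F. P \<inter> Q = {}})"
      and card: "card {P\<in>F. P \<subset> Q} < card F" "card {P\<in>F. P \<inter> Q = {}} < card F"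
      by (rule laminar_split[OF less.prems(1,3) False])
    define F1 where "F1 = {P\<in>F. P \<subset> Q}"
    define F2 where "F2 = {P\<in>F. P \<inter> Q = {}}"
    define s' where "s' = sup s (avg Q)"
    have QA: "Q \<in> \<R>" "Q \<subseteq> A" using Q less.prems(2,4) by auto
    have AQ: "A - Q \<in> \<R>" by (rule Diff[OF less.prems(5) QA(1)])
    have fin: "finite F1" "finite F2" using less.prems(1) by (auto simp: F1_def F2_def)
    have s': "0 \<le> s'" unfolding s'_def using less.prems(6) by (rule order_trans) (rule sup_ge1)
    have 1: "level_set T F1 s' Q \<in> \<R> \<and>
        m (level_set T F1 s' Q) - c * N Q \<le> m Q * bellman TYPE('i) T c (avg Q) s'"
    proof (rule less.hyps)
      show "card F1 < card F" using card(1) by (simp add: F1_def)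
      show "laminar F1" by (rule laminar_subset[OF less.prems(3)]) (auto simp: F1_def)
      show "F1 \<subseteq> \<R>" using less.prems(2) by (auto simp: F1_def)
      show "P \<subseteq> Q" if "P \<in> F1" for P using that by (auto simp: F1_def)
    qed (rule fin QA(1) s')+
    have 2: "level_set T F2 s (A - Q) \<in> \<R> \<and>
        m (level_set T F2 s (A - Q)) - c * N (A - Q) \<le> m (A - Q) * bellman TYPE('i) T c (avg (A - Q)) s"
    proof (rule less.hyps)
      show "card F2 < card F" using card(2) by (simp add: F2_def)
      show "laminar F2" by (rule laminar_subset[OF less.prems(3)]) (auto simp: F2_def)
      show "P \<subseteq> A - Q" if "P \<in> F2" for P using that less.prems(4) by (auto simp: F2_def)
      show "F2 \<subseteq> \<R>" using less.prems(2) by (auto simp: F2_def)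
    qed (rule fin AQ less.prems(6))+
    have ps1: "path_sup F s x = path_sup F1 s' x" if "x \<in> Q" for x
      unfolding s'_def
    proof (rule path_sup_insert[OF less.prems(1) Q that _ fin(1)])
      show "{P\<in>F. x \<in> P} = insert Q {P\<in>F1. x \<in> P}"
        using F Q that unfolding F1_def by blast
    qed
    have ps2: "path_sup F s x = path_sup F2 s x" if "x \<notin> Q" for x
    proof -
      have "{P\<in>F. x \<in> P} = {P\<in>F2. x \<in> P}" using F that unfolding F2_def by blast
      then show ?thesis by (simp only: path_sup_def)
    qed
    have lev: "level_set T F s A = level_set T F1 s' Q \<union> level_set T F2 s (A - Q)"
    proof (rule set_eqI)
      fix x
      show "x \<in> level_set T F s A \<longleftrightarrow> x \<in> level_set T F1 s' Q \<union> level_set T F2 s (A - Q)"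
      proof (cases "x \<in> Q")
        case True
        then have "x \<in> A" using QA(2) by blast
        then show ?thesis using True by (simp add: level_set_def ps1[OF True])
      next
        case False
        then show ?thesis by (simp add: level_set_def ps2[OF False])
      qed
    qed
    have dis: "level_set T F1 s' Q \<inter> level_set T F2 s (A - Q) = {}"
      unfolding level_set_def by auto
    have "m (level_set T F s A) = m (level_set T F1 s' Q) + m (level_set T F2 s (A - Q))"
      unfolding lev using 1 2 dis by (intro m_add) auto
    moreover have "c * N A = c * N Q + c * N (A - Q)"
      by (simp only: subset_split(2)[OF less.prems(5) QA] distrib_left)
    moreover have "m (level_set T F1 s' Q) - c * N Q \<le> m Q * bellman TYPE('i) T c (avg Q) s"
      using conjunct2[OF 1] unfolding s'_def bellman_sup .
    moreover note conjunct2[OF 2]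
    moreover note bellman_split[OF less.prems(5) QA c less.prems(6), where 'i = 'i and T = T]
    ultimately have "m (level_set T F s A) - c * N A \<le> m A * bellman TYPE('i) T c (avg A) s"
      by linarith
    moreover have "level_set T F s A \<in> \<R>" unfolding lev using 1 2 by (intro Un) auto
    ultimately show ?thesis by blast
  qed
qed

text \<open>For \<open>c = C / T\<close> the tree inequality makes every competitor, hence the
  Bellman function at state 0, nonpositive; so the constant is inherited unchanged.\<close>

lemma weak_type:
  assumes "finite F" "F \<subseteq> \<R>" "laminar F" "\<And>Q. Q \<in> F \<Longrightarrow> Q \<subseteq> A" "A \<in> \<R>"
    and C: "0 \<le> C" and T: "0 < T"
    and weak: "\<forall>T>0. \<forall>t :: ('i::finite, 'e) dtree. nonneg_tree t \<longrightarrow>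
      tree_bad T t 0 \<le> C / T * tree_mean (map_dtree norm t)"
  shows "level_set T F 0 A \<in> \<R>" "m (level_set T F 0 A) \<le> C / T * N A"
proof -
  have c: "0 \<le> C / T" using C T by simp
  note lb = level_set_bellman[OF assms(1-5) order_refl c, where 'i = 'i and T = T]
  have "bellman TYPE('i) T (C / T) (avg A) 0 \<le> 0"
    by (rule bellman_le[OF avg_nonneg[OF assms(5)]]) (use weak[rule_format, OF T] in \<open>simp only: diff_le_0_iff_le\<close>)
  then have "m A * bellman TYPE('i) T (C / T) (avg A) 0 \<le> 0"
    using m_nonneg[OF assms(5)] by (simp add: mult_nonneg_nonpos)
  then show "level_set T F 0 A \<in> \<R>" "m (level_set T F 0 A) \<le> C / T * N A"
    using lb by auto
qed

end

section \<open>Sparse domination\<close>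

context dominated_vector_measure
begin

definition norm_avg :: "'a set \<Rightarrow> real" where
  "norm_avg A = N A / m A"

lemma norm_avg_nonneg: "A \<in> \<R> \<Longrightarrow> 0 \<le> norm_avg A"
  unfolding norm_avg_def by (intro divide_nonneg_nonneg N_nonneg m_nonneg)

lemma norm_avg_le: "A \<in> \<R> \<Longrightarrow> norm (avg A) \<le> norm_avg A"
  using norm_v_le[of A] m_nonneg[of A] by (simp add: avg_def norm_avg_def divide_right_mono)

text \<open>A vanishing \<open>norm_avg A\<close> covers two degenerate cases,
  \<open>N A = 0\<close> and, through division by zero, \<open>m A = 0\<close>.\<close>

lemma avg_eq_0:
  assumes "A \<in> \<R>" "B \<in> \<R>" "B \<subseteq> A" "norm_avg A = 0"
  shows "avg B = 0"
proof -
  have "m A = 0 \<or> N A = 0" using assms(4) by (auto simp: norm_avg_def)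
  then have "m B = 0 \<or> N B = 0"
    using m_mono[OF assms(1-3)] N_mono[OF assms(1-3)] m_nonneg[OF assms(2)] N_nonneg[OF assms(2)]
    by fastforce
  then have "m B = 0 \<or> v B = 0" using norm_v_le[OF assms(2)] by auto
  then show ?thesis by (auto simp: avg_def)
qed

lemma Un_family: "finite F \<Longrightarrow> F \<subseteq> \<R> \<Longrightarrow> \<Union>F \<in> \<R>"
  by (induction F rule: finite_induct) (auto simp: empty intro: Un)

text \<open>The maximal function inside \<open>Q\<close>, stopped at \<open>P\<close>: for fixed
  \<open>Q\<close> it belongs to the cube \<open>P\<close> rather than to a point, and it increases
  as \<open>P\<close> shrinks.\<close>

definition chain_sup :: "'a set set \<Rightarrow> 'a set \<Rightarrow> 'a set \<Rightarrow> 'e" where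
  "chain_sup F Q P = Sup_fin (insert 0 (avg ` {R\<in>F. P \<subseteq> R \<and> R \<subseteq> Q}))"

text \<open>At height \<open>L * norm_avg Q\<close> the weak bound is \<open>C / L * m Q\<close>, at
  most half of \<open>m Q\<close> as \<open>2 * C \<le> L\<close>. It applies because at every point
  of \<open>P\<close> the full path supremum dominates \<open>chain_sup F Q P\<close>.\<close>

lemma stopping_cubes:
  assumes F: "finite F" "F \<subseteq> \<R>" "laminar F" and Q: "Q \<in> F"
    and C: "0 < C" and L: "1 \<le> L" "2 * C \<le> L"
    and weak: "\<forall>T>0. \<forall>t :: ('i::finite, 'e) dtree. nonneg_tree t \<longrightarrow>
      tree_bad T t 0 \<le> C / T * tree_mean (map_dtree norm t)"
  shows "m (\<Union>{P\<in>F. P \<subset> Q \<and> L * norm_avg Q < norm (chain_sup F Q P)}) \<le> m Q / 2"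
proof -
  let ?T = "L * norm_avg Q"
  let ?S = "{P\<in>F. P \<subset> Q \<and> ?T < norm (chain_sup F Q P)}"
  have QR: "Q \<in> \<R>" using F Q by blast
  have SR: "\<Union>?S \<in> \<R>" using F by (intro Un_family) auto
  show ?thesis
  proof (cases "norm_avg Q = 0")
    case True
    have "chain_sup F Q P = 0" for P
    proof -
      have "avg ` {R\<in>F. P \<subseteq> R \<and> R \<subseteq> Q} \<subseteq> {0}"
        using avg_eq_0[OF QR _ _ True] F(2) by blast
      then have "insert 0 (avg ` {R\<in>F. P \<subseteq> R \<and> R \<subseteq> Q}) = {0}" by blast
      then show ?thesis by (simp only: chain_sup_def Sup_fin.singleton)
    qed
    then have S0: "?S = {}" by (simp add: True)
    show ?thesis unfolding S0 using m_nonneg[OF QR] by (simp add: m_empty)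
  next
    case False
    then have pos: "0 < norm_avg Q" using norm_avg_nonneg[OF QR] by simp
    then have T: "0 < ?T" using L by simp
    let ?F = "{P\<in>F. P \<subseteq> Q}"
    have fin: "finite ?F" using F by simp
    have QF: "?F \<subseteq> \<R>" "laminar ?F" "\<And>P. P \<in> ?F \<Longrightarrow> P \<subseteq> Q"
      using F laminar_subset[OF F(3), of ?F] by auto
    note wt = weak_type[OF fin QF QR less_imp_le[OF C] T weak]
    have "\<Union>?S \<subseteq> level_set ?T ?F 0 Q"
    proof
      fix x assume "x \<in> \<Union>?S"
      then obtain P where P: "P \<in> F" "P \<subset> Q" "?T < norm (chain_sup F Q P)" "x \<in> P" by blast
      have finP: "finite (avg ` {R\<in>F. P \<subseteq> R \<and> R \<subseteq> Q})" "finite (avg ` {R\<in>?F. x \<in> R})"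
        using F by auto
      have "0 \<le> chain_sup F Q P" unfolding chain_sup_def
        by (rule Sup_fin_insert_ge[OF finP(1)]) blast
      moreover have "chain_sup F Q P \<le> path_sup ?F 0 x"
        unfolding chain_sup_def path_sup_def
      proof (rule Sup_fin_insert_least[OF finP(1)])
        show "0 \<le> Sup_fin (insert 0 (avg ` {R\<in>?F. x \<in> R}))"
          by (rule Sup_fin_insert_ge[OF finP(2)]) blast
        fix a assume "a \<in> avg ` {R\<in>F. P \<subseteq> R \<and> R \<subseteq> Q}"
        then have "a \<in> insert 0 (avg ` {R\<in>?F. x \<in> R})" using P(4) by blast
        then show "a \<le> Sup_fin (insert 0 (avg ` {R\<in>?F. x \<in> R}))"
          by (rule Sup_fin_insert_ge[OF finP(2)])
      qed
      ultimately have "norm (chain_sup F Q P) \<le> norm (path_sup ?F 0 x)" by (rule norm_mono_nonneg)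
      then show "x \<in> level_set ?T ?F 0 Q" using P unfolding level_set_def by auto
    qed
    then have "m (\<Union>?S) \<le> m (level_set ?T ?F 0 Q)" by (intro m_mono wt(1) SR)
    also have "\<dots> \<le> C / ?T * N Q" by (rule wt(2))
    also have "\<dots> = C / L * m Q" using False by (simp add: norm_avg_def)
    also have "\<dots> \<le> 1 / 2 * m Q"
      using L C m_nonneg[OF QR] by (intro mult_right_mono) (auto simp: field_simps)
    finally show ?thesis by simp
  qed
qed

text \<open>The majorants \<open>l\<close> depend on the point: \<open>l Q\<close> is the supremum
  of averages along the cubes containing \<open>x\<close>, from \<open>Q\<close> down to the last
  cube before stopping. Domination is stated cube by cube, as the hypothesis of
  \<open>q_convex_sup_bound\<close> asks.\<close>

lemma sparse_domination:
  assumes "finite F" "F \<subseteq> \<R>" "laminar F"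
    and C: "0 < C" and L: "1 \<le> L" "2 * C \<le> L"
    and weak: "\<forall>T>0. \<forall>t :: ('i::finite, 'e) dtree. nonneg_tree t \<longrightarrow>
      tree_bad T t 0 \<le> C / T * tree_mean (map_dtree norm t)"
  shows "\<exists>S\<subseteq>F. \<exists>E. disjoint_family_on E S \<and>
    (\<forall>Q\<in>S. E Q \<in> \<R> \<and> E Q \<subseteq> Q \<and> m Q / 2 \<le> m (E Q)) \<and>
    (\<forall>x. \<exists>l. (\<forall>Q\<in>S. 0 \<le> l Q \<and> norm (l Q) \<le> L * norm_avg Q * indicator Q x) \<and>
      (\<forall>Q\<in>F. x \<in> Q \<longrightarrow> (\<exists>P\<in>S. avg Q \<le> l P)))"
  using assms(1-3)
proof (induction "card F" arbitrary: F rule: less_induct)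
  case less
  show ?case
  proof (cases "F = {}")
    case True
    then show ?thesis by (intro exI[of _ "{}"]) (simp add: disjoint_family_on_def)
  next
    case False
    obtain Q where Q: "Q \<in> F" and F: "F = insert Q ({P\<in>F. P \<subset> Q} \<union> {P\<in>F. P \<inter> Q = {}})"
      and card: "card {P\<in>F. P \<subset> Q} < card F" "card {P\<in>F. P \<inter> Q = {}} < card F"
      by (rule laminar_split[OF less.prems(1,3) False])
    let ?T = "L * norm_avg Q"
    \<comment> \<open>Not only the maximal stopping cubes but also all cubes of \<open>F\<close>
      below them, because \<open>chain_sup\<close> grows as the cube shrinks. The recursion selects
      the maximal ones itself, and the union is the same.\<close>
    define F3 where "F3 = {P\<in>F. P \<subset> Q \<and> ?T < norm (chain_sup F Q P)}"
    define F2 where "F2 = {P\<in>F. P \<inter> Q = {}}"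
    have QR: "Q \<in> \<R>" using Q less.prems(2) by blast
    have ne: "P \<noteq> {}" if "P \<in> F" for P using less.prems(3) that unfolding laminar_def by metis
    have "card F3 \<le> card {P\<in>F. P \<subset> Q}"
      by (rule card_mono) (use less.prems(1) in \<open>auto simp: F3_def\<close>)
    then have card3: "card F3 < card F" using card(1) by linarith
    have sub3: "F3 \<subseteq> F" and sub2: "F2 \<subseteq> F" by (auto simp: F3_def F2_def)
    from less.hyps[OF card3 finite_subset[OF sub3 less.prems(1)] subset_trans[OF sub3 less.prems(2)]
        laminar_subset[OF less.prems(3) sub3]]
    obtain S3 E3 where S3: "S3 \<subseteq> F3" "disjoint_family_on E3 S3"
      "\<And>P. P \<in> S3 \<Longrightarrow> E3 P \<in> \<R> \<and> E3 P \<subseteq> P \<and> m P / 2 \<le> m (E3 P)"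
      and l3: "\<forall>x. \<exists>l. (\<forall>P\<in>S3. 0 \<le> l P \<and> norm (l P) \<le> L * norm_avg P * indicator P x) \<and>
      (\<forall>P\<in>F3. x \<in> P \<longrightarrow> (\<exists>R\<in>S3. avg P \<le> l R))" by (elim exE conjE) simp
    have card2: "card F2 < card F" using card(2) by (simp only: F2_def)
    from less.hyps[OF card2 finite_subset[OF sub2 less.prems(1)] subset_trans[OF sub2 less.prems(2)]
        laminar_subset[OF less.prems(3) sub2]]
    obtain S2 E2 where S2: "S2 \<subseteq> F2" "disjoint_family_on E2 S2"
      "\<And>P. P \<in> S2 \<Longrightarrow> E2 P \<in> \<R> \<and> E2 P \<subseteq> P \<and> m P / 2 \<le> m (E2 P)"
      and l2: "\<forall>x. \<exists>l. (\<forall>P\<in>S2. 0 \<le> l P \<and> norm (l P) \<le> L * norm_avg P * indicator P x) \<and>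
      (\<forall>P\<in>F2. x \<in> P \<longrightarrow> (\<exists>R\<in>S2. avg P \<le> l R))" by (elim exE conjE) simp
    define S where "S = insert Q (S3 \<union> S2)"
    \<comment> \<open>\<open>Q\<close> keeps what stopping leaves over; the recursive sets lie
      inside \<open>\<Union>F3\<close> or outside \<open>Q\<close>, so disjointness is
      automatic.\<close>
    define E where "E = (\<lambda>P. if P = Q then Q - \<Union>F3 else if P \<in> S3 then E3 P else E2 P)"
    have Q3: "Q \<notin> S3" using S3(1) by (auto simp: F3_def)
    have Q2: "Q \<notin> S2" using S2(1) ne[OF Q] by (auto simp: F2_def)
    have S23: "P \<notin> S3" if "P \<in> S2" for P
    proof
      assume "P \<in> S3"
      then have "P \<in> F" "P \<subset> Q" "P \<inter> Q = {}" using that S2(1) S3(1) by (auto simp: F3_def F2_def)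
      then show False using ne by blast
    qed
    have EQ: "E Q = Q - \<Union>F3" by (simp add: E_def)
    have ES3: "E P = E3 P" if "P \<in> S3" for P using that Q3 by (auto simp: E_def)
    have ES2: "E P = E2 P" if "P \<in> S2" for P using that Q2 S23 by (auto simp: E_def)
    have UR: "\<Union>F3 \<in> \<R>" by (rule Un_family) (use less.prems in \<open>auto simp: F3_def\<close>)
    have UQ: "\<Union>F3 \<subseteq> Q" by (auto simp: F3_def)
    have E3sub: "E P \<subseteq> \<Union>F3" if "P \<in> S3" for P
      using S3(3)[OF that] ES3[OF that] S3(1) that by auto
    have E2sub: "E P \<inter> Q = {}" if "P \<in> S2" for P
    proof -
      have "P \<inter> Q = {}" using S2(1) that by (auto simp: F2_def)
      then show ?thesis using S2(3)[OF that] ES2[OF that] by auto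
    qed
    have dis: "E P \<inter> E R = {}" if PR: "P \<in> S" "R \<in> S" "P \<noteq> R" for P R
    proof -
      have 33: "E P \<inter> E R = {}" if "P \<in> S3" "R \<in> S3" "P \<noteq> R" for P R
        using S3(2) that by (simp add: disjoint_family_on_def ES3)
      have 22: "E P \<inter> E R = {}" if "P \<in> S2" "R \<in> S2" "P \<noteq> R" for P R
        using S2(2) that by (simp add: disjoint_family_on_def ES2)
      have 32: "E P \<inter> E R = {}" if "P \<in> S3" "R \<in> S2" for P R
        using E3sub[OF that(1)] E2sub[OF that(2)] UQ by blast
      have Q3': "E Q \<inter> E P = {}" if "P \<in> S3" for P using E3sub[OF that] EQ by blast
      have Q2': "E Q \<inter> E P = {}" if "P \<in> S2" for P using E2sub[OF that] EQ by blast
      consider "P = Q" | "P \<in> S3" | "P \<in> S2" using PR(1) S_def by blast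
      then show ?thesis
        using PR(2,3) 33 22 32 Q3' Q2' unfolding S_def by cases (metis Int_commute UnE insertE)+
    qed
    have Eprop: "E P \<in> \<R> \<and> E P \<subseteq> P \<and> m P / 2 \<le> m (E P)" if P: "P \<in> S" for P
    proof -
      have "m (\<Union>F3) \<le> m Q / 2"
        unfolding F3_def by (rule stopping_cubes[OF less.prems Q C L weak])
      then have "m Q / 2 \<le> m (Q - \<Union>F3)" using subset_split(1)[OF QR UR UQ] by linarith
      then have main: "E Q \<in> \<R> \<and> E Q \<subseteq> Q \<and> m Q / 2 \<le> m (E Q)"
        unfolding EQ using Diff[OF QR UR] by blast
      consider "P = Q" | "P \<in> S3" | "P \<in> S2" using P S_def by blast
      then show ?thesis
      proof cases
        case 1
        then show ?thesis using main by simp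
      next
        case 2
        then show ?thesis using S3(3) ES3 by simp
      next
        case 3
        then show ?thesis using S2(3) ES2 by simp
      qed
    qed
    have bound: "\<exists>l. (\<forall>P\<in>S. 0 \<le> l P \<and> norm (l P) \<le> L * norm_avg P * indicator P x) \<and>
        (\<forall>P\<in>F. x \<in> P \<longrightarrow> (\<exists>R\<in>S. avg P \<le> l R))" for x
    proof -
      obtain k3 where k3: "\<And>P. P \<in> S3 \<Longrightarrow> 0 \<le> k3 P \<and> norm (k3 P) \<le> L * norm_avg P * indicator P x"
        "\<And>P. P \<in> F3 \<Longrightarrow> x \<in> P \<Longrightarrow> \<exists>R\<in>S3. avg P \<le> k3 R" using l3 by metis
      obtain k2 where k2: "\<And>P. P \<in> S2 \<Longrightarrow> 0 \<le> k2 P \<and> norm (k2 P) \<le> L * norm_avg P * indicator P x"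
        "\<And>P. P \<in> F2 \<Longrightarrow> x \<in> P \<Longrightarrow> \<exists>R\<in>S2. avg P \<le> k2 R" using l2 by metis
      have "\<exists>w. 0 \<le> w \<and> norm w \<le> ?T * indicator Q x \<and>
          (\<forall>P\<in>F. x \<in> P \<longrightarrow> P \<subseteq> Q \<longrightarrow> P \<notin> F3 \<longrightarrow> avg P \<le> w)"
      proof (cases "x \<in> Q")
        case True
        \<comment> \<open>The unstopped cubes inside \<open>Q\<close> that contain \<open>x\<close>
          form a chain. The stopped supremum at its smallest member \<open>P\<close> dominates all
          their averages, and it is small because \<open>P\<close> itself is not stopped.\<close>
        let ?H = "{P\<in>F. x \<in> P \<and> P \<subseteq> Q \<and> P \<notin> F3}"
        have "Q \<in> ?H" using Q True by (auto simp: F3_def)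
        then have "?H \<noteq> {}" "finite ?H" using less.prems(1) by auto
        then obtain P where P: "P \<in> ?H" "\<And>R. R \<in> ?H \<Longrightarrow> R \<subseteq> P \<Longrightarrow> P = R"
          using finite_has_minimal by (metis (no_types, lifting))
        have min: "P \<subseteq> R" if "R \<in> ?H" for R
        proof -
          have "R \<inter> P \<noteq> {}" using P(1) that by blast
          then show ?thesis using laminar_nested[OF less.prems(3), of R P] P that by blast
        qed
        have fin: "finite (avg ` {R\<in>F. P \<subseteq> R \<and> R \<subseteq> Q})" using less.prems(1) by simp
        have ge: "avg R \<le> chain_sup F Q P" if "R \<in> ?H" for R
          unfolding chain_sup_def by (rule Sup_fin_insert_ge[OF fin]) (use that min in blast)
        have nn: "0 \<le> chain_sup F Q P"
          unfolding chain_sup_def by (rule Sup_fin_insert_ge[OF fin]) blast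
        have "norm (chain_sup F Q P) \<le> ?T"
        proof (cases "P = Q")
          \<comment> \<open>Stopping tests strict subsets of \<open>Q\<close> only, so
            \<open>Q\<close> itself is estimated directly, using \<open>1 \<le> L\<close>.\<close>
          case True
          have "{R\<in>F. P \<subseteq> R \<and> R \<subseteq> Q} = {Q}" using Q True by auto
          then have "chain_sup F Q P = sup 0 (avg Q)"
            unfolding chain_sup_def by simp
          also have "\<dots> = avg Q" by (rule sup_absorb2[OF avg_nonneg[OF QR]])
          finally have "norm (chain_sup F Q P) \<le> norm_avg Q" using norm_avg_le[OF QR] by simp
          also have "\<dots> \<le> ?T" using mult_right_mono[OF L(1) norm_avg_nonneg[OF QR]] by simp
          finally show ?thesis .
        next
          case False
          then have "P \<subset> Q" "P \<in> F" "P \<notin> F3" using P(1) by auto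
          then show ?thesis unfolding F3_def by (simp add: not_less)
        qed
        then show ?thesis using nn ge True by (intro exI[of _ "chain_sup F Q P"]) simp
      next
        case False
        then show ?thesis by (intro exI[of _ 0]) auto
      qed
      then obtain w where w: "0 \<le> w" "norm w \<le> ?T * indicator Q x"
        "\<And>P. P \<in> F \<Longrightarrow> x \<in> P \<Longrightarrow> P \<subseteq> Q \<Longrightarrow> P \<notin> F3 \<Longrightarrow> avg P \<le> w" by blast
      define l where "l = (\<lambda>P. if P = Q then w else if P \<in> S3 then k3 P else k2 P)"
      have lQ: "l Q = w" by (simp add: l_def)
      have lS3: "l P = k3 P" if "P \<in> S3" for P using that Q3 by (auto simp: l_def)
      have lS2: "l P = k2 P" if "P \<in> S2" for P using that Q2 S23 by (auto simp: l_def)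
      show ?thesis
      proof (intro exI[of _ l] conjI[of "\<forall>P\<in>S. _ P"] ballI impI)
        fix P assume "P \<in> S"
        then consider "P = Q" | "P \<in> S3" | "P \<in> S2" using S_def by blast
        then show "0 \<le> l P \<and> norm (l P) \<le> L * norm_avg P * indicator P x"
          by cases (simp_all only: lQ lS3 lS2 w k3(1) k2(1) simp_thms)
      next
        fix P assume P: "P \<in> F" "x \<in> P"
        consider "P \<in> F3" | "P \<in> F2" | "P \<subseteq> Q" "P \<notin> F3"
          using F P(1) unfolding F2_def by blast
        then show "\<exists>R\<in>S. avg P \<le> l R"
        proof cases
          case 1
          then obtain R where "R \<in> S3" "avg P \<le> k3 R" using k3(2) P(2) by blast
          then show ?thesis by (intro bexI[of _ R]) (simp_all only: lS3 S_def Un_iff insert_iff simp_thms)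
        next
          case 2
          then obtain R where "R \<in> S2" "avg P \<le> k2 R" using k2(2) P(2) by blast
          then show ?thesis by (intro bexI[of _ R]) (simp_all only: lS2 S_def Un_iff insert_iff simp_thms)
        next
          case 3
          then have "avg P \<le> l Q" using w(3) P lQ by simp
          then show ?thesis by (intro bexI[of _ Q]) (simp_all add: S_def)
        qed
      qed
    qed
    show ?thesis
    proof (intro exI[of _ S] exI[of _ E] conjI ballI allI)
      show "S \<subseteq> F" using Q S3(1) S2(1) sub2 sub3 by (auto simp: S_def)
      show "disjoint_family_on E S" using dis by (simp add: disjoint_family_on_def)
    qed (use Eprop bound in blast)+
  qed
qed

end

section \<open>Integrals over bounded Borel sets and the final estimate\<close>

lemma locally_finite_borel_compact:
  assumes "locally_finite_borel \<mu>" "compact K"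
  shows "emeasure \<mu> K < \<infinity>"
proof -
  have sets: "sets \<mu> = sets borel" using assms(1) by (simp add: locally_finite_borel_def)
  have "\<forall>x. \<exists>U. open U \<and> x \<in> U \<and> emeasure \<mu> U < \<infinity>"
    using assms(1) by (simp add: locally_finite_borel_def)
  then obtain U where U: "\<And>x. open (U x)" "\<And>x. x \<in> U x" "\<And>x. emeasure \<mu> (U x) < \<infinity>" by metis
  obtain C where C: "C \<subseteq> K" "finite C" "K \<subseteq> (\<Union>x\<in>C. U x)"
    by (rule compactE_image[OF assms(2), of K U]) (use U in auto)
  have "emeasure \<mu> K \<le> emeasure \<mu> (\<Union>x\<in>C. U x)"
    using C(3) U(1) by (intro emeasure_mono) (auto simp: sets intro!: borel_open)
  also have "\<dots> \<le> (\<Sum>x\<in>C. emeasure \<mu> (U x))"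
    using C(2) U(1) by (intro emeasure_subadditive_finite) (auto simp: sets intro!: borel_open)
  also have "\<dots> < \<infinity>" using C(2) U(3) by (simp add: sum_Pinfty less_top)
  finally show ?thesis .
qed

definition bounded_borel :: "('a::topological_space) measure \<Rightarrow> 'a set set" where
  "bounded_borel \<mu> = {A \<in> sets \<mu>. \<exists>K. compact K \<and> A \<subseteq> K}"

text \<open>The absolute value around the norm matches the one in \<open>sparse_operator\<close>, so
  that \<open>norm_avg\<close> becomes literally the average used there.\<close>

lemma dominated_vector_measure_bochner:
  fixes f :: "'a::t2_space \<Rightarrow> 'e::banach_lattice"
  assumes \<mu>: "locally_finite_borel \<mu>" and f: "locally_integrable \<mu> f"
  shows "dominated_vector_measure (bounded_borel \<mu>) (measure \<mu>)
    (\<lambda>A. bochner_int \<mu> (\<lambda>x. indicator A x *\<^sub>R \<bar>norm (f x)\<bar>))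
    (\<lambda>A. bochner_int \<mu> (\<lambda>x. indicator A x *\<^sub>R \<bar>f x\<bar>))"
proof -
  have sets: "sets \<mu> = sets borel" using \<mu> by (simp add: locally_finite_borel_def)
  have fin: "emeasure \<mu> A < \<infinity>" if A: "A \<in> bounded_borel \<mu>" for A
  proof -
    obtain K where K: "compact K" "A \<subseteq> K" using A by (auto simp: bounded_borel_def)
    have "emeasure \<mu> A \<le> emeasure \<mu> K"
      using K by (intro emeasure_mono) (auto simp: sets intro: borel_compact)
    then show ?thesis using locally_finite_borel_compact[OF \<mu> K(1)] by (rule order_le_less_trans)
  qed
  have ind_abs: "\<bar>indicat_real A x *\<^sub>R f x\<bar> = indicat_real A x *\<^sub>R \<bar>f x\<bar>" for A x
    by (simp add: indicator_def)
  have ind_norm: "norm (indicat_real A x *\<^sub>R \<bar>f x\<bar>) = indicat_real A x *\<^sub>R \<bar>norm (f x)\<bar>" for A x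
    by (simp add: indicator_def)
  let ?v = "\<lambda>A. bochner_int \<mu> (\<lambda>x. indicator A x *\<^sub>R \<bar>f x\<bar>)"
  let ?N = "\<lambda>A. bochner_int \<mu> (\<lambda>x. indicator A x *\<^sub>R \<bar>norm (f x)\<bar>)"
  have int: "has_bochner_int \<mu> (\<lambda>x. indicator A x *\<^sub>R \<bar>f x\<bar>) (?v A) \<and> 0 \<le> ?v A \<and>
      has_bochner_int \<mu> (\<lambda>x. indicator A x *\<^sub>R \<bar>norm (f x)\<bar>) (?N A) \<and> norm (?v A) \<le> ?N A"
    if A: "A \<in> bounded_borel \<mu>" for A
  proof -
    obtain K where K: "A \<in> sets \<mu>" "compact K" "A \<subseteq> K" using A by (auto simp: bounded_borel_def)
    from locally_integrable_indicator[OF f K] obtain u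
      where "has_bochner_int \<mu> (\<lambda>x. indicator A x *\<^sub>R f x) u" by (auto simp: bochner_integrable_def)
    from bochner_integrable_abs[OF this] obtain w
      where w: "has_bochner_int \<mu> (\<lambda>x. indicator A x *\<^sub>R \<bar>f x\<bar>) w" "0 \<le> w"
      by (auto simp only: ind_abs)
    from bochner_integrable_norm[OF w(1)] obtain r
      where r: "has_bochner_int \<mu> (\<lambda>x. indicator A x *\<^sub>R \<bar>norm (f x)\<bar>) r" "norm w \<le> r"
      by (auto simp only: ind_norm)
    show ?thesis using w r by (simp only: bochner_int_eq[OF w(1)] bochner_int_eq[OF r(1)] simp_thms)
  qed
  have ind_Un: "(\<lambda>x. indicat_real (A \<union> B) x *\<^sub>R g x) =
      (\<lambda>x. indicat_real A x *\<^sub>R g x + indicat_real B x *\<^sub>R g x)"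
    if "A \<inter> B = {}" for A B and g :: "'a \<Rightarrow> 'z::real_vector"
    using that by (auto simp: indicator_def fun_eq_iff)
  show ?thesis
  proof
    show "{} \<in> bounded_borel \<mu>" by (auto simp: bounded_borel_def)
  next
    fix A B assume AB: "A \<in> bounded_borel \<mu>" "B \<in> bounded_borel \<mu>"
    obtain K K' where K: "A \<in> sets \<mu>" "B \<in> sets \<mu>" "compact K" "A \<subseteq> K" "compact K'" "B \<subseteq> K'"
      using AB unfolding bounded_borel_def by blast
    show "A \<union> B \<in> bounded_borel \<mu>"
      using K compact_Un[OF K(3,5)] unfolding bounded_borel_def by blast
    show "A - B \<in> bounded_borel \<mu>"
      using K unfolding bounded_borel_def by blast
    assume dis: "A \<inter> B = {}"
    show "measure \<mu> (A \<union> B) = measure \<mu> A + measure \<mu> B"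
      using K fin[OF AB(1)] fin[OF AB(2)] dis by (intro measure_Union) auto
    show "?N (A \<union> B) = ?N A + ?N B" "?v (A \<union> B) = ?v A + ?v B"
      using int[OF AB(1)] int[OF AB(2)]
      by (auto simp only: ind_Un[OF dis] intro!: bochner_int_eq has_bochner_int_add)
  next
    fix A assume A: "A \<in> bounded_borel \<mu>"
    show "0 \<le> measure \<mu> A" by simp
    show "0 \<le> ?v A" "norm (?v A) \<le> ?N A" using int[OF A] by blast+
    assume "measure \<mu> A = 0"
    then have "A \<in> null_sets \<mu>"
      using fin[OF A] A by (auto simp: null_sets_def bounded_borel_def measure_def enn2real_eq_0_iff)
    then have "AE x in \<mu>. x \<notin> A" by (rule AE_not_in)
    then have "AE x in \<mu>. indicat_real A x *\<^sub>R \<bar>f x\<bar> = 0"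
      by eventually_elim simp
    then show "?v A = 0" using int[OF A] by (blast intro: has_bochner_int_AE_zero)
  qed
qed

lemma dyadic_cube_nonempty:
  assumes "Q \<in> dyadic_cubes"
  shows "Q \<noteq> {}"
proof -
  obtain k m where Q: "Q = dyadic_cube k m" using assms by (auto simp: dyadic_cubes_def)
  have "(\<chi> i. of_int (m $ i) / 2 powi k) \<in> Q" by (simp add: Q mem_dyadic_cube)
  then show ?thesis by blast
qed

lemma laminar_dyadic_cubes: "D \<subseteq> dyadic_cubes \<Longrightarrow> laminar D"
  unfolding laminar_def
proof (intro conjI ballI)
  assume D: "D \<subseteq> dyadic_cubes"
  show "{} \<notin> D" using D dyadic_cube_nonempty by blast
  fix P Q assume "P \<in> D" "Q \<in> D"
  then have "P \<in> dyadic_cubes" "Q \<in> dyadic_cubes" using D by auto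
  then show "P \<subseteq> Q \<or> Q \<subseteq> P \<or> P \<inter> Q = {}" by (rule dyadic_cubes_laminar)
qed

theorem theorem1p3:
  fixes q :: real
  assumes "hardy_littlewood_property TYPE('n::finite) TYPE('e::banach_lattice)"
    and "1 < q"
    and "q_convex TYPE('e) q"
  shows "\<exists>C. \<forall>\<mu> :: (real ^ 'n) measure. locally_finite_borel \<mu> \<longrightarrow>
    (\<forall>\<D> \<subseteq> dyadic_cubes. finite \<D> \<longrightarrow>
      (\<forall>f :: real ^ 'n \<Rightarrow> 'e. locally_integrable \<mu> f \<longrightarrow>
        (\<exists>\<S> \<subseteq> \<D>. sparse_collection \<mu> \<S> \<and>
          (AE x in \<mu>. norm (lattice_maximal \<mu> \<D> f x)
            \<le> C * sparse_operator \<mu> q \<S> (\<lambda>y. norm (f y)) x))))"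
proof -
  from tree_weak_type[OF assms(1)] obtain C where C: "0 < C"
    and weak: "\<forall>T>0. \<forall>t :: ('n, 'e) dtree. nonneg_tree t \<longrightarrow>
      tree_bad T t 0 \<le> C / T * tree_mean (map_dtree norm t)"
    by (elim exE conjE)
  have q: "0 < q" using assms(2) by simp
  from q_convex_sup_bound[OF assms(3) q, where 'i = "(real ^ 'n) set"] obtain B where B: "0 \<le> B"
    and bound: "\<forall>I :: (real ^ 'n) set set. \<forall>l :: (real ^ 'n) set \<Rightarrow> 'e. \<forall>u. finite I \<longrightarrow> 0 \<le> u \<longrightarrow>
      (\<forall>w. 0 \<le> w \<longrightarrow> (\<forall>i\<in>I. l i \<le> w) \<longrightarrow> u \<le> w) \<longrightarrow>
      norm u \<le> B * (\<Sum>i\<in>I. norm (l i) powr q) powr (1 / q)"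
    by (elim exE conjE)
  have sup_bound: "norm u \<le> B * (\<Sum>i\<in>I. norm (l i) powr q) powr (1 / q)"
    if "finite I" "0 \<le> u" "\<forall>w. 0 \<le> w \<longrightarrow> (\<forall>i\<in>I. l i \<le> w) \<longrightarrow> u \<le> w"
    for I :: "(real ^ 'n) set set" and l :: "(real ^ 'n) set \<Rightarrow> 'e" and u
    by (rule bound[THEN spec, THEN spec, THEN spec, THEN mp, THEN mp, THEN mp, OF that])
  \<comment> \<open>The smallest factor meeting both demands of the stopping argument; like
    \<open>B\<close>, it is fixed before the measure, the collection and the function.\<close>
  define L where "L = max 1 (2 * C)"
  have L: "1 \<le> L" "2 * C \<le> L" by (simp_all add: L_def)
  show ?thesis
  proof (intro exI[of _ "B * L"] allI impI)
    fix \<mu> :: "(real ^ 'n) measure" and \<D> :: "(real ^ 'n) set set" and f :: "real ^ 'n \<Rightarrow> 'e"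
    assume \<mu>: "locally_finite_borel \<mu>" and D: "\<D> \<subseteq> dyadic_cubes" "finite \<D>"
      and f: "locally_integrable \<mu> f"
    have sets: "sets \<mu> = sets borel" using \<mu> by (simp add: locally_finite_borel_def)
    interpret dominated_vector_measure "bounded_borel \<mu>" "measure \<mu>"
        "\<lambda>A. bochner_int \<mu> (\<lambda>x. indicator A x *\<^sub>R \<bar>norm (f x)\<bar>)"
        "\<lambda>A. bochner_int \<mu> (\<lambda>x. indicator A x *\<^sub>R \<bar>f x\<bar>)"
      by (rule dominated_vector_measure_bochner[OF \<mu> f])
    have avg: "avg Q = average \<mu> Q (\<lambda>y. \<bar>f y\<bar>)" for Q by (simp only: avg_def average_def)
    have navg: "norm_avg Q = average \<mu> Q (\<lambda>y. \<bar>norm (f y)\<bar>)" for Q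
      unfolding norm_avg_def average_def by simp
    have R: "\<D> \<subseteq> bounded_borel \<mu>"
    proof
      fix Q assume "Q \<in> \<D>"
      then have "Q \<in> dyadic_cubes" using D(1) by (rule subsetD[rotated])
      then obtain k m where Q: "Q = dyadic_cube k m" by (auto simp: dyadic_cubes_def)
      show "Q \<in> bounded_borel \<mu>"
        using dyadic_cube_borel[of k m] dyadic_cube_subset_compact[of k m]
        by (simp add: bounded_borel_def sets Q)
    qed
    from sparse_domination[OF D(2) R laminar_dyadic_cubes[OF D(1)] C L weak]
    obtain \<S> E where S: "\<S> \<subseteq> \<D>" "disjoint_family_on E \<S>"
      and E': "\<forall>Q\<in>\<S>. E Q \<in> bounded_borel \<mu> \<and> E Q \<subseteq> Q \<and> measure \<mu> Q / 2 \<le> measure \<mu> (E Q)"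
      and dom: "\<forall>x. \<exists>l. (\<forall>Q\<in>\<S>. 0 \<le> l Q \<and> norm (l Q) \<le> L * norm_avg Q * indicator Q x) \<and>
        (\<forall>Q\<in>\<D>. x \<in> Q \<longrightarrow> (\<exists>P\<in>\<S>. avg Q \<le> l P))"
      by (elim exE conjE)
    note E = E'[rule_format]
    have em: "emeasure \<mu> A = ennreal (measure \<mu> A)" if A: "A \<in> bounded_borel \<mu>" for A
    proof -
      obtain K where K: "compact K" "A \<subseteq> K" using A by (auto simp: bounded_borel_def)
      have "emeasure \<mu> A \<le> emeasure \<mu> K"
        using K by (intro emeasure_mono) (auto simp: sets intro: borel_compact)
      also have "\<dots> < \<infinity>" by (rule locally_finite_borel_compact[OF \<mu> K(1)])
      finally show ?thesis by (intro emeasure_eq_ennreal_measure) auto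
    qed
    have "sparse_collection \<mu> \<S>"
      unfolding sparse_collection_def
    proof (intro exI[of _ E] conjI ballI S(2))
      fix Q assume Q: "Q \<in> \<S>"
      show "E Q \<in> sets \<mu>" "E Q \<subseteq> Q" using E[OF Q] by (auto simp: bounded_borel_def)
      have "Q \<in> bounded_borel \<mu>" using Q S(1) R by blast
      then have "emeasure \<mu> Q / 2 = ennreal (measure \<mu> Q / 2)"
        by (simp add: em divide_ennreal[symmetric])
      also have "\<dots> \<le> emeasure \<mu> (E Q)" using E[OF Q] by (simp add: em ennreal_leI)
      finally show "emeasure \<mu> Q / 2 \<le> emeasure \<mu> (E Q)" .
    qed
    \<comment> \<open>The bound is obtained at every point, not only almost everywhere.\<close>
    moreover have "norm (lattice_maximal \<mu> \<D> f x) \<le> B * L * sparse_operator \<mu> q \<S> (\<lambda>y. norm (f y)) x" for x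
    proof -
      obtain l where l': "\<forall>Q\<in>\<S>. 0 \<le> l Q \<and> norm (l Q) \<le> L * norm_avg Q * indicator Q x"
        "\<forall>Q\<in>\<D>. x \<in> Q \<longrightarrow> (\<exists>P\<in>\<S>. avg Q \<le> l P)" using spec[OF dom, of x] by (elim exE conjE)
      note l = l'(1)[rule_format, THEN conjunct2] l'(2)[rule_format]
      have fin: "finite \<S>" using S(1) D(2) by (rule finite_subset)
      have nn: "0 \<le> norm_avg Q" if "Q \<in> \<S>" for Q using that S(1) R by (intro norm_avg_nonneg) blast
      have "norm (lattice_maximal \<mu> \<D> f x) \<le> B * (\<Sum>Q\<in>\<S>. norm (l Q) powr q) powr (1 / q)"
      \<comment> \<open>Cubes that do not contain \<open>x\<close> contribute 0, as does the
        inserted 0; this is why only nonnegative majorants \<open>w\<close> are tested.\<close>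
      proof (rule sup_bound[OF fin lattice_maximal_ge(1)[OF D(2)]], intro allI impI)
        fix w assume w: "0 \<le> w" "\<forall>Q\<in>\<S>. l Q \<le> w"
        show "lattice_maximal \<mu> \<D> f x \<le> w"
          unfolding lattice_maximal_def
        proof (rule Sup_fin_insert_least)
          fix a assume "a \<in> (\<lambda>Q. indicator Q x *\<^sub>R average \<mu> Q (\<lambda>y. \<bar>f y\<bar>)) ` \<D>"
          then obtain Q where Q: "Q \<in> \<D>" "a = indicator Q x *\<^sub>R avg Q" by (auto simp only: avg)
          show "a \<le> w"
          proof (cases "x \<in> Q")
            case True
            then obtain P where "P \<in> \<S>" "avg Q \<le> l P" using l(2)[OF Q(1)] by blast
            then have "avg Q \<le> w" using w(2) order_trans by blast
            then show ?thesis using Q(2) True by simp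
          next
            case False
            then show ?thesis using Q(2) w(1) by simp
          qed
        qed (use D(2) w(1) in auto)
      qed
      also have "\<dots> \<le> B * (L powr q * (\<Sum>Q\<in>\<S>. norm_avg Q powr q * indicator Q x)) powr (1 / q)"
      proof (intro mult_left_mono B powr_mono2 sum_nonneg)
        have "norm (l Q) powr q \<le> L powr q * (norm_avg Q powr q * indicator Q x)" if Q: "Q \<in> \<S>" for Q
        proof -
          have "norm (l Q) powr q \<le> (L * norm_avg Q * indicator Q x) powr q"
            using q l(1)[OF Q] by (intro powr_mono2) auto
          also have "\<dots> = L powr q * (norm_avg Q powr q * indicator Q x)"
            using L(1) nn[OF Q] q by (cases "x \<in> Q") (simp_all add: powr_mult)
          finally show ?thesis .
        qed
        then show "(\<Sum>Q\<in>\<S>. norm (l Q) powr q) \<le> L powr q * (\<Sum>Q\<in>\<S>. norm_avg Q powr q * indicator Q x)"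
          unfolding sum_distrib_left by (rule sum_mono)
      qed (use q in auto)
      also have "\<dots> = B * (L * (\<Sum>Q\<in>\<S>. norm_avg Q powr q * indicator Q x) powr (1 / q))"
      proof -
        have "(L powr q * z) powr (1 / q) = L * z powr (1 / q)" if "0 \<le> z" for z
          using L(1) q that by (simp add: powr_mult powr_powr)
        then show ?thesis by (simp only: sum_nonneg mult_nonneg_nonneg powr_ge_zero indicator_pos_le)
      qed
      also have "\<dots> = B * L * sparse_operator \<mu> q \<S> (\<lambda>y. norm (f y)) x"
        by (simp only: sparse_operator_def navg mult.assoc)
      finally show ?thesis .
    qed
    ultimately show "\<exists>\<S>\<subseteq>\<D>. sparse_collection \<mu> \<S> \<and>
        (AE x in \<mu>. norm (lattice_maximal \<mu> \<D> f x) \<le> B * L * sparse_operator \<mu> q \<S> (\<lambda>y. norm (f y)) x)"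
      using S(1) by (intro exI[of _ \<S>] conjI AE_I2)
  qed
qed

end
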